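(* Let $\mathbf{C}$ be a complete and cocomplete category and let $I$ be a set of maps of $\mathbf{C}$ such that the domains and the codomains of maps in $I$ are small relative to $I\text{-}\mathrm{cell}$. For every $i : U \to V$ in $I$, let $C_U(V)$ (with $\iota_0,\iota_1 : V \to C_U(V)$) be a chosen reflexive relative cylinder object for $i$ such that $[\iota_0,\iota_1] : V \amalg_U V \to C_U(V)$ belongs to $I\text{-}\mathrm{cof}$. Let $J_I = \{\iota_0 : V \to C_U(V) \mid (i : U \to V) \in I\}$, and let $\mathcal{W}_I$ be the class of maps that have the RLP up to $\sim_i$ with respect to every $i \in I$. There exists a model structure on $\mathbf{C}$ with $I\text{-}\mathrm{cof}$ as the class of cofibrations and $J_I\text{-}\mathrm{cof}$ as the class of trivial cofibrations if and only if the following condition holds: for every composable pair of maps $f \in J_I\text{-}\mathrm{cell} \cup \mathcal{W}_I$ and $g$, if $g \circ f \in \mathcal{W}_I$, then $g \in \mathcal{W}_I$.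
   Context: A relative cylinder object for $i : U \to V$ is an object $C_U(V)$ with maps $\iota_0,\iota_1 : V \to C_U(V)$ such that $\iota_0 \circ i = \iota_1 \circ i$; it is reflexive if there is a map $s : C_U(V) \to V$ with $s \circ \iota_0 = s \circ \iota_1 = \mathrm{id}_V$. For $a,b : V \to Y$, write $a \sim_i b$ if there is $h : C_U(V) \to Y$ with $h \circ \iota_0 = a$ and $h \circ \iota_1 = b$. A map $f : X \to Y$ has the RLP up to $\sim_i$ with respect to $i : U \to V$ if for all $u : U \to X$, $v : V \to Y$ with $f \circ u = v \circ i$ there is $k : V \to X$ with $k \circ i = u$ and $f \circ k \sim_i v$. For a class $K$ of maps: $K\text{-}\mathrm{inj}$ is the class of maps with the RLP with respect to all maps in $K$; $K\text{-}\mathrm{cof}$ is the class of maps with the LLP with respect to all maps in $K\text{-}\mathrm{inj}$; $K\text{-}\mathrm{cell}$ is the class of transfinite compositions of pushouts of elements of $K$. A model structure on a category consists of three classes (fibrations, cofibrations, weak equivalences) such that weak equivalences satisfy 2-out-of-3 and (cofibrations, fibrations that are weak equivalences) and (cofibrations that are weak equivalences, fibrations) are weak factorization systems. Trivial cofibrations are the cofibrations that are weak equivalences. *)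

theory Defs
  imports Main
begin

unbundle cardinal_syntax

section \<open>Size\<close>

text \<open>
  The distinction between sets and classes is expressed by a universe: a type \<open>'u\<close> of uncountable
  strongly inaccessible cardinality. A set (of elements of any type) is small if its cardinality
  is less than that of \<open>'u\<close>.  Nothing bounds the size of the collection of all objects or of all
  arrows of a category, so arbitrary HOL sets play the role of classes.
\<close>

definition universe :: "'u itself \<Rightarrow> bool" where
  "universe U \<longleftrightarrow>
     natLeq <o |UNIV :: 'u set| \<and>
     regularCard |UNIV :: 'u set| \<and>
     (\<forall>A :: 'u set. |A| <o |UNIV :: 'u set| \<longrightarrow> |Pow A| <o |UNIV :: 'u set| )"

definition small :: "'u itself \<Rightarrow> 'a set \<Rightarrow> bool" where
  "small U A \<longleftrightarrow> |A| <o |UNIV :: 'u set|"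


section \<open>Categories and functors\<close>

record ('o, 'm) cat =
  Obj :: "'o set"
  Arr :: "'m set"
  Dom :: "'m \<Rightarrow> 'o"
  Cod :: "'m \<Rightarrow> 'o"
  Id :: "'o \<Rightarrow> 'm"
  Comp :: "'m \<Rightarrow> 'm \<Rightarrow> 'm"  (infixl \<open>\<cdot>\<index>\<close> 70)

definition hom :: "('o, 'm) cat \<Rightarrow> 'o \<Rightarrow> 'o \<Rightarrow> 'm set" where
  "hom C X Y = {f \<in> Arr C. Dom C f = X \<and> Cod C f = Y}"

locale category =
  fixes C :: "('o, 'm) cat" (structure)
  assumes Dom_Obj: "f \<in> Arr C \<Longrightarrow> Dom C f \<in> Obj C"
    and Cod_Obj: "f \<in> Arr C \<Longrightarrow> Cod C f \<in> Obj C"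
    and Id_hom: "X \<in> Obj C \<Longrightarrow> Id C X \<in> hom C X X"
    and Comp_hom: "\<lbrakk>f \<in> hom C X Y; g \<in> hom C Y Z\<rbrakk> \<Longrightarrow> g \<cdot> f \<in> hom C X Z"
    and Id_Comp: "f \<in> hom C X Y \<Longrightarrow> Id C Y \<cdot> f = f"
    and Comp_Id: "f \<in> hom C X Y \<Longrightarrow> f \<cdot> Id C X = f"
    and Comp_assoc:
      "\<lbrakk>f \<in> hom C W X; g \<in> hom C X Y; h \<in> hom C Y Z\<rbrakk> \<Longrightarrow> (h \<cdot> g) \<cdot> f = h \<cdot> (g \<cdot> f)"

definition locally_small :: "'u itself \<Rightarrow> ('o, 'm) cat \<Rightarrow> bool" where
  "locally_small U C \<longleftrightarrow> (\<forall>X \<in> Obj C. \<forall>Y \<in> Obj C. small U (hom C X Y))"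

locale cat_functor =
  D: category D + C: category C
  for D :: "('j, 'k) cat" and C :: "('o, 'm) cat" +
  fixes F :: "'j \<Rightarrow> 'o" and F' :: "'k \<Rightarrow> 'm"
  assumes map_Obj: "j \<in> Obj D \<Longrightarrow> F j \<in> Obj C"
    and map_hom: "u \<in> hom D j k \<Longrightarrow> F' u \<in> hom C (F j) (F k)"
    and map_Id: "j \<in> Obj D \<Longrightarrow> F' (Id D j) = Id C (F j)"
    and map_Comp:
      "\<lbrakk>u \<in> hom D j k; v \<in> hom D k l\<rbrakk> \<Longrightarrow> F' (v \<cdot>\<^bsub>D\<^esub> u) = F' v \<cdot>\<^bsub>C\<^esub> F' u"


section \<open>Limits and colimits\<close>

definition is_cone ::
  "('j, 'k) cat \<Rightarrow> ('o, 'm) cat \<Rightarrow> ('j \<Rightarrow> 'o) \<Rightarrow> ('k \<Rightarrow> 'm) \<Rightarrow> 'o \<Rightarrow> ('j \<Rightarrow> 'm) \<Rightarrow> bool" where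
  "is_cone D C F F' L \<pi> \<longleftrightarrow>
     L \<in> Obj C \<and> (\<forall>j \<in> Obj D. \<pi> j \<in> hom C L (F j)) \<and>
     (\<forall>u \<in> Arr D. F' u \<cdot>\<^bsub>C\<^esub> \<pi> (Dom D u) = \<pi> (Cod D u))"

definition is_limit ::
  "('j, 'k) cat \<Rightarrow> ('o, 'm) cat \<Rightarrow> ('j \<Rightarrow> 'o) \<Rightarrow> ('k \<Rightarrow> 'm) \<Rightarrow> 'o \<Rightarrow> ('j \<Rightarrow> 'm) \<Rightarrow> bool" where
  "is_limit D C F F' L \<pi> \<longleftrightarrow>
     is_cone D C F F' L \<pi> \<and>
     (\<forall>M \<mu>. is_cone D C F F' M \<mu> \<longrightarrow>
        (\<exists>!h. h \<in> hom C M L \<and> (\<forall>j \<in> Obj D. \<pi> j \<cdot>\<^bsub>C\<^esub> h = \<mu> j)))"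

definition is_cocone ::
  "('j, 'k) cat \<Rightarrow> ('o, 'm) cat \<Rightarrow> ('j \<Rightarrow> 'o) \<Rightarrow> ('k \<Rightarrow> 'm) \<Rightarrow> 'o \<Rightarrow> ('j \<Rightarrow> 'm) \<Rightarrow> bool" where
  "is_cocone D C F F' L \<iota> \<longleftrightarrow>
     L \<in> Obj C \<and> (\<forall>j \<in> Obj D. \<iota> j \<in> hom C (F j) L) \<and>
     (\<forall>u \<in> Arr D. \<iota> (Cod D u) \<cdot>\<^bsub>C\<^esub> F' u = \<iota> (Dom D u))"

definition is_colimit ::
  "('j, 'k) cat \<Rightarrow> ('o, 'm) cat \<Rightarrow> ('j \<Rightarrow> 'o) \<Rightarrow> ('k \<Rightarrow> 'm) \<Rightarrow> 'o \<Rightarrow> ('j \<Rightarrow> 'm) \<Rightarrow> bool" where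
  "is_colimit D C F F' L \<iota> \<longleftrightarrow>
     is_cocone D C F F' L \<iota> \<and>
     (\<forall>M \<mu>. is_cocone D C F F' M \<mu> \<longrightarrow>
        (\<exists>!h. h \<in> hom C L M \<and> (\<forall>j \<in> Obj D. h \<cdot>\<^bsub>C\<^esub> \<iota> j = \<mu> j)))"

text \<open>
  Every category with small sets of objects and arrows is isomorphic to one whose objects and
  arrows are taken from \<open>'u\<close>, so these index categories suffice.
\<close>

definition complete :: "'u itself \<Rightarrow> ('o, 'm) cat \<Rightarrow> bool" where
  "complete U C \<longleftrightarrow>
     (\<forall>(D :: ('u, 'u) cat) F F'.
        small U (Obj D) \<and> small U (Arr D) \<and> cat_functor D C F F' \<longrightarrow>
        (\<exists>L \<pi>. is_limit D C F F' L \<pi>))"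

definition cocomplete :: "'u itself \<Rightarrow> ('o, 'm) cat \<Rightarrow> bool" where
  "cocomplete U C \<longleftrightarrow>
     (\<forall>(D :: ('u, 'u) cat) F F'.
        small U (Obj D) \<and> small U (Arr D) \<and> cat_functor D C F F' \<longrightarrow>
        (\<exists>L \<iota>. is_colimit D C F F' L \<iota>))"

text \<open>The square \<open>p \<cdot> f = q \<cdot> g\<close> is a pushout; in particular \<open>q\<close> is a pushout of \<open>f\<close> along \<open>g\<close>.\<close>

definition is_pushout :: "('o, 'm) cat \<Rightarrow> 'm \<Rightarrow> 'm \<Rightarrow> 'm \<Rightarrow> 'm \<Rightarrow> bool" where
  "is_pushout C f g p q \<longleftrightarrow>
     f \<in> Arr C \<and> g \<in> Arr C \<and> Dom C f = Dom C g \<and>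
     p \<in> hom C (Cod C f) (Cod C p) \<and> q \<in> hom C (Cod C g) (Cod C p) \<and>
     p \<cdot>\<^bsub>C\<^esub> f = q \<cdot>\<^bsub>C\<^esub> g \<and>
     (\<forall>Q. \<forall>a \<in> hom C (Cod C f) Q. \<forall>b \<in> hom C (Cod C g) Q. a \<cdot>\<^bsub>C\<^esub> f = b \<cdot>\<^bsub>C\<^esub> g \<longrightarrow>
        (\<exists>!h. h \<in> hom C (Cod C p) Q \<and> h \<cdot>\<^bsub>C\<^esub> p = a \<and> h \<cdot>\<^bsub>C\<^esub> q = b))"


section \<open>Transfinite sequences\<close>

text \<open>
  A small ordinal is represented by a well-order \<open>r\<close> on a small subset of \<open>'u\<close>. As a category it
  has the elements of \<open>r\<close> themselves as arrows: the pair \<open>(\<alpha>, \<beta>)\<close> is the arrow from \<open>\<alpha>\<close> to \<open>\<beta>\<close>.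
\<close>

definition ord_cat :: "'a rel \<Rightarrow> ('a, 'a \<times> 'a) cat" where
  "ord_cat r = \<lparr>Obj = Field r, Arr = r, Dom = fst, Cod = snd,
     Id = (\<lambda>\<alpha>. (\<alpha>, \<alpha>)), Comp = (\<lambda>v u. (fst u, snd v))\<rparr>"

definition is_succ :: "'a rel \<Rightarrow> 'a \<Rightarrow> 'a \<Rightarrow> bool" where
  "is_succ r \<alpha> \<beta> \<longleftrightarrow> \<alpha> \<in> underS r \<beta> \<and> (\<forall>\<gamma>. \<alpha> \<in> underS r \<gamma> \<longrightarrow> (\<beta>, \<gamma>) \<in> r)"

definition limit_point :: "'a rel \<Rightarrow> 'a \<Rightarrow> bool" where
  "limit_point r \<beta> \<longleftrightarrow> \<beta> \<in> Field r \<and> underS r \<beta> \<noteq> {} \<and> (\<nexists>\<alpha>. is_succ r \<alpha> \<beta>)"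

text \<open>
  A colimit-preserving functor \<open>X\<close> from the ordinal \<open>r\<close> to \<open>C\<close> such that each map
  \<open>X \<beta> \<rightarrow> X (\<beta> + 1)\<close> belongs to \<open>K\<close>.
\<close>

definition trans_seq ::
  "('o, 'm) cat \<Rightarrow> 'm set \<Rightarrow> 'a rel \<Rightarrow> ('a \<Rightarrow> 'o) \<Rightarrow> ('a \<times> 'a \<Rightarrow> 'm) \<Rightarrow> bool" where
  "trans_seq C K r X X' \<longleftrightarrow>
     Well_order r \<and> cat_functor (ord_cat r) C X X' \<and>
     (\<forall>\<beta>. limit_point r \<beta> \<longrightarrow>
        is_colimit (ord_cat (Restr r (underS r \<beta>))) C X X' (X \<beta>) (\<lambda>\<alpha>. X' (\<alpha>, \<beta>))) \<and>
     (\<forall>\<alpha> \<beta>. is_succ r \<alpha> \<beta> \<longrightarrow> X' (\<alpha>, \<beta>) \<in> K)"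

text \<open>
  The composition of a sequence is the map from its value at the least element (there is none for
  the empty ordinal, which is thereby excluded) to its colimit.
\<close>

definition trans_comps :: "'u itself \<Rightarrow> ('o, 'm) cat \<Rightarrow> 'm set \<Rightarrow> 'm set" where
  "trans_comps U C K =
     {\<iota> \<alpha> | (r :: 'u rel) X X' L \<iota> \<alpha>.
        small U (Field r) \<and> trans_seq C K r X X' \<and> is_colimit (ord_cat r) C X X' L \<iota> \<and>
        \<alpha> \<in> Field r \<and> underS r \<alpha> = {}}"

definition pushouts :: "('o, 'm) cat \<Rightarrow> 'm set \<Rightarrow> 'm set" where
  "pushouts C K = {q. \<exists>k \<in> K. \<exists>g p. is_pushout C k g p q}"

definition cell :: "'u itself \<Rightarrow> ('o, 'm) cat \<Rightarrow> 'm set \<Rightarrow> 'm set" where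
  "cell U C K = trans_comps U C (pushouts C K)"


section \<open>Small objects\<close>

text \<open>
  \<open>r\<close> is a nonzero limit ordinal in which every subset of cardinality at most \<open>\<kappa>\<close> is bounded. The
  cardinal is given by a set \<open>\<kappa>\<close> of that cardinality.
\<close>

definition filtered_ord :: "'u set \<Rightarrow> 'a rel \<Rightarrow> bool" where
  "filtered_ord \<kappa> r \<longleftrightarrow>
     Well_order r \<and> Field r \<noteq> {} \<and> (\<forall>\<alpha> \<in> Field r. \<exists>\<beta>. \<alpha> \<in> underS r \<beta>) \<and>
     (\<forall>A \<subseteq> Field r. |A| \<le>o |\<kappa>| \<longrightarrow> (\<exists>\<beta> \<in> Field r. \<forall>\<alpha> \<in> A. (\<alpha>, \<beta>) \<in> r))"

text \<open>
  The colimit of the sets \<open>hom C A (X \<beta>)\<close> is the quotient of their disjoint union by the relation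
  that identifies two maps when they become equal at a later stage. The map from it to
  \<open>hom C A L\<close> is induced by composition with \<open>\<iota>\<close>; it has the same value at all representatives.
\<close>

definition hom_sum :: "('o, 'm) cat \<Rightarrow> 'o \<Rightarrow> 'a rel \<Rightarrow> ('a \<Rightarrow> 'o) \<Rightarrow> ('a \<times> 'm) set" where
  "hom_sum C A r X = (SIGMA \<beta> : Field r. hom C A (X \<beta>))"

definition hom_rel ::
  "('o, 'm) cat \<Rightarrow> 'o \<Rightarrow> 'a rel \<Rightarrow> ('a \<Rightarrow> 'o) \<Rightarrow> ('a \<times> 'a \<Rightarrow> 'm) \<Rightarrow> ('a \<times> 'm) rel" where
  "hom_rel C A r X X' =
     {((\<beta>, f), (\<gamma>, g)).
        (\<beta>, f) \<in> hom_sum C A r X \<and> (\<gamma>, g) \<in> hom_sum C A r X \<and>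
        (\<exists>\<delta>. (\<beta>, \<delta>) \<in> r \<and> (\<gamma>, \<delta>) \<in> r \<and> X' (\<beta>, \<delta>) \<cdot>\<^bsub>C\<^esub> f = X' (\<gamma>, \<delta>) \<cdot>\<^bsub>C\<^esub> g)}"

definition hom_colim ::
  "('o, 'm) cat \<Rightarrow> 'o \<Rightarrow> 'a rel \<Rightarrow> ('a \<Rightarrow> 'o) \<Rightarrow> ('a \<times> 'a \<Rightarrow> 'm) \<Rightarrow> ('a \<times> 'm) set set" where
  "hom_colim C A r X X' = hom_sum C A r X // hom_rel C A r X X'"

definition hom_colim_map :: "('o, 'm) cat \<Rightarrow> ('a \<Rightarrow> 'm) \<Rightarrow> ('a \<times> 'm) set \<Rightarrow> 'm" where
  "hom_colim_map C \<iota> c = the_elem ((\<lambda>(\<beta>, f). \<iota> \<beta> \<cdot>\<^bsub>C\<^esub> f) ` c)"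

definition small_rel :: "'u itself \<Rightarrow> ('o, 'm) cat \<Rightarrow> 'm set \<Rightarrow> 'o \<Rightarrow> bool" where
  "small_rel U C K A \<longleftrightarrow>
     (\<exists>\<kappa> :: 'u set. small U \<kappa> \<and>
        (\<forall>(r :: 'u rel) X X' L \<iota>.
           small U (Field r) \<and> filtered_ord \<kappa> r \<and> trans_seq C K r X X' \<and>
           is_colimit (ord_cat r) C X X' L \<iota> \<longrightarrow>
           bij_betw (hom_colim_map C \<iota>) (hom_colim C A r X X') (hom C A L)))"


section \<open>Lifting properties and model structures\<close>

definition lifts :: "('o, 'm) cat \<Rightarrow> 'm \<Rightarrow> 'm \<Rightarrow> bool" where
  "lifts C i f \<longleftrightarrow>
     (\<forall>u \<in> hom C (Dom C i) (Dom C f). \<forall>v \<in> hom C (Cod C i) (Cod C f).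
        f \<cdot>\<^bsub>C\<^esub> u = v \<cdot>\<^bsub>C\<^esub> i \<longrightarrow>
        (\<exists>k \<in> hom C (Cod C i) (Dom C f). k \<cdot>\<^bsub>C\<^esub> i = u \<and> f \<cdot>\<^bsub>C\<^esub> k = v))"

definition RLP :: "('o, 'm) cat \<Rightarrow> 'm set \<Rightarrow> 'm set" where
  "RLP C K = {f \<in> Arr C. \<forall>i \<in> K. lifts C i f}"

definition LLP :: "('o, 'm) cat \<Rightarrow> 'm set \<Rightarrow> 'm set" where
  "LLP C K = {i \<in> Arr C. \<forall>f \<in> K. lifts C i f}"

definition inj_maps :: "('o, 'm) cat \<Rightarrow> 'm set \<Rightarrow> 'm set" where
  "inj_maps C K = RLP C K"

definition cof :: "('o, 'm) cat \<Rightarrow> 'm set \<Rightarrow> 'm set" where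
  "cof C K = LLP C (inj_maps C K)"

definition weak_fact_system :: "('o, 'm) cat \<Rightarrow> 'm set \<Rightarrow> 'm set \<Rightarrow> bool" where
  "weak_fact_system C L R \<longleftrightarrow>
     L = LLP C R \<and> R = RLP C L \<and>
     (\<forall>f \<in> Arr C. \<exists>l \<in> L. \<exists>r \<in> R. Cod C l = Dom C r \<and> r \<cdot>\<^bsub>C\<^esub> l = f)"

definition two_out_of_three :: "('o, 'm) cat \<Rightarrow> 'm set \<Rightarrow> bool" where
  "two_out_of_three C W \<longleftrightarrow>
     (\<forall>f \<in> Arr C. \<forall>g \<in> Arr C. Cod C f = Dom C g \<longrightarrow>
        (f \<in> W \<and> g \<in> W \<longrightarrow> g \<cdot>\<^bsub>C\<^esub> f \<in> W) \<and>
        (f \<in> W \<and> g \<cdot>\<^bsub>C\<^esub> f \<in> W \<longrightarrow> g \<in> W) \<and>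
        (g \<in> W \<and> g \<cdot>\<^bsub>C\<^esub> f \<in> W \<longrightarrow> f \<in> W))"

text \<open>The classes are, in this order, fibrations, cofibrations and weak equivalences.\<close>

definition model_structure :: "('o, 'm) cat \<Rightarrow> 'm set \<Rightarrow> 'm set \<Rightarrow> 'm set \<Rightarrow> bool" where
  "model_structure C Fib Cof W \<longleftrightarrow>
     W \<subseteq> Arr C \<and> two_out_of_three C W \<and>
     weak_fact_system C Cof (Fib \<inter> W) \<and> weak_fact_system C (Cof \<inter> W) Fib"


section \<open>Relative cylinder objects\<close>

text \<open>A relative cylinder object for \<open>i : U \<rightarrow> V\<close> consists of \<open>Z\<close> and \<open>e0, e1 : V \<rightarrow> Z\<close>.\<close>

definition rel_cylinder :: "('o, 'm) cat \<Rightarrow> 'm \<Rightarrow> 'o \<Rightarrow> 'm \<Rightarrow> 'm \<Rightarrow> bool" where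
  "rel_cylinder C i Z e0 e1 \<longleftrightarrow>
     Z \<in> Obj C \<and> e0 \<in> hom C (Cod C i) Z \<and> e1 \<in> hom C (Cod C i) Z \<and>
     e0 \<cdot>\<^bsub>C\<^esub> i = e1 \<cdot>\<^bsub>C\<^esub> i"

definition reflexive_cylinder :: "('o, 'm) cat \<Rightarrow> 'm \<Rightarrow> 'o \<Rightarrow> 'm \<Rightarrow> 'm \<Rightarrow> bool" where
  "reflexive_cylinder C i Z e0 e1 \<longleftrightarrow>
     rel_cylinder C i Z e0 e1 \<and>
     (\<exists>s \<in> hom C Z (Cod C i).
        s \<cdot>\<^bsub>C\<^esub> e0 = Id C (Cod C i) \<and> s \<cdot>\<^bsub>C\<^esub> e1 = Id C (Cod C i))"

text \<open>
  The map \<open>[e0, e1]\<close> out of the pushout of \<open>i\<close> along itself belongs to \<open>K\<close>. For classes \<open>K\<close>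
  invariant under isomorphism, the choice of the pushout does not matter.
\<close>

definition copair_in :: "('o, 'm) cat \<Rightarrow> 'm set \<Rightarrow> 'm \<Rightarrow> 'o \<Rightarrow> 'm \<Rightarrow> 'm \<Rightarrow> bool" where
  "copair_in C K i Z e0 e1 \<longleftrightarrow>
     (\<exists>j0 j1. is_pushout C i i j0 j1 \<and>
        (\<exists>c \<in> hom C (Cod C j0) Z. c \<cdot>\<^bsub>C\<^esub> j0 = e0 \<and> c \<cdot>\<^bsub>C\<^esub> j1 = e1 \<and> c \<in> K))"

text \<open>The relation \<open>a \<sim>\<^sub>i b\<close> for the cylinder \<open>Z, e0, e1\<close> and maps \<open>a, b\<close> with codomain \<open>Y\<close>:\<close>

definition homotopic ::
  "('o, 'm) cat \<Rightarrow> 'o \<Rightarrow> 'm \<Rightarrow> 'm \<Rightarrow> 'o \<Rightarrow> 'm \<Rightarrow> 'm \<Rightarrow> bool" where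
  "homotopic C Z e0 e1 Y a b \<longleftrightarrow>
     (\<exists>h \<in> hom C Z Y. h \<cdot>\<^bsub>C\<^esub> e0 = a \<and> h \<cdot>\<^bsub>C\<^esub> e1 = b)"

definition lifts_upto :: "('o, 'm) cat \<Rightarrow> 'm \<Rightarrow> 'o \<Rightarrow> 'm \<Rightarrow> 'm \<Rightarrow> 'm \<Rightarrow> bool" where
  "lifts_upto C i Z e0 e1 f \<longleftrightarrow>
     (\<forall>u \<in> hom C (Dom C i) (Dom C f). \<forall>v \<in> hom C (Cod C i) (Cod C f).
        f \<cdot>\<^bsub>C\<^esub> u = v \<cdot>\<^bsub>C\<^esub> i \<longrightarrow>
        (\<exists>k \<in> hom C (Cod C i) (Dom C f).
           k \<cdot>\<^bsub>C\<^esub> i = u \<and> homotopic C Z e0 e1 (Cod C f) (f \<cdot>\<^bsub>C\<^esub> k) v))"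

text \<open>In the following, \<open>Cyl i\<close> with \<open>\<iota>0 i\<close> and \<open>\<iota>1 i\<close> is the cylinder chosen for \<open>i \<in> I\<close>.\<close>

definition W_maps ::
  "('o, 'm) cat \<Rightarrow> 'm set \<Rightarrow> ('m \<Rightarrow> 'o) \<Rightarrow> ('m \<Rightarrow> 'm) \<Rightarrow> ('m \<Rightarrow> 'm) \<Rightarrow> 'm set" where
  "W_maps C I Cyl \<iota>0 \<iota>1 =
     {f \<in> Arr C. \<forall>i \<in> I. lifts_upto C i (Cyl i) (\<iota>0 i) (\<iota>1 i) f}"

definition J_maps :: "'m set \<Rightarrow> ('m \<Rightarrow> 'm) \<Rightarrow> 'm set" where
  "J_maps I \<iota>0 = {\<iota>0 i | i. i \<in> I}"

end

theory Submission
  imports Defs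
begin

text \<open>
  Cofibrations are the maps in \<open>I-cof\<close> and trivial fibrations those in \<open>I-inj\<close>; the classes of
  trivial cofibrations and fibrations are to be \<open>J-cof\<close> and \<open>J-inj\<close>, where \<open>J\<close> consists of the maps
  \<open>\<iota>0\<close>. The retractions of the cylinders make every object fibrant (\<open>extension_along_cof_J\<close>), so each
  map in \<open>J-cof\<close> has a retraction. The weak equivalences can only be the composites of a map in
  \<open>J-cof\<close> followed by one in \<open>I-inj\<close>; they form the class \<open>Weq\<close>. The theorem compares them with the
  maps in \<open>W\<close>, which lift up to homotopy.

  Two observations link the classes. A lift up to homotopy against a fibration can be corrected along
  the homotopy, so that \<open>I-inj\<close> is the intersection of \<open>J-inj\<close> and \<open>W\<close> (\<open>inj_I_eq\<close>). And if a map
  \<open>g\<close> is in \<open>Weq\<close>, then each square from a cofibration to \<open>g\<close> has a diagonal that makes the upper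
  triangle commute (\<open>upper_lift_Weq\<close>). Applied to \<open>[\<iota>0, \<iota>1]\<close>, this lifts homotopies along \<open>g\<close>; if
  \<open>g\<close> is a retraction of \<open>q\<close>, it shows that \<open>q\<close> and \<open>g\<close> are inverse up to homotopy
  (\<open>retraction_homotopy\<close>).

  Suppose the cancellation condition. In a factorization \<open>f = p \<cdot> q\<close> of a map in \<open>W\<close> with \<open>q\<close> in
  \<open>J-cell\<close> and \<open>p\<close> in \<open>J-inj\<close>, the map \<open>p\<close> is in \<open>W\<close> and thus in \<open>I-inj\<close>. Therefore \<open>W\<close> is contained
  in \<open>Weq\<close>. Retractions of maps in \<open>J-cell\<close> are in \<open>W\<close>, again by cancellation; this gives the
  converse inclusion, and the axioms follow (\<open>model_structure_of_cancellation\<close>). Conversely, in a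
  model structure the weak equivalences form the class \<open>Weq\<close>, which is contained in \<open>W\<close>. A map \<open>f\<close>
  in \<open>W\<close> is a weak equivalence because the projection from its mapping path space to its codomain
  lifts strictly against \<open>I\<close>: a lift up to homotopy for \<open>f\<close> becomes a lift once the homotopy is
  recorded in the path component (\<open>weak_equivalences_eq_W\<close>). The condition is then part of
  2-out-of-3.

  The factorizations come from the small object argument. Codomains of maps in \<open>I\<close> are assumed small
  relative to \<open>I-cell\<close>, whereas the argument for \<open>J\<close> needs sequences of pushouts of maps in \<open>J\<close>, which
  are merely in \<open>I-cof\<close>; \<open>weakly_small_cof\<close> bridges the gap by exhibiting such a sequence as a retract
  of one with steps in \<open>I-cell\<close>. Cells are attached one at a time, so that the left factors are
  transfinite compositions of pushouts of single maps, as the definition of \<open>cell\<close> requires.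
\<close>

section \<open>Arrows and lifting properties\<close>

lemma homI: "\<lbrakk>f \<in> Arr C; Dom C f = X; Cod C f = Y\<rbrakk> \<Longrightarrow> f \<in> hom C X Y"
  by (simp add: hom_def)

lemma homD:
  assumes "f \<in> hom C X Y"
  shows "f \<in> Arr C" "Dom C f = X" "Cod C f = Y"
  using assms by (simp_all add: hom_def)

lemma inj_maps_Arr: "f \<in> inj_maps C K \<Longrightarrow> f \<in> Arr C"
  by (simp add: inj_maps_def RLP_def)

lemma cof_Arr: "f \<in> cof C K \<Longrightarrow> f \<in> Arr C"
  by (simp add: cof_def LLP_def)

lemma cof_lifts: "\<lbrakk>j \<in> cof C K; p \<in> inj_maps C K\<rbrakk> \<Longrightarrow> lifts C j p"
  by (simp add: cof_def LLP_def)

lemma liftsD: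
  assumes "lifts C i f" "u \<in> hom C (Dom C i) (Dom C f)" "v \<in> hom C (Cod C i) (Cod C f)"
    and "Comp C f u = Comp C v i"
  obtains k where "k \<in> hom C (Cod C i) (Dom C f)" "Comp C k i = u" "Comp C f k = v"
  using assms unfolding lifts_def by blast

lemma is_pushoutD:
  assumes "is_pushout C f g p q"
  shows "f \<in> Arr C" "g \<in> Arr C" "Dom C f = Dom C g"
    "p \<in> hom C (Cod C f) (Cod C p)" "q \<in> hom C (Cod C g) (Cod C p)" "Cod C q = Cod C p"
    "Comp C p f = Comp C q g"
  using assms by (auto simp: is_pushout_def hom_def)

lemma is_pushout_induced:
  assumes "is_pushout C f g p q" "a \<in> hom C (Cod C f) Q" "b \<in> hom C (Cod C g) Q"
    and "Comp C a f = Comp C b g"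
  obtains h where "h \<in> hom C (Cod C p) Q" "Comp C h p = a" "Comp C h q = b"
  using assms unfolding is_pushout_def by blast

lemma is_pushout_eqI:
  assumes "is_pushout C f g p q" "h \<in> hom C (Cod C p) Q" "h' \<in> hom C (Cod C p) Q"
    and "Comp C h p = Comp C h' p" "Comp C h q = Comp C h' q"
    and "category C"
  shows "h = h'"
proof -
  interpret category C by fact
  note po = is_pushoutD[OF assms(1)]
  have "\<exists>!h. h \<in> hom C (Cod C p) Q \<and> Comp C h p = Comp C h' p \<and> Comp C h q = Comp C h' q"
  proof -
    have "Comp C h' p \<in> hom C (Cod C f) Q" "Comp C h' q \<in> hom C (Cod C g) Q"
      using Comp_hom[OF po(4) assms(3)] Comp_hom[OF po(5) assms(3)] .
    moreover have "Comp C (Comp C h' p) f = Comp C (Comp C h' q) g"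
      using Comp_assoc[OF _ po(4) assms(3), of f "Dom C f"]
        Comp_assoc[OF _ po(5) assms(3), of g "Dom C g"] po by (simp add: homI)
    ultimately show ?thesis using assms(1) unfolding is_pushout_def by blast
  qed
  then show ?thesis using assms by auto
qed

lemma is_pushout_sym:
  assumes "is_pushout C f g p q" shows "is_pushout C g f q p"
  unfolding is_pushout_def
proof (intro conjI allI ballI impI)
  note po = is_pushoutD[OF assms]
  show "g \<in> Arr C" "f \<in> Arr C" "Dom C g = Dom C f" using po by simp_all
  show "q \<in> hom C (Cod C g) (Cod C q)" "p \<in> hom C (Cod C f) (Cod C q)"
    using po(4,5) by (simp_all add: po(6))
  show "Comp C q g = Comp C p f" using po by simp
  fix Q a b assume "a \<in> hom C (Cod C g) Q" "b \<in> hom C (Cod C f) Q" "Comp C a g = Comp C b f"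
  then have "\<exists>!h. h \<in> hom C (Cod C p) Q \<and> Comp C h p = b \<and> Comp C h q = a"
    using assms unfolding is_pushout_def by metis
  then show "\<exists>!h. h \<in> hom C (Cod C q) Q \<and> Comp C h q = a \<and> Comp C h p = b"
    unfolding po(6) by blast
qed

context category begin

lemma Arr_hom: "f \<in> Arr C \<Longrightarrow> f \<in> hom C (Dom C f) (Cod C f)"
  by (simp add: hom_def)

lemma hom_Obj: "f \<in> hom C X Y \<Longrightarrow> X \<in> Obj C" "f \<in> hom C X Y \<Longrightarrow> Y \<in> Obj C"
  using Dom_Obj Cod_Obj by (auto simp: hom_def)

lemma Arr_Comp:
  assumes "f \<in> Arr C" "g \<in> Arr C" "Cod C f = Dom C g"
  shows "g \<cdot> f \<in> Arr C" "Dom C (g \<cdot> f) = Dom C f" "Cod C (g \<cdot> f) = Cod C g"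
  using Comp_hom[of f "Dom C f" "Cod C f" g "Cod C g"] assms by (auto simp: hom_def)

lemma Arr_Id:
  assumes "X \<in> Obj C"
  shows "Id C X \<in> Arr C" "Dom C (Id C X) = X" "Cod C (Id C X) = X"
  using Id_hom[OF assms] by (auto simp: hom_def)

lemma assoc:
  assumes "f \<in> Arr C" "g \<in> Arr C" "h \<in> Arr C" "Cod C f = Dom C g" "Cod C g = Dom C h"
  shows "h \<cdot> g \<cdot> f = h \<cdot> (g \<cdot> f)"
  using Comp_assoc[of f "Dom C f" "Cod C f" g "Cod C g" h "Cod C h"] assms by (simp add: hom_def)

lemma Id_left: "\<lbrakk>f \<in> Arr C; Cod C f = Y\<rbrakk> \<Longrightarrow> Id C Y \<cdot> f = f"
  using Id_Comp[of f "Dom C f" Y] by (simp add: hom_def)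

lemma Id_right: "\<lbrakk>f \<in> Arr C; Dom C f = X\<rbrakk> \<Longrightarrow> f \<cdot> Id C X = f"
  using Comp_Id[of f X "Cod C f"] by (simp add: hom_def)

lemmas cat_simps = Arr_Comp Arr_Id Id_left Id_right assoc Dom_Obj Cod_Obj

lemma Comp_left_eq:
  assumes "g \<cdot> f = h" "f \<in> Arr C" "g \<in> Arr C" "Cod C f = Dom C g" "e \<in> Arr C" "Cod C e = Dom C f"
  shows "g \<cdot> (f \<cdot> e) = h \<cdot> e"
  using assms assoc[of e f g] by auto

lemma liftsI:
  assumes "\<And>u v. \<lbrakk>u \<in> hom C (Dom C i) (Dom C f); v \<in> hom C (Cod C i) (Cod C f); f \<cdot> u = v \<cdot> i\<rbrakk>
    \<Longrightarrow> \<exists>k \<in> hom C (Cod C i) (Dom C f). k \<cdot> i = u \<and> f \<cdot> k = v"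
  shows "lifts C i f"
  using assms unfolding lifts_def by blast

lemma lifts_Comp_left:
  assumes "i \<in> Arr C" "j \<in> Arr C" "Cod C i = Dom C j" "f \<in> Arr C" "lifts C i f" "lifts C j f"
  shows "lifts C (j \<cdot> i) f"
proof (rule liftsI)
  fix u v assume u: "u \<in> hom C (Dom C (j \<cdot> i)) (Dom C f)" and v: "v \<in> hom C (Cod C (j \<cdot> i)) (Cod C f)"
    and sq: "f \<cdot> u = v \<cdot> (j \<cdot> i)"
  have t: "u \<in> Arr C" "Dom C u = Dom C i" "Cod C u = Dom C f"
    "v \<in> Arr C" "Dom C v = Cod C j" "Cod C v = Cod C f"
    using u v assms by (auto simp: hom_def cat_simps)
  obtain k where k: "k \<in> hom C (Cod C i) (Dom C f)" "k \<cdot> i = u" "f \<cdot> k = v \<cdot> j"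
    by (rule liftsD[OF assms(5), of u "v \<cdot> j"]) (use t assms sq in \<open>auto simp: hom_def cat_simps\<close>)
  obtain l where l: "l \<in> hom C (Cod C j) (Dom C f)" "l \<cdot> j = k" "f \<cdot> l = v"
    by (rule liftsD[OF assms(6), of k v]) (use t assms k in \<open>auto simp: hom_def cat_simps\<close>)
  have "l \<cdot> (j \<cdot> i) = u" using k l assms assoc[of i j l] by (auto simp: hom_def)
  then show "\<exists>k\<in>hom C (Cod C (j \<cdot> i)) (Dom C f). k \<cdot> (j \<cdot> i) = u \<and> f \<cdot> k = v"
    using l assms by (auto simp: cat_simps)
qed

lemma lifts_Comp_right:
  assumes "f \<in> Arr C" "g \<in> Arr C" "Cod C f = Dom C g" "i \<in> Arr C" "lifts C i f" "lifts C i g"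
  shows "lifts C i (g \<cdot> f)"
proof (rule liftsI)
  fix u v assume u: "u \<in> hom C (Dom C i) (Dom C (g \<cdot> f))" and v: "v \<in> hom C (Cod C i) (Cod C (g \<cdot> f))"
    and sq: "g \<cdot> f \<cdot> u = v \<cdot> i"
  have t: "u \<in> Arr C" "Dom C u = Dom C i" "Cod C u = Dom C f"
    "v \<in> Arr C" "Dom C v = Cod C i" "Cod C v = Cod C g"
    using u v assms by (auto simp: hom_def cat_simps)
  obtain k where k: "k \<in> hom C (Cod C i) (Dom C g)" "k \<cdot> i = f \<cdot> u" "g \<cdot> k = v"
    by (rule liftsD[OF assms(6), of "f \<cdot> u" v]) (use t assms sq in \<open>auto simp: hom_def cat_simps\<close>)
  obtain l where l: "l \<in> hom C (Cod C i) (Dom C f)" "l \<cdot> i = u" "f \<cdot> l = k"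
    by (rule liftsD[OF assms(5), of u k]) (use t assms k in \<open>auto simp: hom_def cat_simps\<close>)
  have "g \<cdot> f \<cdot> l = v" using k l assms assoc[of l f g] by (auto simp: hom_def)
  then show "\<exists>k\<in>hom C (Cod C i) (Dom C (g \<cdot> f)). k \<cdot> i = u \<and> g \<cdot> f \<cdot> k = v"
    using l assms by (auto simp: cat_simps)
qed

lemma lifts_pushout:
  assumes po: "is_pushout C k g p q" and "f \<in> Arr C" and l: "lifts C k f"
  shows "lifts C q f"
proof (rule liftsI)
  note t0 = is_pushoutD[OF po]
  fix u v assume u: "u \<in> hom C (Dom C q) (Dom C f)" and v: "v \<in> hom C (Cod C q) (Cod C f)"
    and sq: "f \<cdot> u = v \<cdot> q"
  have t: "p \<in> Arr C" "Dom C p = Cod C k" "q \<in> Arr C" "Dom C q = Cod C g" "Cod C q = Cod C p"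
     "u \<in> Arr C" "Dom C u = Cod C g" "Cod C u = Dom C f"
    "v \<in> Arr C" "Dom C v = Cod C p" "Cod C v = Cod C f" "p \<cdot> k = q \<cdot> g"
    using t0 u v by (auto simp: hom_def)
  have "f \<cdot> (u \<cdot> g) = f \<cdot> u \<cdot> g" using assoc[of g u f] t t0 assms by simp
  also have "\<dots> = v \<cdot> p \<cdot> k" using t t0 assms by (simp add: sq assoc)
  finally have sq': "f \<cdot> (u \<cdot> g) = v \<cdot> p \<cdot> k" .
  obtain m where m: "m \<in> hom C (Cod C k) (Dom C f)" "m \<cdot> k = u \<cdot> g" "f \<cdot> m = v \<cdot> p"
    by (rule liftsD[OF l _ _ sq']) (use t t0 assms in \<open>auto simp: hom_def cat_simps\<close>)
  obtain h where h: "h \<in> hom C (Cod C p) (Dom C f)" "h \<cdot> p = m" "h \<cdot> q = u"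
    by (rule is_pushout_induced[OF po, of m "Dom C f" u]) (use t m in \<open>auto simp: hom_def\<close>)
  have "f \<cdot> h = v"
    by (rule is_pushout_eqI[OF po, where Q = "Cod C f"])
      (use t h m sq assms category_axioms in \<open>auto simp: hom_def cat_simps\<close>)
  then show "\<exists>k\<in>hom C (Cod C q) (Dom C f). k \<cdot> q = u \<and> f \<cdot> k = v"
    using h t by auto
qed

lemma retract_argument:
  assumes "q \<in> Arr C" "p \<in> Arr C" "Cod C q = Dom C p" "f = p \<cdot> q" "lifts C f p"
  obtains s where "s \<in> hom C (Cod C f) (Cod C q)" "s \<cdot> f = q" "p \<cdot> s = Id C (Cod C f)"
proof -
  have f: "f \<in> Arr C" "Dom C f = Dom C q" "Cod C f = Cod C p" using assms by (auto simp: cat_simps)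
  show ?thesis
    by (rule liftsD[OF assms(5), of q "Id C (Cod C p)"])
      (use assms f that in \<open>auto simp: hom_def cat_simps\<close>)
qed

lemma lifts_retract:
  assumes "q \<in> Arr C" "p \<in> Arr C" "Cod C q = Dom C p" "f = p \<cdot> q"
    and s: "s \<in> hom C (Cod C f) (Cod C q)" "s \<cdot> f = q" "p \<cdot> s = Id C (Cod C f)"
    and g: "g \<in> Arr C" "lifts C q g"
  shows "lifts C f g"
proof (rule liftsI)
  fix u v assume u: "u \<in> hom C (Dom C f) (Dom C g)" and v: "v \<in> hom C (Cod C f) (Cod C g)"
    and sq: "g \<cdot> u = v \<cdot> f"
  have f: "f \<in> Arr C" "Dom C f = Dom C q" "Cod C f = Cod C p" using assms by (auto simp: cat_simps)
  have t: "u \<in> Arr C" "Dom C u = Dom C q" "Cod C u = Dom C g"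
    "v \<in> Arr C" "Dom C v = Cod C p" "Cod C v = Cod C g"
    "s \<in> Arr C" "Dom C s = Cod C p" "Cod C s = Dom C p"
    using u v s f assms by (auto simp: hom_def cat_simps)
  obtain k where k: "k \<in> hom C (Cod C q) (Dom C g)" "k \<cdot> q = u" "g \<cdot> k = v \<cdot> p"
    by (rule liftsD[OF g(2), of u "v \<cdot> p"]) (use t assms sq in \<open>auto simp: hom_def cat_simps\<close>)
  have kt: "k \<in> Arr C" "Dom C k = Dom C p" "Cod C k = Dom C g" using k assms by (auto simp: hom_def)
  have "g \<cdot> (k \<cdot> s) = v"
    using Comp_left_eq[OF k(3), of s] kt t g assms(1-3) s(3) f(3) by (simp add: cat_simps)
  moreover have "k \<cdot> s \<cdot> f = u" using kt t f s(2) k(2) assms(1-3) by (simp add: assoc)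
  ultimately show "\<exists>k\<in>hom C (Cod C f) (Dom C g). k \<cdot> f = u \<and> g \<cdot> k = v"
    using kt t f by (intro bexI[of _ "k \<cdot> s"]) (auto simp: hom_def cat_simps)
qed

lemma sub_cof: "K \<subseteq> Arr C \<Longrightarrow> K \<subseteq> cof C K"
  by (auto simp: cof_def LLP_def inj_maps_def RLP_def)

lemma RLP_cof: "K \<subseteq> Arr C \<Longrightarrow> RLP C (cof C K) = inj_maps C K"
  using sub_cof[of K] by (auto simp: cof_def LLP_def inj_maps_def RLP_def)

lemma cof_Comp:
  assumes "i \<in> cof C K" "j \<in> cof C K" "Cod C i = Dom C j"
  shows "j \<cdot> i \<in> cof C K"
  using assms lifts_Comp_left[of i j]
  by (auto simp: cof_def LLP_def cat_simps inj_maps_def RLP_def)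

lemma inj_maps_Comp:
  assumes "f \<in> inj_maps C K" "g \<in> inj_maps C K" "Cod C f = Dom C g" "K \<subseteq> Arr C"
  shows "g \<cdot> f \<in> inj_maps C K"
  using assms lifts_Comp_right[of f g] by (auto simp: cat_simps inj_maps_def RLP_def)

lemma cof_pushout:
  assumes "is_pushout C k g p q" "k \<in> cof C K" shows "q \<in> cof C K"
  using lifts_pushout[OF assms(1)] assms is_pushoutD(5)[OF assms(1)]
  by (auto simp: cof_def LLP_def hom_def inj_maps_def RLP_def)

lemma inj_maps_mono: "J \<subseteq> cof C K \<Longrightarrow> inj_maps C K \<subseteq> inj_maps C J"
  by (auto simp: cof_def LLP_def inj_maps_def RLP_def)

lemma cof_mono: "J \<subseteq> cof C K \<Longrightarrow> cof C J \<subseteq> cof C K"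
  using inj_maps_mono[of J K] by (auto simp: cof_def LLP_def)

lemma Id_inj_maps:
  assumes "X \<in> Obj C" "K \<subseteq> Arr C" shows "Id C X \<in> inj_maps C K"
proof -
  have "lifts C i (Id C X)" if "i \<in> K" for i
    using that assms by (intro liftsI) (auto simp: cat_simps hom_def)
  then show ?thesis using assms by (auto simp: inj_maps_def RLP_def cat_simps)
qed

end

section \<open>Small sets\<close>

lemma small_mono: "\<lbrakk>small U A; B \<subseteq> A\<rbrakk> \<Longrightarrow> small U B"
  unfolding small_def using card_of_mono1 ordLeq_ordLess_trans by blast

lemma small_image: "small U A \<Longrightarrow> small U (f ` A)"
  unfolding small_def using card_of_image ordLeq_ordLess_trans by blast

lemma small_ordLeq: "\<lbrakk>small U A; |B| \<le>o |A|\<rbrakk> \<Longrightarrow> small U B"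
  unfolding small_def using ordLeq_ordLess_trans by blast

lemma small_embedding:
  assumes "small (U :: 'u itself) A"
  obtains e :: "'a \<Rightarrow> 'u" where "inj_on e A"
proof -
  have "|A| \<le>o |UNIV :: 'u set|" using assms unfolding small_def by (rule ordLess_imp_ordLeq)
  then show ?thesis using that card_of_ordLeq[of A "UNIV :: 'u set"] by auto
qed

lemma universe_infinite: "universe (U :: 'u itself) \<Longrightarrow> infinite (UNIV :: 'u set)"
  unfolding universe_def infinite_iff_card_of_nat
  using ordLess_imp_ordLeq ordIso_ordLeq_trans card_of_nat by blast

lemma small_UN:
  assumes "universe (U :: 'u itself)" "small U A" "\<And>a. a \<in> A \<Longrightarrow> small U (F a)"
  shows "small U (\<Union>a\<in>A. F a)"
proof -
  have "stable |UNIV :: 'u set|"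
    using assms(1) universe_infinite[OF assms(1)]
    by (auto simp: universe_def card_of_card_order_on Field_card_of intro!: regularCard_stable)
  from stable_UNION[OF this] show ?thesis using assms(2,3) unfolding small_def by auto
qed

lemma small_Sigma:
  assumes "universe (U :: 'u itself)" "small U A" "\<And>a. a \<in> A \<Longrightarrow> small U (F a)"
  shows "small U (SIGMA a : A. F a)"
proof -
  have "(SIGMA a : A. F a) = (\<Union>a\<in>A. Pair a ` F a)" by auto
  then show ?thesis using small_UN[OF assms(1,2), of "\<lambda>a. Pair a ` F a"] small_image[OF assms(3)]
    by (simp only:) blast
qed

lemma small_natLeq:
  assumes "universe (U :: 'u itself)" "|A| \<le>o natLeq" shows "small U A"
  using assms ordLeq_ordLess_trans unfolding universe_def small_def by blast

lemma small_finite: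
  assumes "universe (U :: 'u itself)" "finite A" shows "small U A"
proof (rule small_natLeq[OF assms(1)])
  have "|A| <o |UNIV :: nat set|"
    using assms(2) by (intro finite_ordLess_infinite) (simp_all add: Field_card_of card_of_well_order_on)
  then show "|A| \<le>o natLeq"
    using card_of_nat ordLess_ordIso_trans ordLess_imp_ordLeq by blast
qed

lemma small_Pow:
  assumes "universe (U :: 'u itself)" "small U A" shows "small U (Pow A)"
proof -
  obtain e :: "'a \<Rightarrow> 'u" where e: "inj_on e A" using small_embedding assms(2) by blast
  have "small U (Pow (e ` A))"
    using small_image[OF assms(2), of e] assms(1) by (simp add: small_def universe_def)
  moreover have "inj_on ((`) e) (Pow A)" using e by (rule inj_on_image_Pow)
  then have "|Pow A| \<le>o |Pow (e ` A)|" using card_of_ordLeq[of "Pow A" "Pow (e ` A)"] by blast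
  ultimately show ?thesis by (rule small_ordLeq)
qed


section \<open>Diagrams of arbitrary small shape\<close>

text \<open>
  Cocompleteness speaks of diagrams whose objects and arrows are elements of the universe. A small
  category of any other type is isomorphic to such a category, and colimits do not change along the
  isomorphism.
\<close>

definition relabel :: "('j \<Rightarrow> 'a) \<Rightarrow> ('k \<Rightarrow> 'b) \<Rightarrow> ('j, 'k) cat \<Rightarrow> ('a, 'b) cat" where
  "relabel e e' D =
     \<lparr>Obj = e ` Obj D, Arr = e' ` Arr D,
      Dom = (\<lambda>u. e (Dom D (inv_into (Arr D) e' u))), Cod = (\<lambda>u. e (Cod D (inv_into (Arr D) e' u))),
      Id = (\<lambda>x. e' (Id D (inv_into (Obj D) e x))),
      Comp = (\<lambda>v u. e' (Comp D (inv_into (Arr D) e' v) (inv_into (Arr D) e' u)))\<rparr>"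

lemma relabel_functor:
  assumes F: "cat_functor D C F F'" and e: "inj_on e (Obj D)" and e': "inj_on e' (Arr D)"
  shows "cat_functor (relabel e e' D) C (F \<circ> inv_into (Obj D) e) (F' \<circ> inv_into (Arr D) e')"
proof -
  interpret cat_functor D C F F' by fact
  let ?D = "relabel e e' D"
  have inv: "x \<in> Obj D \<Longrightarrow> inv_into (Obj D) e (e x) = x" "u \<in> Arr D \<Longrightarrow> inv_into (Arr D) e' (e' u) = u"
    for x u using e e' by simp_all
  have homE: "\<exists>u. a = e' u \<and> u \<in> Arr D \<and> x = e (Dom D u) \<and> y = e (Cod D u)"
    if "a \<in> hom ?D x y" for a x y
    using that inv by (auto simp: hom_def relabel_def)
  have homI: "e' u \<in> hom ?D x y" if "u \<in> Arr D" "x = e (Dom D u)" "y = e (Cod D u)" for u x y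
    using that inv by (auto simp: hom_def relabel_def)
  have homO: "x = y" if "e x = e y" "x \<in> Obj D" "y \<in> Obj D" for x y
    using that e by (auto dest: inj_onD)
  show ?thesis
  proof (unfold_locales, goal_cases)
    case (1 f) then show ?case by (auto simp: relabel_def inv intro: D.Dom_Obj)
  next
    case (2 f) then show ?case by (auto simp: relabel_def inv intro: D.Cod_Obj)
  next
    case (3 X) then show ?case
      by (auto simp: relabel_def hom_def inv D.Arr_Id)
  next
    case (4 f X Y g Z)
    from homE[OF 4(1)] homE[OF 4(2)] obtain a b where
      ab: "f = e' a" "a \<in> Arr D" "X = e (Dom D a)" "Y = e (Cod D a)"
        "g = e' b" "b \<in> Arr D" "Y = e (Dom D b)" "Z = e (Cod D b)" by metis
    then have "Cod D a = Dom D b" by (intro homO) (auto intro: D.Dom_Obj D.Cod_Obj)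
    then show ?case using ab by (auto simp: relabel_def hom_def inv D.Arr_Comp)
  next
    case (5 f X Y)
    from homE[OF 5] show ?case by (auto simp: relabel_def inv D.cat_simps)
  next
    case (6 f X Y)
    from homE[OF 6] show ?case by (auto simp: relabel_def inv D.cat_simps)
  next
    case (7 f W X g Y h Z)
    from homE[OF 7(1)] homE[OF 7(2)] homE[OF 7(3)] obtain a b c where
      ab: "f = e' a" "a \<in> Arr D" "X = e (Cod D a)"
        "g = e' b" "b \<in> Arr D" "X = e (Dom D b)" "Y = e (Cod D b)"
        "h = e' c" "c \<in> Arr D" "Y = e (Dom D c)" by metis
    then have "Cod D a = Dom D b" "Cod D b = Dom D c"
      by (auto intro!: homO intro: D.Dom_Obj D.Cod_Obj)
    then show ?case using ab by (simp add: relabel_def inv D.cat_simps)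
  next
    case (8 j) then show ?case by (auto simp: relabel_def inv map_Obj)
  next
    case (9 u j k)
    from homE[OF 9] show ?case
      by (auto simp: relabel_def inv D.cat_simps intro!: map_hom D.Arr_hom)
  next
    case (10 j) then show ?case by (auto simp: relabel_def inv D.cat_simps map_Id)
  next
    case (11 u j k v l)
    from homE[OF 11(1)] homE[OF 11(2)] obtain a b where
      ab: "u = e' a" "a \<in> Arr D" "k = e (Cod D a)" "v = e' b" "b \<in> Arr D" "k = e (Dom D b)" by metis
    then have "Cod D a = Dom D b" by (intro homO) (auto intro: D.Dom_Obj D.Cod_Obj)
    then show ?case using ab map_Comp[of a "Dom D a" "Cod D a" b "Cod D b"]
      by (simp add: relabel_def inv D.cat_simps hom_def)
  qed
qed

lemma relabel_cocone:
  assumes D: "category D" and e: "inj_on e (Obj D)" and e': "inj_on e' (Arr D)"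
  shows "is_cocone (relabel e e' D) C (F \<circ> inv_into (Obj D) e) (F' \<circ> inv_into (Arr D) e') L \<iota>
    \<longleftrightarrow> is_cocone D C F F' L (\<iota> \<circ> e)"
  using e e' category.Dom_Obj[OF D] category.Cod_Obj[OF D]
  by (auto simp: is_cocone_def relabel_def)

lemma is_cocone_cong:
  assumes "category D" "\<And>j. j \<in> Obj D \<Longrightarrow> \<iota> j = \<iota>' j"
  shows "is_cocone D C F F' L \<iota> \<longleftrightarrow> is_cocone D C F F' L \<iota>'"
  using assms category.Dom_Obj[OF assms(1)] category.Cod_Obj[OF assms(1)]
  by (auto simp: is_cocone_def)

lemma small_colimit_exists:
  assumes co: "cocomplete (U :: 'u itself) C" and F: "cat_functor D C F F'"
    and s: "small U (Obj D)" "small U (Arr D)"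
  obtains L \<iota> where "is_colimit D C F F' L \<iota>"
proof -
  obtain e :: "_ \<Rightarrow> 'u" where e: "inj_on e (Obj D)" using small_embedding s(1) by blast
  obtain e' :: "_ \<Rightarrow> 'u" where e': "inj_on e' (Arr D)" using small_embedding s(2) by blast
  interpret cat_functor D C F F' by fact
  let ?D = "relabel e e' D" and ?F = "F \<circ> inv_into (Obj D) e" and ?F' = "F' \<circ> inv_into (Arr D) e'"
  have "small U (Obj ?D)" "small U (Arr ?D)" using s by (auto simp: relabel_def small_image)
  then obtain L \<iota> where L: "is_colimit ?D C ?F ?F' L \<iota>"
    using co relabel_functor[OF F e e'] unfolding cocomplete_def by blast
  have cone: "is_cocone D C F F' M \<mu> \<longleftrightarrow> is_cocone ?D C ?F ?F' M (\<mu> \<circ> inv_into (Obj D) e)" for M \<mu>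
    unfolding relabel_cocone[OF D.category_axioms e e']
    by (rule is_cocone_cong[OF D.category_axioms]) (simp add: e)
  have "is_colimit D C F F' L (\<iota> \<circ> e)"
    unfolding is_colimit_def
  proof (intro conjI allI impI)
    show "is_cocone D C F F' L (\<iota> \<circ> e)"
      using L relabel_cocone[OF D.category_axioms e e', of C F F' L] by (simp add: is_colimit_def)
    fix M \<mu> assume "is_cocone D C F F' M \<mu>"
    then have "\<exists>!h. h \<in> hom C L M \<and> (\<forall>j\<in>Obj ?D. Comp C h (\<iota> j) = (\<mu> \<circ> inv_into (Obj D) e) j)"
      using L cone unfolding is_colimit_def by blast
    moreover have "(\<forall>j\<in>Obj ?D. Comp C h (\<iota> j) = (\<mu> \<circ> inv_into (Obj D) e) j)
        \<longleftrightarrow> (\<forall>j\<in>Obj D. Comp C h ((\<iota> \<circ> e) j) = \<mu> j)" for h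
      using e by (auto simp: relabel_def)
    ultimately show "\<exists>!h. h \<in> hom C L M \<and> (\<forall>j\<in>Obj D. Comp C h ((\<iota> \<circ> e) j) = \<mu> j)" by simp
  qed
  then show ?thesis by (rule that)
qed

lemma ord_cat_simps [simp]:
  "Obj (ord_cat r) = Field r" "Arr (ord_cat r) = r" "Dom (ord_cat r) = fst" "Cod (ord_cat r) = snd"
  "Id (ord_cat r) \<alpha> = (\<alpha>, \<alpha>)" "Comp (ord_cat r) v u = (fst u, snd v)"
  by (simp_all add: ord_cat_def)

lemma ord_cat_category:
  assumes "Refl r" "trans r" shows "category (ord_cat r)"
proof unfold_locales
  fix f g W X Y Z
  show "f \<in> Arr (ord_cat r) \<Longrightarrow> Dom (ord_cat r) f \<in> Obj (ord_cat r)"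
    "f \<in> Arr (ord_cat r) \<Longrightarrow> Cod (ord_cat r) f \<in> Obj (ord_cat r)"
    by (cases f, auto intro: FieldI1 FieldI2)+
  show "X \<in> Obj (ord_cat r) \<Longrightarrow> Id (ord_cat r) X \<in> hom (ord_cat r) X X"
    using assms(1) by (auto simp: hom_def refl_on_def)
  show "f \<in> hom (ord_cat r) X Y \<Longrightarrow> g \<in> hom (ord_cat r) Y Z
      \<Longrightarrow> Comp (ord_cat r) g f \<in> hom (ord_cat r) X Z"
    using assms(2) by (cases f; cases g) (auto simp: hom_def dest: transD)
qed (auto simp: hom_def)

lemma ord_functorI:
  assumes "category C" "Refl r" "trans r"
    and "\<And>\<alpha>. \<alpha> \<in> Field r \<Longrightarrow> X \<alpha> \<in> Obj C"
    and "\<And>\<alpha> \<beta>. (\<alpha>, \<beta>) \<in> r \<Longrightarrow> X' (\<alpha>, \<beta>) \<in> hom C (X \<alpha>) (X \<beta>)"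
    and "\<And>\<alpha>. \<alpha> \<in> Field r \<Longrightarrow> X' (\<alpha>, \<alpha>) = Id C (X \<alpha>)"
    and "\<And>\<alpha> \<beta> \<gamma>. \<lbrakk>(\<alpha>, \<beta>) \<in> r; (\<beta>, \<gamma>) \<in> r\<rbrakk> \<Longrightarrow> X' (\<alpha>, \<gamma>) = Comp C (X' (\<beta>, \<gamma>)) (X' (\<alpha>, \<beta>))"
  shows "cat_functor (ord_cat r) C X X'"
  unfolding cat_functor_def cat_functor_axioms_def
  using assms ord_cat_category[OF assms(2,3)] by (auto simp: hom_def)

lemma ord_functorD:
  assumes "cat_functor (ord_cat r) C X X'"
  shows "\<And>\<alpha>. \<alpha> \<in> Field r \<Longrightarrow> X \<alpha> \<in> Obj C"
    "\<And>\<alpha> \<beta>. (\<alpha>, \<beta>) \<in> r \<Longrightarrow> X' (\<alpha>, \<beta>) \<in> hom C (X \<alpha>) (X \<beta>)"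
    "\<And>\<alpha>. \<alpha> \<in> Field r \<Longrightarrow> X' (\<alpha>, \<alpha>) = Id C (X \<alpha>)"
    "\<And>\<alpha> \<beta> \<gamma>. \<lbrakk>(\<alpha>, \<beta>) \<in> r; (\<beta>, \<gamma>) \<in> r\<rbrakk> \<Longrightarrow> X' (\<alpha>, \<gamma>) = Comp C (X' (\<beta>, \<gamma>)) (X' (\<alpha>, \<beta>))"
proof -
  interpret cat_functor "ord_cat r" C X X' by fact
  show "\<And>\<alpha>. \<alpha> \<in> Field r \<Longrightarrow> X \<alpha> \<in> Obj C" using map_Obj by simp
  show "\<And>\<alpha> \<beta>. (\<alpha>, \<beta>) \<in> r \<Longrightarrow> X' (\<alpha>, \<beta>) \<in> hom C (X \<alpha>) (X \<beta>)"
    by (rule map_hom) (simp add: hom_def)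
  show "\<And>\<alpha>. \<alpha> \<in> Field r \<Longrightarrow> X' (\<alpha>, \<alpha>) = Id C (X \<alpha>)" using map_Id by simp
  show "X' (\<alpha>, \<gamma>) = Comp C (X' (\<beta>, \<gamma>)) (X' (\<alpha>, \<beta>))" if "(\<alpha>, \<beta>) \<in> r" "(\<beta>, \<gamma>) \<in> r" for \<alpha> \<beta> \<gamma>
    using map_Comp[of "(\<alpha>, \<beta>)" \<alpha> \<beta> "(\<beta>, \<gamma>)" \<gamma>] that by (simp add: hom_def)
qed

lemma ord_cocone_iff:
  "is_cocone (ord_cat r) C X X' L \<iota> \<longleftrightarrow>
     L \<in> Obj C \<and> (\<forall>\<alpha>\<in>Field r. \<iota> \<alpha> \<in> hom C (X \<alpha>) L) \<and>
     (\<forall>\<alpha> \<beta>. (\<alpha>, \<beta>) \<in> r \<longrightarrow> Comp C (\<iota> \<beta>) (X' (\<alpha>, \<beta>)) = \<iota> \<alpha>)"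
  by (auto simp: is_cocone_def)

lemma pushout_exists:
  fixes C :: "('o, 'm) cat" (structure)
  assumes U: "universe (U :: 'u itself)" and "category C" and co: "cocomplete U C"
    and f: "f \<in> Arr C" and g: "g \<in> Arr C" and dom: "Dom C f = Dom C g"
  obtains p q where "is_pushout C f g p q"
proof -
  interpret category C by fact
  define r :: "nat rel" where "r = {(0,0),(1,1),(2,2),(0,1),(0,2)}"
  define X where "X = (\<lambda>n::nat. if n = 0 then Dom C f else if n = 1 then Cod C f else Cod C g)"
  define X' where "X' = (\<lambda>u::nat \<times> nat. if u = (0,1) then f else if u = (0,2) then g else Id C (X (fst u)))"
  have Fr: "Field r = {0,1,2}" by (auto simp: r_def Field_def)
  have r: "Refl r" "trans r" by (auto simp: Fr refl_on_def r_def trans_def)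
  have X: "X n \<in> Obj C" for n using f g by (simp add: X_def Dom_Obj Cod_Obj)
  have X': "X' (\<alpha>, \<beta>) \<in> hom C (X \<alpha>) (X \<beta>)" if "(\<alpha>, \<beta>) \<in> r" for \<alpha> \<beta>
    using that f g dom Id_hom[OF X] by (auto simp: r_def X'_def) (simp_all add: X_def hom_def)
  have Xid: "X' (\<alpha>, \<alpha>) = Id C (X \<alpha>)" for \<alpha> by (auto simp: X'_def)
  have diag: "cat_functor (ord_cat r) C X X'"
  proof (rule ord_functorI[where X = X and X' = X', OF \<open>category C\<close> r X X' Xid])
    fix \<alpha> \<beta> \<gamma> assume ab: "(\<alpha>, \<beta>) \<in> r" "(\<beta>, \<gamma>) \<in> r"
    then consider "\<alpha> = \<beta>" | "\<beta> = \<gamma>" by (auto simp: r_def)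
    then show "X' (\<alpha>, \<gamma>) = X' (\<beta>, \<gamma>) \<cdot> X' (\<alpha>, \<beta>)"
      using Id_Comp[OF X'[OF ab(1)]] Comp_Id[OF X'[OF ab(2)]] Xid by cases simp_all
  qed
  have sm: "small U (Field r)" "small U r"
    by (simp_all add: small_finite[OF U] Fr) (simp add: small_finite[OF U] r_def)
  obtain L \<iota> where L: "is_colimit (ord_cat r) C X X' L \<iota>"
    using small_colimit_exists[OF co diag] sm by auto
  then have c: "is_cocone (ord_cat r) C X X' L \<iota>" by (simp add: is_colimit_def)
  then have ih: "\<iota> 1 \<in> hom C (Cod C f) L" "\<iota> 2 \<in> hom C (Cod C g) L" "\<iota> 0 \<in> hom C (Dom C f) L"
    and ie: "\<iota> 1 \<cdot> f = \<iota> 0" "\<iota> 2 \<cdot> g = \<iota> 0"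
    unfolding ord_cocone_iff Fr by (auto simp: X_def X'_def r_def)
  have "is_pushout C f g (\<iota> 1) (\<iota> 2)"
    unfolding is_pushout_def
  proof (intro conjI allI ballI impI)
    fix Q a b assume ab: "a \<in> hom C (Cod C f) Q" "b \<in> hom C (Cod C g) Q" "a \<cdot> f = b \<cdot> g"
    define \<mu> where "\<mu> = (\<lambda>n::nat. if n = 0 then a \<cdot> f else if n = 1 then a else b)"
    have "is_cocone (ord_cat r) C X X' Q \<mu>"
      using ab f g dom hom_Obj[OF ab(1)]
      by (auto simp: ord_cocone_iff Fr \<mu>_def X_def X'_def r_def hom_def cat_simps)
    then have "\<exists>!h. h \<in> hom C L Q \<and> (\<forall>j\<in>{0,1,2}. h \<cdot> \<iota> j = \<mu> j)"
      using L unfolding is_colimit_def by (auto simp: Fr)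
    moreover have "(\<forall>j\<in>{0,1,2}. h \<cdot> \<iota> j = \<mu> j) \<longleftrightarrow> h \<cdot> \<iota> 1 = a \<and> h \<cdot> \<iota> 2 = b"
      if "h \<in> hom C L Q" for h
      using that ih f g by (auto simp: \<mu>_def ie[symmetric] hom_def cat_simps)
    ultimately show "\<exists>!h. h \<in> hom C (Cod C (\<iota> 1)) Q \<and> h \<cdot> \<iota> 1 = a \<and> h \<cdot> \<iota> 2 = b"
      using ih homD(3)[OF ih(1)] by (metis (no_types, lifting))
  qed (use f g dom ih ie in \<open>auto simp: hom_def\<close>)
  then show ?thesis by (rule that)
qed

lemma initial_exists:
  assumes "universe (U :: 'u itself)" and C: "category C" and co: "cocomplete U C"
  obtains L where "L \<in> Obj C" "\<And>X. X \<in> Obj C \<Longrightarrow> \<exists>!t. t \<in> hom C L X"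
proof -
  have diag: "cat_functor (ord_cat ({} :: nat rel)) C (\<lambda>_. undefined) (\<lambda>_. undefined)"
    by (rule ord_functorI[OF C]) (auto simp: trans_def)
  obtain L \<iota> where "is_colimit (ord_cat ({} :: nat rel)) C (\<lambda>_. undefined) (\<lambda>_. undefined) L \<iota>"
    by (rule small_colimit_exists[OF co diag]) (simp_all add: small_finite[OF assms(1)])
  then show ?thesis by (intro that[of L]) (auto simp: is_colimit_def is_cocone_def)
qed


section \<open>Limits by duality\<close>

definition opposite :: "('o, 'm) cat \<Rightarrow> ('o, 'm) cat" where
  "opposite C = \<lparr>Obj = Obj C, Arr = Arr C, Dom = Cod C, Cod = Dom C, Id = Id C,
     Comp = (\<lambda>g f. Comp C f g)\<rparr>"

lemma opposite_simps [simp]: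
  "Obj (opposite C) = Obj C" "Arr (opposite C) = Arr C" "Dom (opposite C) = Cod C"
  "Cod (opposite C) = Dom C" "Id (opposite C) = Id C" "Comp (opposite C) g f = Comp C f g"
  "hom (opposite C) X Y = hom C Y X" "opposite (opposite C) = C"
  by (auto simp: opposite_def hom_def)

lemma opposite_category:
  assumes "category C" shows "category (opposite C)"
proof -
  interpret category C by fact
  show ?thesis
    by unfold_locales (auto simp: Dom_Obj Cod_Obj Id_hom Comp_hom Id_Comp Comp_Id Comp_assoc)
qed

lemma opposite_functor:
  assumes "cat_functor D C F F'" shows "cat_functor (opposite D) (opposite C) F F'"
proof -
  interpret cat_functor D C F F' by fact
  show ?thesis
    unfolding cat_functor_def cat_functor_axioms_def
    using opposite_category[OF D.category_axioms] opposite_category[OF C.category_axioms]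
    by (auto simp: map_Obj map_hom map_Id map_Comp)
qed

lemma is_limit_opposite:
  "is_limit D C F F' L \<pi> \<longleftrightarrow> is_colimit (opposite D) (opposite C) F F' L \<pi>"
  by (simp add: is_limit_def is_colimit_def is_cone_def is_cocone_def)

lemma opposite_cocomplete:
  assumes "complete (U :: 'u itself) C" shows "cocomplete U (opposite C)"
  unfolding cocomplete_def
proof (intro allI impI, elim conjE)
  fix D :: "('u, 'u) cat" and F F'
  assume s: "small U (Obj D)" "small U (Arr D)" and F: "cat_functor D (opposite C) F F'"
  have "cat_functor (opposite D) C F F'" using opposite_functor[OF F] by simp
  then have "\<exists>L \<iota>. is_limit (opposite D) C F F' L \<iota>"
    using assms s unfolding complete_def by (metis opposite_simps(1,2))
  then show "\<exists>L \<iota>. is_colimit D (opposite C) F F' L \<iota>" by (simp add: is_limit_opposite)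
qed

lemma terminal_exists:
  assumes "universe (U :: 'u itself)" and "category C" and "complete U C"
  obtains T where "T \<in> Obj C" "\<And>X. X \<in> Obj C \<Longrightarrow> \<exists>!t. t \<in> hom C X T"
  using initial_exists[OF assms(1) opposite_category[OF assms(2)] opposite_cocomplete[OF assms(3)]]
  by auto

definition is_pullback :: "('o, 'm) cat \<Rightarrow> 'm \<Rightarrow> 'm \<Rightarrow> 'm \<Rightarrow> 'm \<Rightarrow> bool" where
  "is_pullback C f g p q \<longleftrightarrow> is_pushout (opposite C) f g p q"

lemma pullback_exists:
  assumes "universe (U :: 'u itself)" and "category C" and "complete U C"
    and "f \<in> Arr C" and "g \<in> Arr C" and "Cod C f = Cod C g"
  obtains p q where "is_pullback C f g p q"
  using pushout_exists[OF assms(1) opposite_category[OF assms(2)] opposite_cocomplete[OF assms(3)], of f g]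
    assms(4-6) by (auto simp: is_pullback_def)

lemma is_pullbackD:
  assumes "is_pullback C f g p q"
  shows "p \<in> hom C (Dom C p) (Dom C f)" "q \<in> hom C (Dom C p) (Dom C g)" "Comp C f p = Comp C g q"
  using is_pushoutD[OF assms[unfolded is_pullback_def]] by simp_all

lemma is_pullback_sym: "is_pullback C f g p q \<Longrightarrow> is_pullback C g f q p"
  unfolding is_pullback_def by (rule is_pushout_sym)

lemma is_pullback_induced:
  assumes "is_pullback C f g p q" "a \<in> hom C Q (Dom C f)" "b \<in> hom C Q (Dom C g)"
    and "Comp C f a = Comp C g b"
  obtains h where "h \<in> hom C Q (Dom C p)" "Comp C p h = a" "Comp C q h = b"
  using is_pushout_induced[OF assms(1)[unfolded is_pullback_def], of a Q b] assms(2-4) by auto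

lemma is_pullback_eqI:
  assumes "is_pullback C f g p q" "h \<in> hom C Q (Dom C p)" "h' \<in> hom C Q (Dom C p)"
    and "Comp C p h = Comp C p h'" "Comp C q h = Comp C q h'" and "category C"
  shows "h = h'"
  using is_pushout_eqI[OF assms(1)[unfolded is_pullback_def], of h Q h'] assms(2-5)
    opposite_category[OF assms(6)] by auto

lemma lifts_opposite:
  assumes "lifts C i f" shows "lifts (opposite C) f i"
  unfolding lifts_def opposite_simps
proof (intro ballI impI)
  fix v u assume v: "v \<in> hom C (Cod C i) (Cod C f)" and u: "u \<in> hom C (Dom C i) (Dom C f)"
    and sq: "Comp C v i = Comp C f u"
  obtain k where "k \<in> hom C (Cod C i) (Dom C f)" "Comp C k i = u" "Comp C f k = v"
    by (rule liftsD[OF assms u v sq[symmetric]])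
  then show "\<exists>k\<in>hom C (Cod C i) (Dom C f). Comp C f k = v \<and> Comp C k i = u" by (intro bexI conjI)
qed

lemma (in category) lifts_pullback:
  assumes "is_pullback C f g p q" "i \<in> Arr C" "lifts C i g"
  shows "lifts C i p"
proof -
  interpret op: category "opposite C" by (rule opposite_category[OF category_axioms])
  have "is_pushout (opposite C) g f q p"
    by (rule is_pushout_sym[OF assms(1)[unfolded is_pullback_def]])
  then have "lifts (opposite C) p i"
    using op.lifts_pushout[of g f q p i] assms(2) lifts_opposite[OF assms(3)] by simp
  then show ?thesis using lifts_opposite[of "opposite C" p i] by simp
qed

section \<open>Transfinite sequences\<close>

lemma Well_orderD:
  assumes "Well_order r"
  shows "Refl r" "trans r" "antisym r" "Total r" "wf (r - Relation.Id)"
  using assms by (auto simp: order_on_defs)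

lemma Well_order_cases:
  assumes "Well_order r" "\<alpha> \<in> Field r" "\<beta> \<in> Field r"
  shows "\<alpha> \<in> underS r \<beta> \<or> \<alpha> = \<beta> \<or> \<beta> \<in> underS r \<alpha>"
  using Well_orderD(4)[OF assms(1)] assms(2,3) by (auto simp: total_on_def underS_def)

lemma underS_trans:
  assumes "Well_order r"
  shows "\<lbrakk>\<alpha> \<in> underS r \<beta>; (\<beta>, \<gamma>) \<in> r\<rbrakk> \<Longrightarrow> \<alpha> \<in> underS r \<gamma>"
    and "\<lbrakk>(\<alpha>, \<beta>) \<in> r; \<beta> \<in> underS r \<gamma>\<rbrakk> \<Longrightarrow> \<alpha> \<in> underS r \<gamma>"
  using Well_orderD(2,3)[OF assms] by (auto simp: underS_def dest: transD antisymD)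

lemma ofilter_underS: "Well_order r \<Longrightarrow> ofilter r (underS r \<beta>)"
  by (auto simp: ofilter_def under_def intro: underS_trans underS_Field)

lemma ofilter_under: "Well_order r \<Longrightarrow> ofilter r (under r \<beta>)"
  using Well_orderD(2)[of r] by (auto simp: ofilter_def under_def intro: FieldI1 dest: transD)

lemma ofilter_Field: "ofilter r (Field r)"
  by (auto simp: ofilter_def under_def Field_def)

lemma ofilterD: "\<lbrakk>ofilter r S; \<beta> \<in> S; (\<alpha>, \<beta>) \<in> r\<rbrakk> \<Longrightarrow> \<alpha> \<in> S"
  by (auto simp: ofilter_def under_def)

lemma ofilter_underSD: "\<lbrakk>ofilter r S; \<beta> \<in> S; \<alpha> \<in> underS r \<beta>\<rbrakk> \<Longrightarrow> \<alpha> \<in> S"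
  by (auto simp: ofilter_def under_def underS_def)

lemma Field_Restr_initial: "\<lbrakk>Well_order r; ofilter r S\<rbrakk> \<Longrightarrow> Field (Restr r S) = S"
  by (auto simp: ofilter_def intro!: Refl_Field_Restr2 Well_orderD)

lemma underS_Restr: "\<lbrakk>ofilter r S; \<beta> \<in> S\<rbrakk> \<Longrightarrow> underS (Restr r S) \<beta> = underS r \<beta>"
  by (auto simp: underS_def intro: ofilterD)

lemma is_succD:
  assumes "Well_order r" "is_succ r \<alpha> \<beta>"
  shows "\<alpha> \<in> underS r \<beta>" "(\<alpha>, \<beta>) \<in> r" "\<alpha> \<in> Field r" "\<beta> \<in> Field r" "underS r \<beta> = under r \<alpha>"
proof -
  show 1: "\<alpha> \<in> underS r \<beta>" using assms(2) by (simp add: is_succ_def)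
  then show 2: "(\<alpha>, \<beta>) \<in> r" by (simp add: underS_def)
  then show 3: "\<alpha> \<in> Field r" "\<beta> \<in> Field r" by (auto simp: Field_def)
  have "\<gamma> \<in> under r \<alpha>" if \<gamma>: "\<gamma> \<in> underS r \<beta>" for \<gamma>
  proof (rule ccontr)
    assume "\<gamma> \<notin> under r \<alpha>"
    then have "\<alpha> \<in> underS r \<gamma>"
      using Well_order_cases[OF assms(1) _ 3(1), of \<gamma>] \<gamma> underS_Field[OF \<gamma>] 2
        Well_orderD(1)[OF assms(1)] 3 by (auto simp: under_def underS_def refl_on_def)
    then have "(\<beta>, \<gamma>) \<in> r" using assms(2) by (simp add: is_succ_def)
    then show False using \<gamma> Well_orderD(3)[OF assms(1)] by (auto simp: underS_def antisym_def)
  qed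
  moreover have "\<gamma> \<in> underS r \<beta>" if "\<gamma> \<in> under r \<alpha>" for \<gamma>
    using underS_trans(2)[OF assms(1) _ 1] that by (simp add: under_def)
  ultimately show "underS r \<beta> = under r \<alpha>" by blast
qed

lemma is_succ_unique:
  assumes "Well_order r" "is_succ r \<alpha> \<beta>" "is_succ r \<alpha>' \<beta>" shows "\<alpha> = \<alpha>'"
  using is_succD(1,5)[OF assms(1,2)] is_succD(1,5)[OF assms(1,3)] Well_orderD(3)[OF assms(1)]
  by (auto simp: under_def antisym_def)

lemma is_succ_exists:
  assumes "Well_order r" "\<alpha> \<in> underS r \<gamma>"
  obtains \<beta> where "is_succ r \<alpha> \<beta>" "(\<beta>, \<gamma>) \<in> r"
proof -
  have "wf (r - Relation.Id)" using Well_orderD(5)[OF assms(1)] .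
  then obtain \<beta> where \<beta>: "\<alpha> \<in> underS r \<beta>" "\<And>\<delta>. (\<delta>, \<beta>) \<in> r - Relation.Id \<Longrightarrow> \<alpha> \<notin> underS r \<delta>"
    using assms(2) wfE_min[of "r - Relation.Id" \<gamma> "{\<delta>. \<alpha> \<in> underS r \<delta>}"] by auto
  have F: "\<delta> \<in> Field r" if "\<alpha> \<in> underS r \<delta>" for \<delta> using that by (auto simp: underS_def Field_def)
  have "(\<beta>, \<delta>) \<in> r" if "\<alpha> \<in> underS r \<delta>" for \<delta>
    using Well_order_cases[OF assms(1) F[OF that] F[OF \<beta>(1)]] \<beta>(2)[of \<delta>] that
      Well_orderD(1)[OF assms(1)] F by (auto simp: underS_def refl_on_def)
  then show ?thesis using \<beta>(1) assms(2) that unfolding is_succ_def by blast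
qed

lemma is_succ_Restr:
  assumes r: "Well_order r" and S: "ofilter r S" "\<beta> \<in> S"
  shows "is_succ (Restr r S) \<alpha> \<beta> \<longleftrightarrow> is_succ r \<alpha> \<beta>"
proof
  assume s: "is_succ (Restr r S) \<alpha> \<beta>"
  have 1: "\<alpha> \<in> underS r \<beta>" using s underS_Restr[OF S] by (simp add: is_succ_def)
  have "(\<beta>, \<gamma>) \<in> r" if "\<alpha> \<in> underS r \<gamma>" for \<gamma>
  proof (cases "\<gamma> \<in> S")
    case True
    then show ?thesis using s that underS_Restr[OF S(1)] by (auto simp: is_succ_def)
  next
    case False
    have "\<gamma> \<in> Field r" "\<beta> \<in> Field r" using that S by (auto simp: underS_def Field_def ofilter_def)
    then show ?thesis using Well_order_cases[OF r, of \<beta> \<gamma>] False S ofilterD[OF S]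
      by (auto simp: underS_def)
  qed
  then show "is_succ r \<alpha> \<beta>" using 1 by (simp add: is_succ_def)
next
  assume s: "is_succ r \<alpha> \<beta>"
  have "(\<beta>, \<gamma>) \<in> Restr r S" if "\<alpha> \<in> underS (Restr r S) \<gamma>" for \<gamma>
    using that s S by (auto simp: underS_def is_succ_def)
  then show "is_succ (Restr r S) \<alpha> \<beta>" using s underS_Restr[OF S] by (simp add: is_succ_def)
qed

lemma limit_point_Restr:
  assumes "Well_order r" "ofilter r S" "\<beta> \<in> S"
  shows "limit_point (Restr r S) \<beta> \<longleftrightarrow> limit_point r \<beta>"
  using assms is_succ_Restr[OF assms] underS_Restr[OF assms(2,3)] Field_Restr_initial[OF assms(1,2)]
  by (auto simp: limit_point_def ofilter_def)

lemma is_colimit_cong: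
  assumes "category D" "\<And>j. j \<in> Obj D \<Longrightarrow> F j = G j" "\<And>u. u \<in> Arr D \<Longrightarrow> F' u = G' u"
    and "\<And>j. j \<in> Obj D \<Longrightarrow> \<iota> j = \<kappa> j"
  shows "is_colimit D C F F' L \<iota> \<longleftrightarrow> is_colimit D C G G' L \<kappa>"
proof -
  have "is_cocone D C F F' M \<mu> \<longleftrightarrow> is_cocone D C G G' M \<mu>" for M \<mu>
    by (simp add: is_cocone_def assms(2,3))
  moreover have "is_cocone D C F F' L \<iota> \<longleftrightarrow> is_cocone D C F F' L \<kappa>"
    using is_cocone_cong[OF assms(1,4)] .
  ultimately show ?thesis using assms(4) by (simp add: is_colimit_def)
qed

lemma ord_colimit_universal:
  assumes "is_colimit (ord_cat r) C X X' L \<iota>"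
    and "M \<in> Obj C" "\<And>\<alpha>. \<alpha> \<in> Field r \<Longrightarrow> \<mu> \<alpha> \<in> hom C (X \<alpha>) M"
    and "\<And>\<alpha> \<beta>. (\<alpha>, \<beta>) \<in> r \<Longrightarrow> Comp C (\<mu> \<beta>) (X' (\<alpha>, \<beta>)) = \<mu> \<alpha>"
  obtains h where "h \<in> hom C L M" "\<And>\<alpha>. \<alpha> \<in> Field r \<Longrightarrow> Comp C h (\<iota> \<alpha>) = \<mu> \<alpha>"
proof -
  have "is_cocone (ord_cat r) C X X' M \<mu>" using assms by (simp add: ord_cocone_iff)
  then have "\<exists>!h. h \<in> hom C L M \<and> (\<forall>j\<in>Field r. Comp C h (\<iota> j) = \<mu> j)"
    using assms(1) unfolding is_colimit_def by simp
  then show ?thesis using that by blast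
qed

lemma ord_colimitD:
  assumes "is_colimit (ord_cat r) C X X' L \<iota>"
  shows "L \<in> Obj C" "\<And>\<alpha>. \<alpha> \<in> Field r \<Longrightarrow> \<iota> \<alpha> \<in> hom C (X \<alpha>) L"
    "\<And>\<alpha> \<beta>. (\<alpha>, \<beta>) \<in> r \<Longrightarrow> Comp C (\<iota> \<beta>) (X' (\<alpha>, \<beta>)) = \<iota> \<alpha>"
  using assms by (auto simp: is_colimit_def ord_cocone_iff)

lemma ord_colimit_eqI:
  assumes L: "is_colimit (ord_cat r) C X X' L \<iota>" and C: "category C"
    and X: "\<And>\<alpha> \<beta>. (\<alpha>, \<beta>) \<in> r \<Longrightarrow> X' (\<alpha>, \<beta>) \<in> hom C (X \<alpha>) (X \<beta>)"
    and h: "h \<in> hom C L M" "h' \<in> hom C L M"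
    and eq: "\<And>\<alpha>. \<alpha> \<in> Field r \<Longrightarrow> Comp C h (\<iota> \<alpha>) = Comp C h' (\<iota> \<alpha>)"
  shows "h = h'"
proof -
  interpret category C by fact
  note LD = ord_colimitD[OF L]
  have "is_cocone (ord_cat r) C X X' M (\<lambda>\<alpha>. Comp C h' (\<iota> \<alpha>))"
    unfolding ord_cocone_iff
  proof (intro conjI ballI allI impI)
    show "M \<in> Obj C" using h hom_Obj by blast
    show "Comp C h' (\<iota> \<alpha>) \<in> hom C (X \<alpha>) M" if "\<alpha> \<in> Field r" for \<alpha>
      using Comp_hom[OF LD(2)[OF that] h(2)] .
    fix \<alpha> \<beta> assume "(\<alpha>, \<beta>) \<in> r"
    moreover from this have "\<beta> \<in> Field r" by (auto simp: Field_def)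
    ultimately show "Comp C (Comp C h' (\<iota> \<beta>)) (X' (\<alpha>, \<beta>)) = Comp C h' (\<iota> \<alpha>)"
      using Comp_assoc[OF X LD(2) h(2)] LD(3) by simp
  qed
  then have "\<exists>!k. k \<in> hom C L M \<and> (\<forall>j\<in>Field r. Comp C k (\<iota> j) = Comp C h' (\<iota> j))"
    using L unfolding is_colimit_def by simp
  then show ?thesis using h eq by blast
qed

text \<open>The share of the stage \<open>\<beta>\<close> in the definition of a transfinite sequence. It speaks of the stages
  up to \<open>\<beta>\<close> only; hence it is inherited by initial segments and can be achieved by recursion.\<close>

definition trans_seq_at ::
  "('o, 'm) cat \<Rightarrow> 'm set \<Rightarrow> 'a rel \<Rightarrow> ('a \<Rightarrow> 'o) \<Rightarrow> ('a \<times> 'a \<Rightarrow> 'm) \<Rightarrow> 'a \<Rightarrow> bool" where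
  "trans_seq_at C K r X X' \<beta> \<longleftrightarrow>
     X \<beta> \<in> Obj C \<and> X' (\<beta>, \<beta>) = Id C (X \<beta>) \<and>
     (\<forall>\<alpha>. (\<alpha>, \<beta>) \<in> r \<longrightarrow> X' (\<alpha>, \<beta>) \<in> hom C (X \<alpha>) (X \<beta>)) \<and>
     (\<forall>\<alpha> \<gamma>. (\<alpha>, \<gamma>) \<in> r \<and> (\<gamma>, \<beta>) \<in> r \<longrightarrow> X' (\<alpha>, \<beta>) = Comp C (X' (\<gamma>, \<beta>)) (X' (\<alpha>, \<gamma>))) \<and>
     (limit_point r \<beta> \<longrightarrow>
        is_colimit (ord_cat (Restr r (underS r \<beta>))) C X X' (X \<beta>) (\<lambda>\<alpha>. X' (\<alpha>, \<beta>))) \<and>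
     (\<forall>\<alpha>. is_succ r \<alpha> \<beta> \<longrightarrow> X' (\<alpha>, \<beta>) \<in> K)"

lemma trans_seq_Restr_iff:
  assumes C: "category C" and r: "Well_order r" and S: "ofilter r S"
  shows "trans_seq C K (Restr r S) X X' \<longleftrightarrow> (\<forall>\<beta>\<in>S. trans_seq_at C K r X X' \<beta>)"
proof -
  note F = Field_Restr_initial[OF r S]
  have W: "Well_order (Restr r S)" using r by (rule Well_order_Restr)
  have segm: "Restr (Restr r S) (underS (Restr r S) \<beta>) = Restr r (underS r \<beta>)" if "\<beta> \<in> S" for \<beta>
    using underS_Restr[OF S that] ofilter_underSD[OF S that] by auto
  have lim: "limit_point (Restr r S) \<beta> \<longleftrightarrow> \<beta> \<in> S \<and> limit_point r \<beta>" for \<beta>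
    using limit_point_Restr[OF r S] F by (auto simp: limit_point_def)
  have suc: "is_succ (Restr r S) \<alpha> \<beta> \<longleftrightarrow> \<beta> \<in> S \<and> is_succ r \<alpha> \<beta>" for \<alpha> \<beta>
    using is_succ_Restr[OF r S] by (auto simp: is_succ_def underS_def)
  show ?thesis
  proof
    assume t: "trans_seq C K (Restr r S) X X'"
    show "\<forall>\<beta>\<in>S. trans_seq_at C K r X X' \<beta>"
    proof
      fix \<beta> assume \<beta>: "\<beta> \<in> S"
      have fu: "cat_functor (ord_cat (Restr r S)) C X X'" using t by (simp add: trans_seq_def)
      note fD = ord_functorD[OF fu]
      have m: "(\<alpha>, \<gamma>) \<in> Restr r S" if "(\<alpha>, \<gamma>) \<in> r" "\<gamma> \<in> S" for \<alpha> \<gamma>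
        using that ofilterD[OF S] by auto
      have "X' (\<alpha>, \<beta>) = Comp C (X' (\<gamma>, \<beta>)) (X' (\<alpha>, \<gamma>))" if "(\<alpha>, \<gamma>) \<in> r" "(\<gamma>, \<beta>) \<in> r" for \<alpha> \<gamma>
        using fD(4)[OF m m] that \<beta> ofilterD[OF S] by blast
      then show "trans_seq_at C K r X X' \<beta>"
        using t \<beta> fD(1,3)[of \<beta>] fD(2)[OF m] segm[OF \<beta>]
        unfolding trans_seq_at_def trans_seq_def lim suc F by auto
    qed
  next
    assume a: "\<forall>\<beta>\<in>S. trans_seq_at C K r X X' \<beta>"
    have "cat_functor (ord_cat (Restr r S)) C X X'"
      by (rule ord_functorI[OF C Well_orderD(1,2)[OF W]]) (use a in \<open>auto simp: F trans_seq_at_def\<close>)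
    then show "trans_seq C K (Restr r S) X X'"
      using a W segm unfolding trans_seq_def lim suc trans_seq_at_def by auto
  qed
qed

lemma trans_seq_iff:
  assumes "category C" "Well_order r"
  shows "trans_seq C K r X X' \<longleftrightarrow> (\<forall>\<beta>\<in>Field r. trans_seq_at C K r X X' \<beta>)"
  using trans_seq_Restr_iff[OF assms ofilter_Field] by (simp add: Restr_Field)

lemma trans_seq_initial:
  assumes "category C" "trans_seq C K r X X'" "ofilter r S"
  shows "trans_seq C K (Restr r S) X X'"
proof -
  have r: "Well_order r" using assms(2) by (simp add: trans_seq_def)
  have "\<forall>\<beta>\<in>Field r. trans_seq_at C K r X X' \<beta>" using trans_seq_iff[OF assms(1) r] assms(2) by blast
  then show ?thesis
    unfolding trans_seq_Restr_iff[OF assms(1) r assms(3)] using assms(3) by (auto simp: ofilter_def)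
qed

lemma trans_seq_mono: "\<lbrakk>trans_seq C K r X X'; K \<subseteq> K'\<rbrakk> \<Longrightarrow> trans_seq C K' r X X'"
  by (auto simp: trans_seq_def)

text \<open>A last stage is a terminal object of the ordinal, so a cocone is determined by its component
  there.\<close>

lemma last_stage_colimit:
  assumes C: "category C" and fu: "cat_functor (ord_cat r) C X X'"
    and \<beta>: "\<beta> \<in> Field r" "\<And>\<alpha>. \<alpha> \<in> Field r \<Longrightarrow> (\<alpha>, \<beta>) \<in> r"
  shows "is_colimit (ord_cat r) C X X' (X \<beta>) (\<lambda>\<alpha>. X' (\<alpha>, \<beta>))"
  unfolding is_colimit_def
proof (intro conjI allI impI)
  interpret category C by fact
  note fD = ord_functorD[OF fu]
  have F: "(\<alpha>, \<gamma>) \<in> r \<Longrightarrow> (\<gamma>, \<beta>) \<in> r" for \<alpha> \<gamma> using \<beta>(2) by (auto simp: Field_def)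
  show "is_cocone (ord_cat r) C X X' (X \<beta>) (\<lambda>\<alpha>. X' (\<alpha>, \<beta>))"
    unfolding ord_cocone_iff using fD(1)[OF \<beta>(1)] fD(2)[OF \<beta>(2)] fD(4)[OF _ F] by auto
  fix M \<mu> assume m: "is_cocone (ord_cat r) C X X' M \<mu>"
  show "\<exists>!h. h \<in> hom C (X \<beta>) M \<and> (\<forall>j\<in>Obj (ord_cat r). Comp C h (X' (j, \<beta>)) = \<mu> j)"
  proof (rule ex1I[of _ "\<mu> \<beta>"])
    show "\<mu> \<beta> \<in> hom C (X \<beta>) M \<and> (\<forall>j\<in>Obj (ord_cat r). Comp C (\<mu> \<beta>) (X' (j, \<beta>)) = \<mu> j)"
      using m \<beta> by (auto simp: ord_cocone_iff)
    fix h assume h: "h \<in> hom C (X \<beta>) M \<and> (\<forall>j\<in>Obj (ord_cat r). Comp C h (X' (j, \<beta>)) = \<mu> j)"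
    then have "Comp C h (Id C (X \<beta>)) = \<mu> \<beta>" using fD(3)[OF \<beta>(1)] \<beta>(1) by auto
    then show "h = \<mu> \<beta>" using h Comp_Id by auto
  qed
qed

lemma least_exists:
  assumes "Well_order r" "Field r \<noteq> {}"
  obtains z where "z \<in> Field r" "underS r z = {}"
proof -
  obtain x where "x \<in> Field r" using assms(2) by blast
  then obtain z where "z \<in> Field r" "\<And>y. (y, z) \<in> r - Relation.Id \<Longrightarrow> y \<notin> Field r"
    using wfE_min[OF Well_orderD(5)[OF assms(1)], of x "Field r"] by metis
  then show ?thesis using that[of z] by (auto simp: underS_def Field_def)
qed

lemma least_le:
  assumes "Well_order r" "z \<in> Field r" "underS r z = {}" "\<beta> \<in> Field r"
  shows "(z, \<beta>) \<in> r"
  using Well_order_cases[OF assms(1,2,4)] assms Well_orderD(1)[OF assms(1)]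
  by (auto simp: underS_def refl_on_def)

text \<open>Each stage of a sequence is the colimit of the stages up to it. This exhibits the map from the
  first stage as a transfinite composition.\<close>

lemma trans_comps_stage:
  assumes C: "category C" and t: "trans_seq C K (r :: 'u rel) X X'"
    and sm: "small (U :: 'u itself) (under r \<beta>)"
    and z: "z \<in> Field r" "underS r z = {}" and \<beta>: "\<beta> \<in> Field r"
  shows "X' (z, \<beta>) \<in> trans_comps U C K"
proof -
  have r: "Well_order r" using t by (simp add: trans_seq_def)
  let ?S = "under r \<beta>"
  note S = ofilter_under[OF r, of \<beta>]
  have t': "trans_seq C K (Restr r ?S) X X'" by (rule trans_seq_initial[OF C t S])
  have F: "Field (Restr r ?S) = ?S" by (rule Field_Restr_initial[OF r S])
  have \<beta>S: "\<beta> \<in> ?S" using Well_orderD(1)[OF r] \<beta> by (simp add: under_def refl_on_def)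
  have zS: "z \<in> ?S" using least_le[OF r z \<beta>] by (simp add: under_def)
  have "is_colimit (ord_cat (Restr r ?S)) C X X' (X \<beta>) (\<lambda>\<alpha>. X' (\<alpha>, \<beta>))"
    using t' F \<beta>S by (intro last_stage_colimit[OF C]) (auto simp: trans_seq_def under_def)
  moreover have "underS (Restr r ?S) z = {}" using underS_Restr[OF S zS] z by simp
  ultimately show ?thesis
    using t' sm F zS unfolding trans_comps_def
    by (intro CollectI exI[of _ "Restr r ?S"] exI[of _ X] exI[of _ X'] exI[of _ "X \<beta>"]
        exI[of _ "\<lambda>\<alpha>. X' (\<alpha>, \<beta>)"] exI[of _ z]) simp
qed

lemma trans_comps_Arr:
  assumes "category C" "f \<in> trans_comps U C K" shows "f \<in> Arr C"
  using assms(2) by (auto simp: trans_comps_def is_colimit_def ord_cocone_iff hom_def)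

text \<open>A single map is a transfinite composition over the ordinal \<open>2\<close>, realized by two elements of the
  universe.\<close>

lemma sub_trans_comps:
  assumes C: "category C" and U: "universe (U :: 'u itself)" and K: "K \<subseteq> Arr C"
  shows "K \<subseteq> trans_comps U C K"
proof
  interpret category C by fact
  fix k assume k: "k \<in> K"
  obtain a b :: 'u where ab: "a \<noteq> b"
    using universe_infinite[OF U] ex_new_if_finite[of "{undefined}"] by auto
  define r where "r = {(a, a), (a, b), (b, b)}"
  define X where "X = (\<lambda>x. if x = a then Dom C k else Cod C k)"
  define X' where "X' = (\<lambda>u. if u = (a, b) then k else Id C (X (fst u)))"
  have F: "Field r = {a, b}" by (auto simp: r_def Field_def)
  have "r - Relation.Id = {(a, b)}" using ab by (auto simp: r_def)
  then have "wf (r - Relation.Id)" using ab by (simp add: wf_insert)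
  then have r: "Well_order r" using ab
    by (auto simp: order_on_defs F refl_on_def trans_def antisym_def total_on_def r_def)
  have us: "underS r a = {}" "underS r b = {a}" using ab by (auto simp: underS_def r_def)
  have suc: "is_succ r \<alpha> \<beta> \<longleftrightarrow> \<alpha> = a \<and> \<beta> = b" for \<alpha> \<beta>
    using ab by (auto simp: is_succ_def underS_def r_def)
  have mem: "(\<alpha>, \<beta>) \<in> r \<longleftrightarrow> (\<alpha> = a \<and> (\<beta> = a \<or> \<beta> = b)) \<or> (\<alpha> = b \<and> \<beta> = b)" for \<alpha> \<beta>
    by (auto simp: r_def)
  have kA: "k \<in> Arr C" using k K by blast
  have "trans_seq_at C K r X X' \<beta>" if "\<beta> \<in> Field r" for \<beta>
    using that us suc ab kA k unfolding trans_seq_at_def limit_point_def suc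
    by (auto simp: F X_def X'_def mem hom_def cat_simps)
  then have t: "trans_seq C K r X X'" using trans_seq_iff[OF C r] by blast
  have "X' (a, b) \<in> trans_comps U C K"
    by (rule trans_comps_stage[OF C t]) (simp_all add: F us small_finite[OF U] under_def mem)
  then show "k \<in> trans_comps U C K" by (simp add: X'_def)
qed

lemma pushouts_Arr: "pushouts C K \<subseteq> Arr C"
  by (auto simp: pushouts_def is_pushout_def hom_def)

lemma pushouts_cell: "\<lbrakk>category C; universe U\<rbrakk> \<Longrightarrow> pushouts C K \<subseteq> cell U C K"
  unfolding cell_def by (rule sub_trans_comps[OF _ _ pushouts_Arr])

text \<open>A lift against a transfinite composition is constructed stage by stage: the lifting property of
  the step yields it at successors, and the universal property of the colimit at limits.\<close>

lemma lifts_trans_comps: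
  fixes C :: "('o, 'm) cat"
  assumes C: "category C" and f: "f \<in> Arr C" and K: "\<And>k. k \<in> K \<Longrightarrow> lifts C k f"
    and c: "c \<in> trans_comps (U :: 'u itself) C K"
  shows "lifts C c f"
proof -
  interpret category C by fact
  obtain r :: "'u rel" and X X' L \<iota> z where t: "trans_seq C K r X X'" and L: "is_colimit (ord_cat r) C X X' L \<iota>"
    and z: "z \<in> Field r" "underS r z = {}" "c = \<iota> z"
    using c unfolding trans_comps_def by blast
  have r: "Well_order r" and fu: "cat_functor (ord_cat r) C X X'" using t by (simp_all add: trans_seq_def)
  note fD = ord_functorD[OF fu] and LD = ord_colimitD[OF L]
  have zl: "(z, \<beta>) \<in> r" if "\<beta> \<in> Field r" for \<beta> using least_le[OF r z(1,2) that] .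
  show ?thesis
  proof (rule liftsI)
    fix u v assume u: "u \<in> hom C (Dom C c) (Dom C f)" and v: "v \<in> hom C (Cod C c) (Cod C f)"
      and sq: "Comp C f u = Comp C v c"
    have ct: "Dom C c = X z" "Cod C c = L" using LD(2)[OF z(1)] z(3) by (auto simp: hom_def)
    define good where "good k \<beta> x \<longleftrightarrow> (\<beta> \<in> Field r \<longrightarrow>
        x \<in> hom C (X \<beta>) (Dom C f) \<and> Comp C f x = Comp C v (\<iota> \<beta>) \<and> (\<beta> = z \<longrightarrow> x = u) \<and>
        (\<forall>\<alpha>\<in>underS r \<beta>. Comp C x (X' (\<alpha>, \<beta>)) = k \<alpha>))" for k \<beta> x
    have "\<exists>k. \<forall>\<beta>. good k \<beta> (k \<beta>)"
    proof (rule dependent_wf_choice[OF Well_orderD(5)[OF r]])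
      fix k k' :: "'u \<Rightarrow> 'm" and \<beta> x assume "\<And>\<alpha>. (\<alpha>, \<beta>) \<in> r - Relation.Id \<Longrightarrow> k \<alpha> = k' \<alpha>"
      then show "good k \<beta> x = good k' \<beta> x" by (auto simp: good_def underS_def)
    next
      fix \<beta> and k :: "'u \<Rightarrow> 'm" assume IH: "\<And>\<alpha>. (\<alpha>, \<beta>) \<in> r - Relation.Id \<Longrightarrow> good k \<alpha> (k \<alpha>)"
      have IH': "k \<alpha> \<in> hom C (X \<alpha>) (Dom C f)" "Comp C f (k \<alpha>) = Comp C v (\<iota> \<alpha>)"
        "(\<gamma>, \<alpha>) \<in> r \<Longrightarrow> Comp C (k \<alpha>) (X' (\<gamma>, \<alpha>)) = k \<gamma>" "\<alpha> = z \<Longrightarrow> k \<alpha> = u"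
        if "\<alpha> \<in> underS r \<beta>" for \<alpha> \<gamma>
      proof -
        have \<alpha>: "\<alpha> \<in> Field r" "good k \<alpha> (k \<alpha>)" using that IH[of \<alpha>] by (auto simp: underS_def Field_def)
        then show h: "k \<alpha> \<in> hom C (X \<alpha>) (Dom C f)" "Comp C f (k \<alpha>) = Comp C v (\<iota> \<alpha>)"
          by (auto simp: good_def)
        show "Comp C (k \<alpha>) (X' (\<gamma>, \<alpha>)) = k \<gamma>" if "(\<gamma>, \<alpha>) \<in> r"
          using \<alpha> that fD(3)[OF \<alpha>(1)] Comp_Id[OF h(1)] by (cases "\<gamma> = \<alpha>") (auto simp: good_def underS_def)
        show "\<alpha> = z \<Longrightarrow> k \<alpha> = u" using \<alpha> by (auto simp: good_def)
      qed
      show "\<exists>x. good k \<beta> x"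
      proof (cases "\<beta> \<in> Field r")
        case False then show ?thesis by (simp add: good_def)
      next
        case \<beta>: True
        show ?thesis
        proof (cases "underS r \<beta> = {}")
          case True
          then have "\<beta> = z" using zl[OF \<beta>] by (auto simp: underS_def)
          then show ?thesis using u sq ct True z by (intro exI[of _ u]) (auto simp: good_def)
        next
          case ne: False
          then have bz: "\<beta> \<noteq> z" using z by auto
          note \<iota>\<beta> = LD(2)[OF \<beta>]
          have v': "v \<in> hom C L (Cod C f)" using v ct by simp
          show ?thesis
          proof (cases "limit_point r \<beta>")
            case True
            then have col: "is_colimit (ord_cat (Restr r (underS r \<beta>))) C X X' (X \<beta>) (\<lambda>\<alpha>. X' (\<alpha>, \<beta>))"
              using t by (simp add: trans_seq_def)
            note F = Field_Restr_initial[OF r ofilter_underS[OF r], of \<beta>]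
            obtain x where x: "x \<in> hom C (X \<beta>) (Dom C f)"
                "\<And>\<alpha>. \<alpha> \<in> underS r \<beta> \<Longrightarrow> Comp C x (X' (\<alpha>, \<beta>)) = k \<alpha>"
              by (rule ord_colimit_universal[OF col, of "Dom C f" k])
                (use IH' F Dom_Obj[OF f] in auto)
            have "Comp C f x = Comp C v (\<iota> \<beta>)"
            proof (rule ord_colimit_eqI[OF col C])
              show "Comp C f x \<in> hom C (X \<beta>) (Cod C f)" using Comp_hom[OF x(1) Arr_hom[OF f]] .
              show "Comp C v (\<iota> \<beta>) \<in> hom C (X \<beta>) (Cod C f)" using Comp_hom[OF \<iota>\<beta> v'] .
              fix \<alpha> assume "\<alpha> \<in> Field (Restr r (underS r \<beta>))"
              then have \<alpha>: "\<alpha> \<in> underS r \<beta>" "(\<alpha>, \<beta>) \<in> r" using F by (auto simp: underS_def)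
              show "Comp C (Comp C f x) (X' (\<alpha>, \<beta>)) = Comp C (Comp C v (\<iota> \<beta>)) (X' (\<alpha>, \<beta>))"
                using Comp_assoc[OF fD(2)[OF \<alpha>(2)] x(1) Arr_hom[OF f]]
                  Comp_assoc[OF fD(2)[OF \<alpha>(2)] \<iota>\<beta> v'] x(2)[OF \<alpha>(1)] IH'(2)[OF \<alpha>(1)]
                  LD(3)[OF \<alpha>(2)] by simp
            qed (use fD in auto)
            then show ?thesis using x bz by (auto simp: good_def)
          next
            case False
            then obtain \<alpha> where s: "is_succ r \<alpha> \<beta>" using ne \<beta> by (auto simp: limit_point_def)
            note sD = is_succD[OF r s]
            have lift: "lifts C (X' (\<alpha>, \<beta>)) f" using K t s by (auto simp: trans_seq_def)
            have eq: "Comp C f (k \<alpha>) = Comp C (Comp C v (\<iota> \<beta>)) (X' (\<alpha>, \<beta>))"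
              using IH'(2)[OF sD(1)] Comp_assoc[OF fD(2)[OF sD(2)] \<iota>\<beta> v'] LD(3)[OF sD(2)] by simp
            obtain x where x: "x \<in> hom C (X \<beta>) (Dom C f)" "Comp C x (X' (\<alpha>, \<beta>)) = k \<alpha>"
                "Comp C f x = Comp C v (\<iota> \<beta>)"
              using liftsD[OF lift _ _ eq] IH'(1)[OF sD(1)] Comp_hom[OF \<iota>\<beta> v'] fD(2)[OF sD(2)]
              by (auto simp: hom_def)
            have "Comp C x (X' (\<gamma>, \<beta>)) = k \<gamma>" if "\<gamma> \<in> underS r \<beta>" for \<gamma>
            proof -
              have g: "(\<gamma>, \<alpha>) \<in> r" using that sD(5) by (simp add: under_def)
              show ?thesis
                using fD(4)[OF g sD(2)] Comp_assoc[OF fD(2)[OF g] fD(2)[OF sD(2)] x(1)] x(2)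
                  IH'(3)[OF sD(1) g] by simp
            qed
            then show ?thesis using x bz by (auto simp: good_def)
          qed
        qed
      qed
    qed
    then obtain k where k: "\<And>\<beta>. good k \<beta> (k \<beta>)" by blast
    have kh: "k \<beta> \<in> hom C (X \<beta>) (Dom C f)" "Comp C f (k \<beta>) = Comp C v (\<iota> \<beta>)" if "\<beta> \<in> Field r" for \<beta>
      using k[of \<beta>] that by (auto simp: good_def)
    have kz: "k z = u" using k[of z] z by (auto simp: good_def)
    obtain h where h: "h \<in> hom C L (Dom C f)" "\<And>\<alpha>. \<alpha> \<in> Field r \<Longrightarrow> Comp C h (\<iota> \<alpha>) = k \<alpha>"
    proof (rule ord_colimit_universal[OF L, of "Dom C f" k])
      fix \<alpha> \<beta> assume ab: "(\<alpha>, \<beta>) \<in> r"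
      then have \<beta>: "\<beta> \<in> Field r" by (auto simp: Field_def)
      show "Comp C (k \<beta>) (X' (\<alpha>, \<beta>)) = k \<alpha>"
        using k[of \<beta>] \<beta> ab fD(3)[OF \<beta>] Comp_Id[OF kh(1)[OF \<beta>]]
        by (cases "\<alpha> = \<beta>") (auto simp: good_def underS_def)
    qed (use kh Dom_Obj[OF f] in auto)
    have v': "v \<in> hom C L (Cod C f)" using v ct by simp
    have "Comp C f h = v"
    proof (rule ord_colimit_eqI[OF L C fD(2) Comp_hom[OF h(1) Arr_hom[OF f]] v'])
      fix \<alpha> assume \<alpha>: "\<alpha> \<in> Field r"
      show "Comp C (Comp C f h) (\<iota> \<alpha>) = Comp C v (\<iota> \<alpha>)"
        using Comp_assoc[OF LD(2)[OF \<alpha>] h(1) Arr_hom[OF f]] h(2)[OF \<alpha>] kh(2)[OF \<alpha>] by simp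
    qed
    then show "\<exists>k\<in>hom C (Cod C c) (Dom C f). Comp C k c = u \<and> Comp C f k = v"
      using h kz z ct by auto
  qed
qed

lemma cell_cof:
  assumes C: "category C" and K: "K \<subseteq> Arr C" shows "cell U C K \<subseteq> cof C K"
proof -
  interpret category C by fact
  have "lifts C c f" if "c \<in> cell U C K" "f \<in> inj_maps C K" for c f
  proof (rule lifts_trans_comps[OF C _ _ that(1)[unfolded cell_def]])
    show f: "f \<in> Arr C" using that by (simp add: inj_maps_Arr)
    fix q assume "q \<in> pushouts C K"
    then show "lifts C q f"
      using lifts_pushout f that by (auto simp: pushouts_def inj_maps_def RLP_def)
  qed
  then show ?thesis using trans_comps_Arr[OF C] by (auto simp: cof_def LLP_def cell_def)
qed

section \<open>Construction of transfinite sequences by recursion\<close>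

text \<open>A diagram \<open>X'\<close> on the stages before \<open>\<beta>\<close> is continued to \<open>\<beta>\<close>; the value of \<open>m\<close> at a stage is the
  map from there to the new stage.\<close>

definition extend_map :: "'a \<Rightarrow> ('a \<Rightarrow> 'm) \<Rightarrow> ('a \<times> 'a \<Rightarrow> 'm) \<Rightarrow> 'a \<times> 'a \<Rightarrow> 'm" where
  "extend_map \<beta> m X' = (\<lambda>u. if snd u = \<beta> then m (fst u) else X' u)"

lemma extend_map_simps [simp]:
  "extend_map \<beta> m X' (\<alpha>, \<beta>) = m \<alpha>"
  "\<gamma> \<noteq> \<beta> \<Longrightarrow> extend_map \<beta> m X' (\<alpha>, \<gamma>) = X' (\<alpha>, \<gamma>)"
  by (simp_all add: extend_map_def)

lemma trans_seq_at_cong: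
  assumes r: "Well_order r" and \<beta>: "\<beta> \<in> Field r"
    and X: "\<And>\<alpha>. (\<alpha>, \<beta>) \<in> r \<Longrightarrow> X \<alpha> = Y \<alpha>"
    and X': "\<And>\<alpha> \<gamma>. \<lbrakk>(\<alpha>, \<gamma>) \<in> r; (\<gamma>, \<beta>) \<in> r\<rbrakk> \<Longrightarrow> X' (\<alpha>, \<gamma>) = Y' (\<alpha>, \<gamma>)"
  shows "trans_seq_at C K r X X' \<beta> \<longleftrightarrow> trans_seq_at C K r Y Y' \<beta>"
proof -
  have \<beta>\<beta>: "(\<beta>, \<beta>) \<in> r" using Well_orderD(1)[OF r] \<beta> by (simp add: refl_on_def)
  have col: "is_colimit (ord_cat (Restr r (underS r \<beta>))) C X X' (X \<beta>) (\<lambda>\<alpha>. X' (\<alpha>, \<beta>))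
    \<longleftrightarrow> is_colimit (ord_cat (Restr r (underS r \<beta>))) C Y Y' (Y \<beta>) (\<lambda>\<alpha>. Y' (\<alpha>, \<beta>))"
    unfolding X[OF \<beta>\<beta>]
  proof (rule is_colimit_cong)
    have "Well_order (Restr r (underS r \<beta>))" using r by (rule Well_order_Restr)
    then show "category (ord_cat (Restr r (underS r \<beta>)))"
      using ord_cat_category Well_orderD by blast
  next
    fix j assume "j \<in> Obj (ord_cat (Restr r (underS r \<beta>)))"
    then have "(j, \<beta>) \<in> r"
      using Field_Restr_initial[OF r ofilter_underS[OF r]] by (simp add: underS_def)
    then show "X j = Y j" "X' (j, \<beta>) = Y' (j, \<beta>)" using X X' \<beta>\<beta> by auto
  next
    fix u assume "u \<in> Arr (ord_cat (Restr r (underS r \<beta>)))"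
    then show "X' u = Y' u" using X' by (cases u) (auto simp: underS_def)
  qed
  have succ: "(\<forall>\<alpha>. is_succ r \<alpha> \<beta> \<longrightarrow> X' (\<alpha>, \<beta>) \<in> K) \<longleftrightarrow> (\<forall>\<alpha>. is_succ r \<alpha> \<beta> \<longrightarrow> Y' (\<alpha>, \<beta>) \<in> K)"
    using X' \<beta>\<beta> by (auto simp: is_succ_def underS_def)
  have hom: "(\<forall>\<alpha>. (\<alpha>, \<beta>) \<in> r \<longrightarrow> X' (\<alpha>, \<beta>) \<in> hom C (X \<alpha>) (X \<beta>)) \<longleftrightarrow>
      (\<forall>\<alpha>. (\<alpha>, \<beta>) \<in> r \<longrightarrow> Y' (\<alpha>, \<beta>) \<in> hom C (Y \<alpha>) (Y \<beta>))"
    using X X' \<beta>\<beta> by auto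
  have comp: "(\<forall>\<alpha> \<gamma>. (\<alpha>, \<gamma>) \<in> r \<and> (\<gamma>, \<beta>) \<in> r \<longrightarrow> X' (\<alpha>, \<beta>) = Comp C (X' (\<gamma>, \<beta>)) (X' (\<alpha>, \<gamma>))) \<longleftrightarrow>
      (\<forall>\<alpha> \<gamma>. (\<alpha>, \<gamma>) \<in> r \<and> (\<gamma>, \<beta>) \<in> r \<longrightarrow> Y' (\<alpha>, \<beta>) = Comp C (Y' (\<gamma>, \<beta>)) (Y' (\<alpha>, \<gamma>)))"
  proof -
    have "X' (\<alpha>, \<beta>) = Y' (\<alpha>, \<beta>) \<and> X' (\<gamma>, \<beta>) = Y' (\<gamma>, \<beta>) \<and> X' (\<alpha>, \<gamma>) = Y' (\<alpha>, \<gamma>)"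
      if "(\<alpha>, \<gamma>) \<in> r \<and> (\<gamma>, \<beta>) \<in> r" for \<alpha> \<gamma>
      using that X' \<beta>\<beta> transD[OF Well_orderD(2)[OF r], of \<alpha> \<gamma> \<beta>] by simp
    then show ?thesis by metis
  qed
  show ?thesis 
    unfolding trans_seq_at_def X[OF \<beta>\<beta>] X'[OF \<beta>\<beta> \<beta>\<beta>] comp succ
      col[unfolded X[OF \<beta>\<beta>]] hom[unfolded X[OF \<beta>\<beta>]] ..
qed

lemma trans_seq_at_extend:
  assumes C: "category C" and r: "Well_order r" and \<beta>: "\<beta> \<in> Field r" and Y: "Y \<in> Obj C"
    and m: "\<And>\<alpha>. \<alpha> \<in> underS r \<beta> \<Longrightarrow> m \<alpha> \<in> hom C (X \<alpha>) Y"
      "\<And>\<alpha> \<gamma>. \<lbrakk>(\<alpha>, \<gamma>) \<in> r; \<gamma> \<in> underS r \<beta>\<rbrakk> \<Longrightarrow> Comp C (m \<gamma>) (X' (\<alpha>, \<gamma>)) = m \<alpha>"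
    and col: "limit_point r \<beta> \<Longrightarrow> is_colimit (ord_cat (Restr r (underS r \<beta>))) C X X' Y m"
  shows "trans_seq_at C UNIV r (X(\<beta> := Y)) (extend_map \<beta> (m(\<beta> := Id C Y)) X') \<beta>"
proof -
  interpret category C by fact
  let ?m = "m(\<beta> := Id C Y)"
  have ne: "\<alpha> \<noteq> \<beta>" if "\<alpha> \<in> underS r \<beta>" for \<alpha> using that by (simp add: underS_def)
  have dn: "\<alpha> \<in> underS r \<beta>" if "(\<alpha>, \<gamma>) \<in> r" "\<gamma> \<in> underS r \<beta>" for \<alpha> \<gamma>
    using underS_trans(2)[OF r that] .
  have hom: "?m \<alpha> \<in> hom C ((X(\<beta> := Y)) \<alpha>) Y" if "(\<alpha>, \<beta>) \<in> r" for \<alpha>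
    using that m(1)[of \<alpha>] Id_hom[OF Y] by (cases "\<alpha> = \<beta>") (auto simp: underS_def)
  have comp: "?m \<alpha> = Comp C (?m \<gamma>) (extend_map \<beta> ?m X' (\<alpha>, \<gamma>))"
    if "(\<alpha>, \<gamma>) \<in> r" "(\<gamma>, \<beta>) \<in> r" for \<alpha> \<gamma>
  proof (cases "\<gamma> = \<beta>")
    case True
    then show ?thesis using Id_Comp[OF hom] that by simp
  next
    case False
    then have "\<gamma> \<in> underS r \<beta>" using that by (simp add: underS_def)
    then show ?thesis using False m(2)[OF that(1)] ne[OF dn[OF that(1)]] by simp
  qed
  have "is_colimit (ord_cat (Restr r (underS r \<beta>))) C X X' Y m
      \<longleftrightarrow> is_colimit (ord_cat (Restr r (underS r \<beta>))) C (X(\<beta> := Y)) (extend_map \<beta> ?m X') Y ?m"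
  proof (rule is_colimit_cong)
    have "Well_order (Restr r (underS r \<beta>))" using r by (rule Well_order_Restr)
    then show "category (ord_cat (Restr r (underS r \<beta>)))"
      using ord_cat_category Well_orderD by blast
  next
    fix j assume "j \<in> Obj (ord_cat (Restr r (underS r \<beta>)))"
    then have "j \<noteq> \<beta>" using Field_Restr_initial[OF r ofilter_underS[OF r]] ne by simp
    then show "X j = (X(\<beta> := Y)) j" "m j = ?m j" by simp_all
  next
    fix u assume "u \<in> Arr (ord_cat (Restr r (underS r \<beta>)))"
    then show "X' u = extend_map \<beta> ?m X' u" using ne by (cases u) auto
  qed
  then show ?thesis
    unfolding trans_seq_at_def using Y hom comp col by (auto simp del: fun_upd_apply simp: fun_upd_same)
qed

text \<open>
  Dependent choice along a well-order, arranged so that functoriality and the passage to colimits are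
  dealt with once. It remains to choose, at successors, a map out of the preceding stage and, at all
  stages, a decoration \<open>d\<close>, subject to a condition \<open>Q\<close> that may involve the earlier stages.
\<close>

lemma decorated_trans_seq_exists:
  fixes C :: "('o, 'm) cat" and r :: "'a rel"
    and Q :: "'a \<Rightarrow> ('a \<Rightarrow> 'o) \<Rightarrow> ('a \<times> 'a \<Rightarrow> 'm) \<Rightarrow> ('a \<Rightarrow> 'd) \<Rightarrow> bool"
  assumes C: "category C" and co: "cocomplete (U :: 'u itself) C" and U: "universe U"
    and r: "Well_order r" and sm: "\<And>\<beta>. \<beta> \<in> Field r \<Longrightarrow> small U (underS r \<beta>)"
    and X0: "X0 \<in> Obj C"
    and local: "\<And>\<beta> X Y X' Y' d d'. \<lbrakk>\<beta> \<in> Field r;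
        \<And>\<alpha>. (\<alpha>, \<beta>) \<in> r \<Longrightarrow> X \<alpha> = Y \<alpha> \<and> d \<alpha> = d' \<alpha>;
        \<And>\<alpha> \<gamma>. \<lbrakk>(\<alpha>, \<gamma>) \<in> r; (\<gamma>, \<beta>) \<in> r\<rbrakk> \<Longrightarrow> X' (\<alpha>, \<gamma>) = Y' (\<alpha>, \<gamma>); Q \<beta> X X' d\<rbrakk> \<Longrightarrow> Q \<beta> Y Y' d'"
    and zero: "\<And>\<beta> X X' d. \<lbrakk>\<beta> \<in> Field r; underS r \<beta> = {}\<rbrakk> \<Longrightarrow>
        \<exists>d0. Q \<beta> (X(\<beta> := X0)) (extend_map \<beta> (\<lambda>_. Id C X0) X') (d(\<beta> := d0))"
    and succ: "\<And>\<alpha> \<beta> X X' d. \<lbrakk>is_succ r \<alpha> \<beta>; trans_seq C UNIV (Restr r (under r \<alpha>)) X X';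
        \<forall>\<gamma>\<in>under r \<alpha>. Q \<gamma> X X' d\<rbrakk> \<Longrightarrow>
        \<exists>Y g d1. g \<in> hom C (X \<alpha>) Y \<and>
          Q \<beta> (X(\<beta> := Y)) (extend_map \<beta> ((\<lambda>\<gamma>. Comp C g (X' (\<gamma>, \<alpha>)))(\<beta> := Id C Y)) X') (d(\<beta> := d1))"
    and lim: "\<And>\<beta> X X' d L \<iota>. \<lbrakk>limit_point r \<beta>; trans_seq C UNIV (Restr r (underS r \<beta>)) X X';
        \<forall>\<gamma>\<in>underS r \<beta>. Q \<gamma> X X' d;
        is_colimit (ord_cat (Restr r (underS r \<beta>))) C X X' L \<iota>\<rbrakk> \<Longrightarrow>
        \<exists>d1. Q \<beta> (X(\<beta> := L)) (extend_map \<beta> (\<iota>(\<beta> := Id C L)) X') (d(\<beta> := d1))"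
  obtains X X' d where "trans_seq C UNIV r X X'" "\<And>\<beta>. \<beta> \<in> Field r \<Longrightarrow> Q \<beta> X X' d"
proof -
  interpret category C by fact
  define good where "good \<beta> X X' d \<longleftrightarrow> trans_seq_at C UNIV r X X' \<beta> \<and> Q \<beta> X X' d"
    for \<beta> X X' and d :: "'a \<Rightarrow> 'd"
  have good_cong: "good \<beta> X X' d = good \<beta> Y Y' d'"
    if eq: "\<beta> \<in> Field r" "\<And>\<alpha>. (\<alpha>, \<beta>) \<in> r \<Longrightarrow> X \<alpha> = Y \<alpha> \<and> d \<alpha> = d' \<alpha>"
      "\<And>\<alpha> \<gamma>. \<lbrakk>(\<alpha>, \<gamma>) \<in> r; (\<gamma>, \<beta>) \<in> r\<rbrakk> \<Longrightarrow> X' (\<alpha>, \<gamma>) = Y' (\<alpha>, \<gamma>)" for \<beta> X Y X' Y' d d'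
  proof -
    have "Q \<beta> Y Y' d'" if q: "Q \<beta> X X' d"
      by (rule local[OF _ _ _ q]) (simp_all add: eq)
    moreover have "Q \<beta> X X' d" if q: "Q \<beta> Y Y' d'"
      by (rule local[OF _ _ _ q]) (simp_all add: eq)
    moreover have "trans_seq_at C UNIV r X X' \<beta> \<longleftrightarrow> trans_seq_at C UNIV r Y Y' \<beta>"
      by (rule trans_seq_at_cong[OF r eq(1)]) (simp_all add: eq)
    ultimately show ?thesis unfolding good_def by (metis (no_types))
  qed
  \<comment> \<open>The value of the recursion at a stage consists of its object, the maps to it and its decoration.\<close>
  define ob where "ob f = (\<lambda>\<alpha>. fst (f \<alpha>))" for f :: "'a \<Rightarrow> 'o \<times> ('a \<Rightarrow> 'm) \<times> 'd"
  define ma where "ma f = (\<lambda>u. fst (snd (f (snd u))) (fst u))" for f :: "'a \<Rightarrow> 'o \<times> ('a \<Rightarrow> 'm) \<times> 'd"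
  define de where "de f = (\<lambda>\<alpha>. snd (snd (f \<alpha>)))" for f :: "'a \<Rightarrow> 'o \<times> ('a \<Rightarrow> 'm) \<times> 'd"
  have upd: "ob (f(\<beta> := x)) = (ob f)(\<beta> := fst x)" "ma (f(\<beta> := x)) = extend_map \<beta> (fst (snd x)) (ma f)"
    "de (f(\<beta> := x)) = (de f)(\<beta> := snd (snd x))" for f \<beta> x
    by (auto simp: ob_def ma_def de_def extend_map_def)
  have "\<exists>f. \<forall>\<beta>. \<beta> \<in> Field r \<longrightarrow> good \<beta> (ob (f(\<beta> := f \<beta>))) (ma (f(\<beta> := f \<beta>))) (de (f(\<beta> := f \<beta>)))"
  proof (rule dependent_wf_choice[OF Well_orderD(5)[OF r]])
    fix f g :: "'a \<Rightarrow> 'o \<times> ('a \<Rightarrow> 'm) \<times> 'd" and \<beta> x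
    assume eq: "\<And>\<alpha>. (\<alpha>, \<beta>) \<in> r - Relation.Id \<Longrightarrow> f \<alpha> = g \<alpha>"
    have eq': "(f(\<beta> := x)) \<alpha> = (g(\<beta> := x)) \<alpha>" if "(\<alpha>, \<beta>) \<in> r" for \<alpha> using eq that by auto
    have "good \<beta> (ob (f(\<beta> := x))) (ma (f(\<beta> := x))) (de (f(\<beta> := x))) =
        good \<beta> (ob (g(\<beta> := x))) (ma (g(\<beta> := x))) (de (g(\<beta> := x)))" if "\<beta> \<in> Field r"
    proof (rule good_cong[OF that])
      show "ob (f(\<beta> := x)) \<alpha> = ob (g(\<beta> := x)) \<alpha> \<and> de (f(\<beta> := x)) \<alpha> = de (g(\<beta> := x)) \<alpha>"
        if "(\<alpha>, \<beta>) \<in> r" for \<alpha> unfolding ob_def de_def eq'[OF that] by blast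
      show "ma (f(\<beta> := x)) (\<alpha>, \<gamma>) = ma (g(\<beta> := x)) (\<alpha>, \<gamma>)"
        if "(\<alpha>, \<gamma>) \<in> r" "(\<gamma>, \<beta>) \<in> r" for \<alpha> \<gamma>
        unfolding ma_def snd_conv eq'[OF that(2)] by blast
    qed
    then show "(\<beta> \<in> Field r \<longrightarrow> good \<beta> (ob (f(\<beta> := x))) (ma (f(\<beta> := x))) (de (f(\<beta> := x)))) =
        (\<beta> \<in> Field r \<longrightarrow> good \<beta> (ob (g(\<beta> := x))) (ma (g(\<beta> := x))) (de (g(\<beta> := x))))"
      by blast
  next
    fix \<beta> and f :: "'a \<Rightarrow> 'o \<times> ('a \<Rightarrow> 'm) \<times> 'd"
    assume IH: "\<And>\<alpha>. (\<alpha>, \<beta>) \<in> r - Relation.Id \<Longrightarrow>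
      \<alpha> \<in> Field r \<longrightarrow> good \<alpha> (ob (f(\<alpha> := f \<alpha>))) (ma (f(\<alpha> := f \<alpha>))) (de (f(\<alpha> := f \<alpha>)))"
    have IH': "good \<alpha> (ob f) (ma f) (de f)" if "\<alpha> \<in> underS r \<beta>" for \<alpha>
      using IH[of \<alpha>] that by (auto simp: underS_def Field_def fun_upd_triv)
    show "\<exists>x. \<beta> \<in> Field r \<longrightarrow> good \<beta> (ob (f(\<beta> := x))) (ma (f(\<beta> := x))) (de (f(\<beta> := x)))"
    proof (cases "\<beta> \<in> Field r")
      case \<beta>: True
      have t: "trans_seq C UNIV (Restr r (underS r \<beta>)) (ob f) (ma f)"
        using trans_seq_Restr_iff[OF C r ofilter_underS[OF r]] IH' by (auto simp: good_def)
      then have fu: "cat_functor (ord_cat (Restr r (underS r \<beta>))) C (ob f) (ma f)"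
        by (simp add: trans_seq_def)
      note F = Field_Restr_initial[OF r ofilter_underS[OF r], of \<beta>]
      have R: "(\<alpha>, \<gamma>) \<in> Restr r (underS r \<beta>)" if "(\<alpha>, \<gamma>) \<in> r" "\<gamma> \<in> underS r \<beta>" for \<alpha> \<gamma>
        using that underS_trans(2)[OF r that] by simp
      note fD = ord_functorD[OF fu, unfolded F]
      have ex: "\<exists>x. good \<beta> (ob (f(\<beta> := x))) (ma (f(\<beta> := x))) (de (f(\<beta> := x)))"
        if "Y \<in> Obj C" "\<And>\<alpha>. \<alpha> \<in> underS r \<beta> \<Longrightarrow> m \<alpha> \<in> hom C (ob f \<alpha>) Y"
          "\<And>\<alpha> \<gamma>. \<lbrakk>(\<alpha>, \<gamma>) \<in> r; \<gamma> \<in> underS r \<beta>\<rbrakk> \<Longrightarrow> Comp C (m \<gamma>) (ma f (\<alpha>, \<gamma>)) = m \<alpha>"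
          "limit_point r \<beta> \<Longrightarrow> is_colimit (ord_cat (Restr r (underS r \<beta>))) C (ob f) (ma f) Y m"
          "Q \<beta> ((ob f)(\<beta> := Y)) (extend_map \<beta> (m(\<beta> := Id C Y)) (ma f)) ((de f)(\<beta> := d1))" for Y m d1
        using trans_seq_at_extend[OF C r \<beta> that(1-4)] that(5)
        by (intro exI[of _ "(Y, m(\<beta> := Id C Y), d1)"]) (auto simp: good_def upd)
      show ?thesis
      proof (cases "underS r \<beta> = {}")
        case True
        obtain d0 where "Q \<beta> ((ob f)(\<beta> := X0)) (extend_map \<beta> (\<lambda>_. Id C X0) (ma f)) ((de f)(\<beta> := d0))"
          using zero[OF \<beta> True] by blast
        then show ?thesis
          using True X0 ex[of X0 "\<lambda>_. Id C X0" d0] by (simp add: limit_point_def fun_upd_idem)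
      next
        case ne: False
        show ?thesis
        proof (cases "limit_point r \<beta>")
          case True
          have "small U (Field (Restr r (underS r \<beta>)))" "small U (Restr r (underS r \<beta>))"
            using sm[OF \<beta>] small_Sigma[OF U sm[OF \<beta>] sm[OF \<beta>]] unfolding F
            by (auto elim: small_mono)
          then obtain L \<iota> where L: "is_colimit (ord_cat (Restr r (underS r \<beta>))) C (ob f) (ma f) L \<iota>"
            using small_colimit_exists[OF co fu] by auto
          obtain d1 where "Q \<beta> ((ob f)(\<beta> := L)) (extend_map \<beta> (\<iota>(\<beta> := Id C L)) (ma f)) ((de f)(\<beta> := d1))"
            using lim[OF True t _ L] IH' by (auto simp: good_def)
          then show ?thesis using ex[of L \<iota> d1] ord_colimitD[OF L, unfolded F] L R ne by auto
        next
          case False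
          then obtain \<alpha> where s: "is_succ r \<alpha> \<beta>" using ne \<beta> by (auto simp: limit_point_def)
          note sD = is_succD[OF r s]
          obtain Y g d1 where g: "g \<in> hom C (ob f \<alpha>) Y"
            and q: "Q \<beta> ((ob f)(\<beta> := Y))
              (extend_map \<beta> ((\<lambda>\<gamma>. Comp C g (ma f (\<gamma>, \<alpha>)))(\<beta> := Id C Y)) (ma f)) ((de f)(\<beta> := d1))"
            using succ[OF s, of "ob f" "ma f" "de f"] t IH' sD(5) by (auto simp: good_def)
          show ?thesis
          proof (rule exE[OF ex[of Y "\<lambda>\<gamma>. Comp C g (ma f (\<gamma>, \<alpha>))" d1]])
            show "Y \<in> Obj C" using hom_Obj(2)[OF g] .
            fix \<gamma> assume \<gamma>: "\<gamma> \<in> underS r \<beta>"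
            then have ga: "(\<gamma>, \<alpha>) \<in> r" using sD(5) by (simp add: under_def)
            note h = fD(2)[OF R[OF ga sD(1)]]
            show "Comp C g (ma f (\<gamma>, \<alpha>)) \<in> hom C (ob f \<gamma>) Y" using Comp_hom[OF h g] .
            fix \<delta> assume \<delta>: "(\<delta>, \<gamma>) \<in> r"
            show "Comp C (Comp C g (ma f (\<gamma>, \<alpha>))) (ma f (\<delta>, \<gamma>)) = Comp C g (ma f (\<delta>, \<alpha>))"
              using Comp_assoc[OF fD(2)[OF R[OF \<delta> \<gamma>]] h g] fD(4)[OF R[OF \<delta> \<gamma>] R[OF ga sD(1)]] by simp
          qed (use q ne False in auto)
        qed
      qed
    qed simp
  qed
  then obtain f where f: "\<And>\<beta>. \<beta> \<in> Field r \<Longrightarrow> good \<beta> (ob f) (ma f) (de f)"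
    by (auto simp: fun_upd_triv)
  show ?thesis
    by (rule that[of "ob f" "ma f" "de f"]) (use f trans_seq_iff[OF C r] in \<open>auto simp: good_def\<close>)
qed


section \<open>Ordinals closed under small operations\<close>

text \<open>The universe, well-ordered in its least order type, serves as the ordinal along which objects
  are enlarged: its proper initial segments are small and its small subsets bounded.\<close>

abbreviation univ_ord :: "'u itself \<Rightarrow> 'u rel" where
  "univ_ord U \<equiv> |UNIV :: 'u set|"

lemma small_underS_univ:
  assumes "universe (U :: 'u itself)" shows "small U (underS (univ_ord U) \<beta>)"
  unfolding small_def by (rule card_of_underS) (simp_all add: card_of_card_order_on Field_card_of)

lemma small_under_univ:
  assumes "universe (U :: 'u itself)" shows "small U (under (univ_ord U) \<beta>)"
proof -
  have "under (univ_ord U) \<beta> = (\<Union>A\<in>{underS (univ_ord U) \<beta>, {\<beta>}}. A)"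
    using Refl_under_underS[OF Well_orderD(1)[OF card_of_Well_order], of \<beta>]
    by (auto simp: Field_card_of)
  also have "small U \<dots>"
    by (rule small_UN[OF assms]) (auto simp: small_underS_univ[OF assms] small_finite[OF assms])
  finally show ?thesis .
qed

lemma not_small_UNIV: "\<not> small (U :: 'u itself) (UNIV :: 'u set)"
  by (simp add: small_def ordLess_irreflexive)

lemma small_bounded:
  assumes U: "universe (U :: 'u itself)" and A: "small U (A :: 'u set)"
  obtains b where "A \<subseteq> underS (univ_ord U) b"
proof -
  note r = card_of_Well_order[of "UNIV :: 'u set"]
  have "small U (\<Union>a\<in>A. under (univ_ord U) a)"
    by (rule small_UN[OF U A]) (rule small_under_univ[OF U])
  then obtain b where b: "b \<notin> (\<Union>a\<in>A. under (univ_ord U) a)" using not_small_UNIV[of U] by (metis UNIV_eq_I)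
  have "a \<in> underS (univ_ord U) b" if "a \<in> A" for a
    using Well_order_cases[OF r, of a b] b that Well_orderD(1)[OF r]
    by (auto simp: Field_card_of under_def underS_def refl_on_def)
  then show ?thesis using that by blast
qed

lemma small_Un:
  assumes U: "universe U" and "small U A" "small U B" shows "small U (A \<union> B)"
  using small_UN[OF U small_finite[OF U, of "{A, B}"], of id] assms by auto

text \<open>
  The ordinal is the supremum of an increasing sequence, of length the successor cardinal of an
  infinite cardinal above \<open>\<kappa>\<close>, each of whose terms exceeds everything that \<open>H\<close> assigns to the
  ordinals up to an earlier term. The length being regular, the supremum has cofinality above \<open>\<kappa>\<close>.
\<close>

lemma closed_limit_ordinal:
  fixes H :: "'u \<Rightarrow> 'u set" and \<kappa> :: "'u set"
  assumes U: "universe (U :: 'u itself)" and H: "\<And>\<alpha>. small U (H \<alpha>)" and \<kappa>: "small U \<kappa>"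
  obtains l where "limit_point (univ_ord U) l"
    "filtered_ord \<kappa> (Restr (univ_ord U) (underS (univ_ord U) l))"
    "\<And>\<alpha>. \<alpha> \<in> underS (univ_ord U) l \<Longrightarrow> H \<alpha> \<subseteq> underS (univ_ord U) l"
proof -
  let ?r = "univ_ord U"
  note r = card_of_Well_order[of "UNIV :: 'u set"]
  have rF [simp]: "Field ?r = UNIV" by (rule Field_card_of)
  obtain n :: "nat \<Rightarrow> 'u" where n: "inj n"
    using universe_infinite[OF U] infinite_countable_subset by blast
  define \<kappa>' where "\<kappa>' = \<kappa> \<union> range n"
  have "small U (range n)"
    by (rule small_natLeq[OF U])
      (use card_of_image[of n UNIV] card_of_nat ordLeq_ordIso_trans in blast)
  then have \<kappa>': "small U \<kappa>'" using small_Un[OF U \<kappa>] by (simp add: \<kappa>'_def)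
  have inf: "infinite \<kappa>'" using n finite_imageD[of n UNIV] by (auto simp: \<kappa>'_def)
  define \<mu> where "\<mu> = cardSuc |\<kappa>'|"
  have \<mu>C: "Card_order \<mu>" by (simp add: \<mu>_def cardSuc_Card_order card_of_Card_order)
  then have \<mu>W: "Well_order \<mu>" by (simp add: card_order_on_def)
  have \<mu>g: "|\<kappa>'| <o \<mu>" by (simp add: \<mu>_def cardSuc_greater card_of_Card_order)
  have \<mu>inf: "infinite (Field \<mu>)"
    using inf by (simp add: \<mu>_def cardSuc_finite[OF card_of_Card_order] Field_card_of)
  have \<mu>reg: "regularCard \<mu>"
    using inf infinite_cardSuc_regularCard[OF _ card_of_Card_order, of \<kappa>'] by (simp add: \<mu>_def Field_card_of)
  have "\<mu> \<le>o |Pow \<kappa>'|"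
    unfolding \<mu>_def by (rule cardSuc_least) (simp_all add: card_of_Card_order card_of_Pow)
  then have \<mu>s: "small U (Field \<mu>)"
    using small_ordLeq[OF small_Pow[OF U \<kappa>']] card_of_Field_ordIso[OF \<mu>C] ordIso_ordLeq_trans by blast
  have \<mu>lim: "\<exists>\<zeta>. \<xi> \<in> underS \<mu> \<zeta>" if "\<xi> \<in> Field \<mu>" for \<xi>
    using infinite_Card_order_limit[OF \<mu>C \<mu>inf that] by (auto simp: underS_def)
  define step where "step f \<xi> x \<longleftrightarrow> (\<forall>\<eta>\<in>underS \<mu> \<xi>. f \<eta> \<in> underS ?r x \<and>
      (\<forall>\<alpha>\<in>under ?r (f \<eta>). H \<alpha> \<subseteq> underS ?r x))" for f :: "'u set \<Rightarrow> 'u" and \<xi> x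
  have "\<exists>g. \<forall>\<xi>. step g \<xi> (g \<xi>)"
  proof (rule dependent_wf_choice[OF Well_orderD(5)[OF \<mu>W]])
    fix f g :: "'u set \<Rightarrow> 'u" and \<xi> x assume "\<And>\<eta>. (\<eta>, \<xi>) \<in> \<mu> - Relation.Id \<Longrightarrow> f \<eta> = g \<eta>"
    then show "step f \<xi> x = step g \<xi> x" by (auto simp: step_def underS_def)
  next
    fix \<xi> and f :: "'u set \<Rightarrow> 'u"
    have "small U (\<Union>\<eta>\<in>underS \<mu> \<xi>. {f \<eta>} \<union> (\<Union>\<alpha>\<in>under ?r (f \<eta>). H \<alpha>))"
    proof (rule small_UN[OF U])
      show "small U (underS \<mu> \<xi>)" using \<mu>s small_mono underS_Field by (metis subsetI)
      show "small U ({f \<eta>} \<union> (\<Union>\<alpha>\<in>under ?r (f \<eta>). H \<alpha>))" for \<eta>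
        by (intro small_Un[OF U] small_finite[OF U] small_UN[OF U] small_under_univ[OF U] H) simp
    qed
    then obtain x where "(\<Union>\<eta>\<in>underS \<mu> \<xi>. {f \<eta>} \<union> (\<Union>\<alpha>\<in>under ?r (f \<eta>). H \<alpha>)) \<subseteq> underS ?r x"
      using small_bounded[OF U] by blast
    then have "step f \<xi> x" unfolding step_def by blast
    then show "\<exists>x. step f \<xi> x" ..
  qed
  then obtain g where "\<And>\<xi>. step g \<xi> (g \<xi>)" by blast
  then have g: "g \<eta> \<in> underS ?r (g \<xi>)" "\<And>\<alpha>. \<alpha> \<in> under ?r (g \<eta>) \<Longrightarrow> H \<alpha> \<subseteq> underS ?r (g \<xi>)"
    if "\<eta> \<in> underS \<mu> \<xi>" for \<eta> \<xi> using that by (auto simp: step_def)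
  define S where "S = (\<Union>\<xi>\<in>Field \<mu>. under ?r (g \<xi>))"
  have "small U S" unfolding S_def by (rule small_UN[OF U \<mu>s]) (rule small_under_univ[OF U])
  then obtain b where "b \<notin> S" using not_small_UNIV[of U] by (metis UNIV_eq_I)
  then obtain l where l: "l \<notin> S" "\<And>\<alpha>. \<alpha> \<in> underS ?r l \<Longrightarrow> \<alpha> \<in> S"
  proof -
    obtain l where "l \<in> - S" "\<And>\<alpha>. (\<alpha>, l) \<in> ?r - Relation.Id \<Longrightarrow> \<alpha> \<notin> - S"
      using wfE_min[OF Well_orderD(5)[OF r], of b "- S"] \<open>b \<notin> S\<close> by (metis ComplI)
    then show ?thesis using that[of l] unfolding underS_def by fast
  qed
  have Sdown: "\<beta> \<in> S" if a: "\<alpha> \<in> S" "(\<beta>, \<alpha>) \<in> ?r" for \<alpha> \<beta>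
  proof -
    obtain \<xi> where "\<xi> \<in> Field \<mu>" "(\<alpha>, g \<xi>) \<in> ?r" using a(1) by (auto simp: S_def under_def)
    then show ?thesis
      using transD[OF Well_orderD(2)[OF r] a(2)] by (auto simp: S_def under_def)
  qed
  have eq: "underS ?r l = S"
  proof
    show "S \<subseteq> underS ?r l"
      using Well_order_cases[OF r, of _ l] l(1) Sdown by (auto simp: underS_def)
  qed (use l in blast)
  have gS: "g \<xi> \<in> S" if "\<xi> \<in> Field \<mu>" for \<xi>
    using that Well_orderD(1)[OF r] by (auto simp: S_def under_def refl_on_def)
  have F\<mu>: "\<zeta> \<in> Field \<mu>" if "\<xi> \<in> underS \<mu> \<zeta>" for \<xi> \<zeta> using that by (auto simp: underS_def Field_def)
  have up: "\<exists>\<beta>\<in>S. \<alpha> \<in> underS ?r \<beta> \<and> H \<alpha> \<subseteq> S" if a: "\<alpha> \<in> S" for \<alpha>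
  proof -
    obtain \<xi> where \<xi>: "\<xi> \<in> Field \<mu>" "\<alpha> \<in> under ?r (g \<xi>)" using a by (auto simp: S_def)
    obtain \<zeta> where \<zeta>: "\<xi> \<in> underS \<mu> \<zeta>" using \<mu>lim[OF \<xi>(1)] by blast
    have "\<alpha> \<in> underS ?r (g \<zeta>)" using underS_trans(2)[OF r _ g(1)[OF \<zeta>]] \<xi>(2) by (simp add: under_def)
    moreover have "H \<alpha> \<subseteq> S" using g(2)[OF \<zeta> \<xi>(2)] gS[OF F\<mu>[OF \<zeta>]] Sdown by (auto simp: underS_def)
    ultimately show ?thesis using gS[OF F\<mu>[OF \<zeta>]] by blast
  qed
  have ne: "S \<noteq> {}" using gS infinite_imp_nonempty[OF \<mu>inf] by blast
  note SO = ofilter_underS[OF r, of l, unfolded eq]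
  have "limit_point ?r l"
    unfolding limit_point_def eq
  proof (intro conjI notI)
    assume "\<exists>\<alpha>. is_succ ?r \<alpha> l"
    then obtain \<alpha> where "is_succ ?r \<alpha> l" by blast
    then have a: "\<alpha> \<in> S" "S = under ?r \<alpha>" using is_succD[OF r] eq by auto
    then obtain \<beta> where "\<beta> \<in> S" "\<alpha> \<in> underS ?r \<beta>" using up by blast
    then show False using a Well_orderD(3)[OF r] by (auto simp: under_def underS_def antisym_def)
  qed (use ne in auto)
  moreover have "filtered_ord \<kappa> (Restr ?r S)"
    unfolding filtered_ord_def Field_Restr_initial[OF r SO]
  proof (intro conjI ballI allI impI)
    show "well_order_on S (Restr ?r S)"
      using Well_order_Restr[OF r, of S] unfolding Field_Restr_initial[OF r SO] .
    show "S \<noteq> {}" by fact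
    show "\<exists>\<beta>. \<alpha> \<in> underS (Restr ?r S) \<beta>" if "\<alpha> \<in> S" for \<alpha>
      using up[OF that] underS_Restr[OF SO] by blast
    fix A assume A: "A \<subseteq> S" "|A| \<le>o |\<kappa>|"
    then have "\<forall>a\<in>A. \<exists>\<xi>. \<xi> \<in> Field \<mu> \<and> (a, g \<xi>) \<in> ?r" by (auto simp: S_def under_def)
    then obtain x where x: "\<And>a. a \<in> A \<Longrightarrow> x a \<in> Field \<mu> \<and> (a, g (x a)) \<in> ?r" by metis
    have "|\<kappa>| \<le>o |\<kappa>'|" by (rule card_of_mono1) (simp add: \<kappa>'_def)
    then have "|x ` A| \<le>o |\<kappa>'|"
      using card_of_image[of x A] A(2) ordLeq_transitive by blast
    then have "|x ` A| <o \<mu>" using \<mu>g ordLeq_ordLess_trans by blast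
    then have "\<not> |x ` A| =o \<mu>" using not_ordLess_ordIso by blast
    then have "\<not> cofinal (x ` A) \<mu>" using \<mu>reg x unfolding regularCard_def by blast
    then obtain \<zeta> where \<zeta>: "\<zeta> \<in> Field \<mu>" "\<And>\<xi>. \<xi> \<in> x ` A \<Longrightarrow> \<xi> = \<zeta> \<or> (\<zeta>, \<xi>) \<notin> \<mu>"
      unfolding cofinal_def by blast
    have "(a, g \<zeta>) \<in> ?r" if "a \<in> A" for a
    proof -
      have "x a = \<zeta> \<or> x a \<in> underS \<mu> \<zeta>"
        using Well_order_cases[OF \<mu>W, of "x a" \<zeta>] \<zeta>(1) \<zeta>(2)[of "x a"] x[OF that] that
        by (auto simp: underS_def)
      then have "(g (x a), g \<zeta>) \<in> ?r"
        using g(1)[of "x a" \<zeta>] Well_orderD(1)[OF r] by (auto simp: underS_def refl_on_def)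
      then show ?thesis using x[OF that] Well_orderD(2)[OF r] by (auto dest: transD)
    qed
    then show "\<exists>\<beta>\<in>S. \<forall>\<alpha>\<in>A. (\<alpha>, \<beta>) \<in> Restr ?r S"
      using gS[OF \<zeta>(1)] A(1) by blast
  qed
  ultimately show ?thesis using that[of l] up by (auto simp: eq)
qed

text \<open>The bookkeeping function inverts an injection of \<open>('u \<times> 'u) \<times> 'u\<close> into \<open>'u\<close>. Each of its fibres
  has the cardinality of the universe and is thus not contained in a small initial segment.\<close>

lemma bookkeeping_exists:
  assumes U: "universe (U :: 'u itself)"
  obtains b :: "'u \<Rightarrow> 'u \<times> 'u" where "\<And>p \<alpha>. \<exists>\<beta>. (\<alpha>, \<beta>) \<in> univ_ord U \<and> b \<beta> = p"
proof -
  note r = card_of_Well_order[of "UNIV :: 'u set"]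
  note inf = universe_infinite[OF U]
  have "|UNIV \<times> UNIV :: ('u \<times> 'u) set| \<le>o univ_ord U"
    by (rule card_of_Times_ordLeq_infinite_Field)
      (use inf in \<open>auto simp: Field_card_of card_of_card_order_on card_of_mono1\<close>)
  then have "|(UNIV \<times> UNIV) \<times> UNIV :: (('u \<times> 'u) \<times> 'u) set| \<le>o univ_ord U"
    by (intro card_of_Times_ordLeq_infinite_Field)
      (use inf in \<open>auto simp: Field_card_of card_of_card_order_on card_of_mono1\<close>)
  then obtain j :: "('u \<times> 'u) \<times> 'u \<Rightarrow> 'u" where j: "inj j"
    using card_of_ordLeq[of "(UNIV \<times> UNIV) \<times> UNIV :: (('u \<times> 'u) \<times> 'u) set" "UNIV :: 'u set"] by auto
  have "\<exists>\<beta>. (\<alpha>, \<beta>) \<in> univ_ord U \<and> fst (inv j \<beta>) = p" for p \<alpha>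
  proof (rule ccontr)
    assume no: "\<not> ?thesis"
    have "j (p, x) \<in> underS (univ_ord U) \<alpha>" for x
    proof -
      have "fst (inv j (j (p, x))) = p" using j by simp
      then have "(\<alpha>, j (p, x)) \<notin> univ_ord U" using no by blast
      then show ?thesis
        using Well_order_cases[OF r, of "j (p, x)" \<alpha>] Well_orderD(1)[OF r]
        by (auto simp: Field_card_of underS_def refl_on_def)
    qed
    then have "range (\<lambda>x. j (p, x)) \<subseteq> underS (univ_ord U) \<alpha>" by blast
    then have "small U (range (\<lambda>x. j (p, x)))" using small_mono small_underS_univ[OF U] by blast
    moreover have "inj (\<lambda>x. j (p, x))" by (rule injI) (drule injD[OF j], simp)
    then have "|UNIV :: 'u set| \<le>o |range (\<lambda>x. j (p, x))|"
      by (intro card_of_ordLeqI[of "\<lambda>x. j (p, x)"]) auto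
    ultimately show False using small_ordLeq[of U] not_small_UNIV[of U] by blast
  qed
  then show ?thesis using that[of "\<lambda>\<beta>. fst (inv j \<beta>)"] by blast
qed

section \<open>The small object argument\<close>

text \<open>
  The surjectivity half of smallness, which is what the small object argument consumes: maps from
  \<open>A\<close> into the colimit of a long sequence factor through a stage.
\<close>

definition factors_through_stage ::
  "'u itself \<Rightarrow> 'u set \<Rightarrow> ('o, 'm) cat \<Rightarrow> 'm set \<Rightarrow> 'o \<Rightarrow> bool" where
  "factors_through_stage U \<kappa> C K A \<longleftrightarrow>
     (\<forall>(r :: 'u rel) X X' L \<iota> a.
        small U (Field r) \<and> filtered_ord \<kappa> r \<and> trans_seq C K r X X' \<and>
        is_colimit (ord_cat r) C X X' L \<iota> \<and> a \<in> hom C A L \<longrightarrow>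
        (\<exists>\<beta> \<in> Field r. \<exists>a' \<in> hom C A (X \<beta>). Comp C (\<iota> \<beta>) a' = a))"

definition weakly_small :: "'u itself \<Rightarrow> ('o, 'm) cat \<Rightarrow> 'm set \<Rightarrow> 'o \<Rightarrow> bool" where
  "weakly_small U C K A \<longleftrightarrow> (\<exists>\<kappa>. small U \<kappa> \<and> factors_through_stage U \<kappa> C K A)"

lemma factors_through_stageI:
  fixes \<kappa> :: "'u set"
  assumes "\<And>(r :: 'u rel) X X' L \<iota> a. \<lbrakk>small U (Field r); filtered_ord \<kappa> r; trans_seq C K r X X';
     is_colimit (ord_cat r) C X X' L \<iota>; a \<in> hom C A L\<rbrakk> \<Longrightarrow>
     \<exists>\<beta> \<in> Field r. \<exists>a' \<in> hom C A (X \<beta>). Comp C (\<iota> \<beta>) a' = a"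
  shows "factors_through_stage U \<kappa> C K A"
  unfolding factors_through_stage_def by (intro allI impI, elim conjE) (rule assms)

lemma factors_through_stageE:
  fixes U :: "'u itself" and r :: "'u rel"
  assumes "factors_through_stage U \<kappa> C K A"
    and "small U (Field r)" "filtered_ord \<kappa> r" "trans_seq C K r X X'"
    and "is_colimit (ord_cat r) C X X' L \<iota>" "a \<in> hom C A L"
  obtains \<beta> a' where "\<beta> \<in> Field r" "a' \<in> hom C A (X \<beta>)" "Comp C (\<iota> \<beta>) a' = a"
  using assms(1)[unfolded factors_through_stage_def, THEN spec[of _ r], THEN spec[of _ X],
      THEN spec[of _ X'], THEN spec[of _ L], THEN spec[of _ \<iota>], THEN spec[of _ a]] assms(2-6) that
  by blast

lemma factors_through_stage_mono:
  fixes U :: "'u itself"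
  assumes "factors_through_stage U \<kappa> C K A" "\<kappa> \<subseteq> \<kappa>'" "K' \<subseteq> K"
  shows "factors_through_stage U \<kappa>' C K' A"
proof (rule factors_through_stageI)
  fix r :: "'u rel" and X X' L \<iota> a
  assume "small U (Field r)" "filtered_ord \<kappa>' r" and t: "trans_seq C K' r X X'"
    and "is_colimit (ord_cat r) C X X' L \<iota>" "a \<in> hom C A L"
  moreover from this have "filtered_ord \<kappa> r"
    using ordLeq_transitive[OF _ card_of_mono1[OF assms(2)]] unfolding filtered_ord_def by blast
  ultimately show "\<exists>\<beta> \<in> Field r. \<exists>a' \<in> hom C A (X \<beta>). Comp C (\<iota> \<beta>) a' = a"
    using factors_through_stageE[OF assms(1) _ _ trans_seq_mono[OF t assms(3)]] by metis
qed

lemma weakly_small_mono: "\<lbrakk>weakly_small U C K A; K' \<subseteq> K\<rbrakk> \<Longrightarrow> weakly_small U C K' A"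
  unfolding weakly_small_def using factors_through_stage_mono by (metis subset_refl)

lemma small_rel_weakly_small:
  assumes C: "category C" and s: "small_rel (U :: 'u itself) C K A"
  shows "weakly_small U C K A"
proof -
  interpret category C by fact
  obtain \<kappa> :: "'u set" where \<kappa>: "small U \<kappa>"
    and bij: "\<And>(r :: 'u rel) X X' L \<iota>. \<lbrakk>small U (Field r); filtered_ord \<kappa> r; trans_seq C K r X X';
       is_colimit (ord_cat r) C X X' L \<iota>\<rbrakk> \<Longrightarrow>
       bij_betw (hom_colim_map C \<iota>) (hom_colim C A r X X') (hom C A L)"
    using s unfolding small_rel_def by blast
  have factor: "\<exists>\<beta>\<in>Field r. \<exists>a'\<in>hom C A (X \<beta>). Comp C (\<iota> \<beta>) a' = a"
    if r: "small U (Field r)" "filtered_ord \<kappa> r" "trans_seq C K r X X'"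
      "is_colimit (ord_cat r) C X X' L \<iota>" and a: "a \<in> hom C A L"
    for r :: "'u rel" and X X' L \<iota> a
  proof -
    have fu: "cat_functor (ord_cat r) C X X'" using r(3) by (simp add: trans_seq_def)
    note fD = ord_functorD[OF fu] and LD = ord_colimitD[OF r(4)]
    have "a \<in> hom_colim_map C \<iota> ` hom_colim C A r X X'"
      using bij[OF r] a by (simp add: bij_betw_def)
    then obtain c where c: "c \<in> hom_colim C A r X X'" "a = hom_colim_map C \<iota> c" by blast
    then obtain \<beta> f where \<beta>: "\<beta> \<in> Field r" "f \<in> hom C A (X \<beta>)" "c = hom_rel C A r X X' `` {(\<beta>, f)}"
      by (auto simp: hom_colim_def hom_sum_def elim!: quotientE)
    have "(\<beta>, \<beta>) \<in> r"
      using r(3) \<beta>(1) Well_orderD(1)[of r] by (auto simp: trans_seq_def refl_on_def)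
    then have mem: "(\<beta>, f) \<in> c" using \<beta> by (auto simp: hom_rel_def hom_sum_def)
    have "Comp C (\<iota> \<gamma>) g = Comp C (\<iota> \<beta>) f" if gg: "(\<gamma>, g) \<in> c" for \<gamma> g
    proof -
      obtain \<delta> where \<delta>: "(\<beta>, \<delta>) \<in> r" "(\<gamma>, \<delta>) \<in> r"
          "Comp C (X' (\<beta>, \<delta>)) f = Comp C (X' (\<gamma>, \<delta>)) g" and g: "g \<in> hom C A (X \<gamma>)"
        using gg unfolding \<beta>(3) hom_rel_def hom_sum_def by auto
      have \<delta>F: "\<delta> \<in> Field r" using \<delta> by (auto simp: Field_def)
      show ?thesis
        using Comp_assoc[OF \<beta>(2) fD(2)[OF \<delta>(1)] LD(2)[OF \<delta>F]]
          Comp_assoc[OF g fD(2)[OF \<delta>(2)] LD(2)[OF \<delta>F]] LD(3)[OF \<delta>(1)] LD(3)[OF \<delta>(2)] \<delta>(3) by simp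
    qed
    then have "(case x of (\<beta>, f) \<Rightarrow> Comp C (\<iota> \<beta>) f) = Comp C (\<iota> \<beta>) f" if "x \<in> c" for x
      using that by (cases x) (simp only: prod.case)
    then have "(\<lambda>(\<beta>, f). Comp C (\<iota> \<beta>) f) ` c = (\<lambda>_. Comp C (\<iota> \<beta>) f) ` c"
      by (rule image_cong[OF refl])
    also have "\<dots> = {Comp C (\<iota> \<beta>) f}" using mem by (rule image_constant)
    finally have "(\<lambda>(\<beta>, f). Comp C (\<iota> \<beta>) f) ` c = {Comp C (\<iota> \<beta>) f}" .
    then have "a = Comp C (\<iota> \<beta>) f" using c by (simp add: hom_colim_map_def)
    then show ?thesis using \<beta> by blast
  qed
  show ?thesis
    unfolding weakly_small_def
    by (intro exI[of _ \<kappa>] conjI \<kappa> factors_through_stageI) (rule factor)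
qed

text \<open>One cardinal serves all members of a small family: the union of the individual ones.\<close>

lemma weakly_small_uniform:
  assumes U: "universe (U :: 'u itself)" and K: "small U K"
    and ws: "\<And>k. k \<in> K \<Longrightarrow> weakly_small U C S (D k)"
  obtains \<kappa> where "small U \<kappa>" "\<And>k. k \<in> K \<Longrightarrow> factors_through_stage U \<kappa> C S (D k)"
proof -
  obtain \<kappa> where \<kappa>: "\<And>k. k \<in> K \<Longrightarrow> small U (\<kappa> k) \<and> factors_through_stage U (\<kappa> k) C S (D k)"
    using ws unfolding weakly_small_def by metis
  have "small U (\<Union>k\<in>K. \<kappa> k)" by (rule small_UN[OF U K]) (simp add: \<kappa>)
  moreover have "factors_through_stage U (\<Union>k\<in>K. \<kappa> k) C S (D k)" if "k \<in> K" for k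
    by (rule factors_through_stage_mono[of U "\<kappa> k" C S]) (use \<kappa>[OF that] that in auto)
  ultimately show ?thesis by (rule that)
qed

text \<open>
  For each map \<open>f\<close>, a sequence of factorizations \<open>e \<beta> : X \<beta> \<rightarrow> Cod f\<close> is constructed by attaching one
  cell per stage. Every lifting problem of every stage is solved at a later stage that the
  bookkeeping function determines. At a stage closed under these assignments, of sufficiently large
  cofinality, each problem comes from an earlier stage and hence has a solution. A problem to be
  solved exists at each stage, unless a factorization has already been found.
\<close>

lemma small_object_argument:
  fixes C :: "('o, 'm) cat" (structure)
  assumes "category C" and U: "universe (U :: 'u itself)" and co: "cocomplete U C"
    and ls: "locally_small U C" and K: "K \<subseteq> Arr C" "small U K"
    and ws: "\<And>k. k \<in> K \<Longrightarrow> weakly_small U C (pushouts C K) (Dom C k)"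
    and f: "f \<in> Arr C"
  obtains q p where "q \<in> cell U C K" "p \<in> inj_maps C K" "Cod C q = Dom C p" "f = p \<cdot> q"
proof (rule ccontr)
  interpret category C by fact
  note cat = \<open>category C\<close>
  note factorization = that
  assume "\<not> thesis"
  then have no: False if "q \<in> cell U C K" "p \<in> inj_maps C K" "Cod C q = Dom C p" "f = p \<cdot> q" for q p
    using factorization[OF that] by blast
  let ?r = "univ_ord U"
  have r: "Well_order ?r" by (rule card_of_Well_order)
  have rF [simp]: "Field ?r = UNIV" by (rule Field_card_of)
  have rr: "(\<alpha>, \<alpha>) \<in> ?r" for \<alpha> using Well_orderD(1)[OF r] by (simp add: refl_on_def)
  define prob where "prob X e = {(k, u, v). k \<in> K \<and> u \<in> hom C (Dom C k) X \<and>
      v \<in> hom C (Cod C k) (Cod C f) \<and> e \<cdot> u = v \<cdot> k}" for X e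
  have prob_small: "small U (prob X e)" if "X \<in> Obj C" for X e
  proof -
    have "small U (SIGMA k : K. hom C (Dom C k) X \<times> hom C (Cod C k) (Cod C f))"
    proof (rule small_Sigma[OF U K(2)])
      fix k assume "k \<in> K"
      then have "k \<in> Arr C" using K by blast
      then show "small U (hom C (Dom C k) X \<times> hom C (Cod C k) (Cod C f))"
        using ls that f by (intro small_Sigma[OF U]) (auto simp: locally_small_def Dom_Obj Cod_Obj)
    qed
    then show ?thesis by (rule small_mono) (auto simp: prob_def)
  qed
  define enc :: "'o \<Rightarrow> 'm \<Rightarrow> 'm \<times> 'm \<times> 'm \<Rightarrow> 'u" where
    "enc X e = (SOME h. inj_on h (prob X e))" for X e
  have enc: "inj_on (enc X e) (prob X e)" if "X \<in> Obj C" for X e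
    unfolding enc_def using small_embedding[OF prob_small[OF that]] by (metis someI_ex)
  obtain b :: "'u \<Rightarrow> 'u \<times> 'u" where b: "\<And>p \<alpha>. \<exists>\<beta>. (\<alpha>, \<beta>) \<in> ?r \<and> b \<beta> = p"
    using bookkeeping_exists[OF U] by blast
  \<comment> \<open>If the bookkeeping designates a problem \<open>(k, u, v)\<close> of a stage \<open>\<gamma>\<close> up to \<open>\<alpha>\<close>, then the cell attached at
    \<open>\<alpha>\<close> solves its image at \<open>\<alpha>\<close>.\<close>
  define solved where "solved \<alpha> \<beta> X X' e \<longleftrightarrow> (\<forall>\<gamma> k u v. (\<gamma>, \<alpha>) \<in> ?r \<and>
      (k, u, v) \<in> prob (X \<gamma>) (e \<gamma>) \<and> b \<alpha> = (\<gamma>, enc (X \<gamma>) (e \<gamma>) (k, u, v)) \<longrightarrow>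
      (\<exists>p \<in> hom C (Cod C k) (X \<beta>). p \<cdot> k = X' (\<alpha>, \<beta>) \<cdot> (X' (\<gamma>, \<alpha>) \<cdot> u) \<and> e \<beta> \<cdot> p = v))"
    for \<alpha> \<beta> X X' and e :: "'u \<Rightarrow> 'm"
  define Q where "Q \<beta> X X' e \<longleftrightarrow> e \<beta> \<in> hom C (X \<beta>) (Cod C f) \<and> (underS ?r \<beta> = {} \<longrightarrow> e \<beta> = f) \<and>
      (\<forall>\<alpha>\<in>underS ?r \<beta>. e \<beta> \<cdot> X' (\<alpha>, \<beta>) = e \<alpha>) \<and>
      (\<forall>\<alpha>. is_succ ?r \<alpha> \<beta> \<longrightarrow> X' (\<alpha>, \<beta>) \<in> pushouts C K \<and> solved \<alpha> \<beta> X X' e)"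
    for \<beta> X X' and e :: "'u \<Rightarrow> 'm"
  have to_K: "trans_seq C (pushouts C K) (Restr ?r S) X X'"
    if S: "ofilter ?r S" and t: "trans_seq C UNIV (Restr ?r S) X X'" and q: "\<forall>\<gamma>\<in>S. Q \<gamma> X X' e"
    for S X X' e
    using t q unfolding trans_seq_Restr_iff[OF cat r S] by (auto simp: trans_seq_at_def Q_def)
  have in_cell: "X' (z, \<alpha>) \<in> cell U C K"
    if t: "trans_seq C UNIV (Restr ?r (under ?r \<alpha>)) X X'" and q: "\<forall>\<gamma>\<in>under ?r \<alpha>. Q \<gamma> X X' e"
      and z: "underS ?r z = {}" for X X' e z \<alpha>
  proof -
    note S = ofilter_under[OF r, of \<alpha>]
    note F = Field_Restr_initial[OF r S]
    have za: "z \<in> under ?r \<alpha>" using least_le[OF r _ z, of \<alpha>] by (simp add: under_def)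
    have aa: "\<alpha> \<in> under ?r \<alpha>" using rr by (simp add: under_def)
    show ?thesis unfolding cell_def
      by (rule trans_comps_stage[OF cat to_K[OF S t q]])
        (use F za aa z underS_Restr[OF S za] small_under_univ[OF U, of \<alpha>] under_Field[of "Restr ?r (under ?r \<alpha>)" \<alpha>]
          in \<open>auto intro: small_mono\<close>)
  qed
  obtain X X' e where t: "trans_seq C UNIV ?r X X'" and Qe: "\<And>\<beta>. Q \<beta> X X' e"
  proof (rule decorated_trans_seq_exists[OF cat co U r small_underS_univ[OF U] Dom_Obj[OF f], of Q])
    fix \<beta> X Y X' Y' and e e' :: "'u \<Rightarrow> 'm"
    assume eq: "\<And>\<alpha>. (\<alpha>, \<beta>) \<in> ?r \<Longrightarrow> X \<alpha> = Y \<alpha> \<and> e \<alpha> = e' \<alpha>"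
      "\<And>\<alpha> \<gamma>. \<lbrakk>(\<alpha>, \<gamma>) \<in> ?r; (\<gamma>, \<beta>) \<in> ?r\<rbrakk> \<Longrightarrow> X' (\<alpha>, \<gamma>) = Y' (\<alpha>, \<gamma>)" and q: "Q \<beta> X X' e"
    have eq\<beta>: "X \<beta> = Y \<beta>" "e \<beta> = e' \<beta>" using eq(1)[OF rr] by simp_all
    have "solved \<alpha> \<beta> Y Y' e'" if s: "is_succ ?r \<alpha> \<beta>" "solved \<alpha> \<beta> X X' e" for \<alpha>
    proof -
      note sD = is_succD[OF r s(1)]
      have "(\<gamma>, \<beta>) \<in> ?r" if "(\<gamma>, \<alpha>) \<in> ?r" for \<gamma> using that sD(2) Well_orderD(2)[OF r] by (meson transD)
      then have "X \<gamma> = Y \<gamma>" "e \<gamma> = e' \<gamma>" "X' (\<gamma>, \<alpha>) = Y' (\<gamma>, \<alpha>)" if "(\<gamma>, \<alpha>) \<in> ?r" for \<gamma>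
        using that eq sD(2) by auto
      moreover have "X' (\<alpha>, \<beta>) = Y' (\<alpha>, \<beta>)" using eq(2)[OF sD(2) rr] .
      ultimately show ?thesis using s(2) eq\<beta> unfolding solved_def by metis
    qed
    moreover have "X' (\<alpha>, \<beta>) = Y' (\<alpha>, \<beta>)" "e \<alpha> = e' \<alpha>" if "\<alpha> \<in> underS ?r \<beta>" for \<alpha>
      using that eq rr by (auto simp: underS_def)
    moreover have "X' (\<alpha>, \<beta>) = Y' (\<alpha>, \<beta>)" if "is_succ ?r \<alpha> \<beta>" for \<alpha>
      using is_succD(2)[OF r that] eq(2) rr by blast
    ultimately show "Q \<beta> Y Y' e'" using q eq\<beta> unfolding Q_def by (metis (no_types, lifting))
  next
    fix \<beta> X X' and e :: "'u \<Rightarrow> 'm" assume z: "underS ?r \<beta> = {}"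
    then have "\<not> is_succ ?r \<alpha> \<beta>" for \<alpha> by (auto simp: is_succ_def)
    then show "\<exists>d0. Q \<beta> (X(\<beta> := Dom C f)) (extend_map \<beta> (\<lambda>_. Id C (Dom C f)) X') (e(\<beta> := d0))"
      using z f by (intro exI[of _ f]) (auto simp: Q_def Arr_hom)
  next
    fix \<alpha> \<beta> X X' and e :: "'u \<Rightarrow> 'm"
    assume s: "is_succ ?r \<alpha> \<beta>" and t: "trans_seq C UNIV (Restr ?r (under ?r \<alpha>)) X X'"
      and q: "\<forall>\<gamma>\<in>under ?r \<alpha>. Q \<gamma> X X' e"
    note sD = is_succD[OF r s]
    have at: "trans_seq_at C UNIV ?r X X' \<gamma>" if "(\<gamma>, \<alpha>) \<in> ?r" for \<gamma>
      using t that unfolding trans_seq_Restr_iff[OF cat r ofilter_under[OF r]] by (simp add: under_def)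
    have q: "Q \<gamma> X X' e" if "(\<gamma>, \<alpha>) \<in> ?r" for \<gamma> using q that by (simp add: under_def)
    have XO: "X \<gamma> \<in> Obj C" if "(\<gamma>, \<alpha>) \<in> ?r" for \<gamma> using at[OF that] by (simp add: trans_seq_at_def)
    have eh: "e \<gamma> \<in> hom C (X \<gamma>) (Cod C f)" if "(\<gamma>, \<alpha>) \<in> ?r" for \<gamma> using q[OF that] by (simp add: Q_def)
    have X': "X' (\<gamma>, \<alpha>) \<in> hom C (X \<gamma>) (X \<alpha>)" if "(\<gamma>, \<alpha>) \<in> ?r" for \<gamma>
      using at[OF rr] that by (simp add: trans_seq_at_def)
    have Xid: "X' (\<alpha>, \<alpha>) = Id C (X \<alpha>)" using at[OF rr] by (simp add: trans_seq_at_def)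
    have ee: "e \<alpha> \<cdot> X' (\<gamma>, \<alpha>) = e \<gamma>" if "(\<gamma>, \<alpha>) \<in> ?r" for \<gamma>
      using q[OF rr] that Xid Comp_Id[OF eh[OF rr]] by (cases "\<gamma> = \<alpha>") (auto simp: Q_def underS_def)
    \<comment> \<open>The composite up to this stage is a relative cell complex, so \<open>e \<alpha>\<close> cannot have the lifting property.\<close>
    obtain z where z: "underS ?r z = {}" using least_exists[OF r] by auto
    have za: "(z, \<alpha>) \<in> ?r" using least_le[OF r _ z, of \<alpha>] by simp
    have "e z = f" using q[OF za] z by (simp add: Q_def)
    then have "e \<alpha> \<notin> inj_maps C K"
      using no[OF in_cell[OF t _ z], of e "e \<alpha>"] q ee[OF za] X'[OF za] eh[OF rr]
      by (auto simp: hom_def under_def)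
    then obtain k where k: "k \<in> K" "\<not> lifts C k (e \<alpha>)"
      using eh[OF rr] by (auto simp: inj_maps_def RLP_def hom_def)
    have ed: "Dom C (e \<alpha>) = X \<alpha>" "Cod C (e \<alpha>) = Cod C f" using eh[OF rr] by (auto simp: hom_def)
    obtain u v where default: "(k, u, v) \<in> prob (X \<alpha>) (e \<alpha>)"
      using k unfolding lifts_def ed prob_def by blast
    \<comment> \<open>The problem to be solved is the designated one, or else an arbitrary one of the stage \<open>\<alpha>\<close>; some cell
      has to be attached, as identities need not be pushouts of maps in \<open>K\<close>.\<close>
    obtain l w y where lwy: "(l, w, y) \<in> prob (X \<alpha>) (e \<alpha>)"
      and sel: "\<And>\<gamma> k u v. \<lbrakk>(\<gamma>, \<alpha>) \<in> ?r; (k, u, v) \<in> prob (X \<gamma>) (e \<gamma>);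
        b \<alpha> = (\<gamma>, enc (X \<gamma>) (e \<gamma>) (k, u, v))\<rbrakk> \<Longrightarrow> k = l \<and> X' (\<gamma>, \<alpha>) \<cdot> u = w \<and> v = y"
    proof (cases "\<exists>\<gamma> k u v. (\<gamma>, \<alpha>) \<in> ?r \<and> (k, u, v) \<in> prob (X \<gamma>) (e \<gamma>) \<and>
        b \<alpha> = (\<gamma>, enc (X \<gamma>) (e \<gamma>) (k, u, v))")
      case True
      then obtain \<gamma> k u v where g: "(\<gamma>, \<alpha>) \<in> ?r" "(k, u, v) \<in> prob (X \<gamma>) (e \<gamma>)"
        "b \<alpha> = (\<gamma>, enc (X \<gamma>) (e \<gamma>) (k, u, v))" by blast
      have u: "u \<in> hom C (Dom C k) (X \<gamma>)" "e \<gamma> \<cdot> u = v \<cdot> k" using g(2) by (auto simp: prob_def)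
      have "(k, X' (\<gamma>, \<alpha>) \<cdot> u, v) \<in> prob (X \<alpha>) (e \<alpha>)"
        using g(2) Comp_hom[OF u(1) X'[OF g(1)]] Comp_assoc[OF u(1) X'[OF g(1)] eh[OF rr]] ee[OF g(1)]
        by (auto simp: prob_def)
      moreover have "(k', u', v') = (k, u, v)" if "(k', u', v') \<in> prob (X \<gamma>) (e \<gamma>)"
        "enc (X \<gamma>) (e \<gamma>) (k', u', v') = enc (X \<gamma>) (e \<gamma>) (k, u, v)" for k' u' v'
        using inj_onD[OF enc[OF XO[OF g(1)]] that(2)] that(1) g(2) by blast
      ultimately show ?thesis using g(3) by (intro that[of k "X' (\<gamma>, \<alpha>) \<cdot> u" v]) auto
    next
      case False
      then show ?thesis using default by (intro that[of k u v]) blast+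
    qed
    have lwy': "l \<in> K" "l \<in> Arr C" "w \<in> hom C (Dom C l) (X \<alpha>)" "y \<in> hom C (Cod C l) (Cod C f)"
      "e \<alpha> \<cdot> w = y \<cdot> l" using lwy K by (auto simp: prob_def)
    obtain p g where po: "is_pushout C l w p g"
      using pushout_exists[OF U cat co, of l w] lwy' by (auto simp: hom_def)
    note pD = is_pushoutD[OF po]
    have wc: "Cod C w = X \<alpha>" using lwy'(3) by (simp add: hom_def)
    obtain h where h: "h \<in> hom C (Cod C p) (Cod C f)" "h \<cdot> p = y" "h \<cdot> g = e \<alpha>"
      by (rule is_pushout_induced[OF po, of y "Cod C f" "e \<alpha>"]) (use lwy' eh[OF rr] wc in auto)
    have gh: "g \<in> hom C (X \<alpha>) (Cod C p)" using pD wc by simp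
    define m where "m = (\<lambda>\<gamma>. g \<cdot> X' (\<gamma>, \<alpha>))(\<beta> := Id C (Cod C p))"
    have ne: "\<gamma> \<noteq> \<beta>" if "(\<gamma>, \<alpha>) \<in> ?r" for \<gamma>
      using underS_trans(2)[OF r that sD(1)] by (simp add: underS_def)
    have m: "m \<gamma> = g \<cdot> X' (\<gamma>, \<alpha>)" if "(\<gamma>, \<alpha>) \<in> ?r" for \<gamma> using ne[OF that] by (simp add: m_def)
    have m\<alpha>: "m \<alpha> = g" using m[OF rr] Xid Comp_Id[OF gh] by simp
    let ?X = "X(\<beta> := Cod C p)" and ?X' = "extend_map \<beta> m X'" and ?e = "e(\<beta> := h)"
    have "?e \<beta> \<cdot> ?X' (\<gamma>, \<beta>) = ?e \<gamma>" if "\<gamma> \<in> underS ?r \<beta>" for \<gamma>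
    proof -
      have ga: "(\<gamma>, \<alpha>) \<in> ?r" using that sD(5) by (simp add: under_def)
      show ?thesis using m[OF ga] ne[OF ga] Comp_assoc[OF X'[OF ga] gh h(1)] h(3) ee[OF ga] by simp
    qed
    moreover have "solved \<alpha> \<beta> ?X ?X' ?e"
      unfolding solved_def
    proof (intro allI impI, elim conjE)
      fix \<gamma> k u v assume ga: "(\<gamma>, \<alpha>) \<in> ?r" and "(k, u, v) \<in> prob (?X \<gamma>) (?e \<gamma>)"
        "b \<alpha> = (\<gamma>, enc (?X \<gamma>) (?e \<gamma>) (k, u, v))"
      then have "k = l" "X' (\<gamma>, \<alpha>) \<cdot> u = w" "v = y" using sel[OF ga, of k u v] ne[OF ga] by simp_all
      then show "\<exists>p\<in>hom C (Cod C k) (?X \<beta>). p \<cdot> k = ?X' (\<alpha>, \<beta>) \<cdot> (?X' (\<gamma>, \<alpha>) \<cdot> u) \<and> ?e \<beta> \<cdot> p = v"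
        using pD h m\<alpha> ne[OF rr] by (intro bexI[of _ p]) simp_all
    qed
    moreover have "?X' (\<alpha>, \<beta>) \<in> pushouts C K" using m\<alpha> po lwy'(1) by (auto simp: pushouts_def)
    ultimately have "Q \<beta> ?X ?X' ?e"
      using h(1) sD(1) is_succ_unique[OF r s] by (auto simp: Q_def)
    then show "\<exists>Y g d1. g \<in> hom C (X \<alpha>) Y \<and> Q \<beta> (X(\<beta> := Y))
        (extend_map \<beta> ((\<lambda>\<gamma>. g \<cdot> X' (\<gamma>, \<alpha>))(\<beta> := Id C Y)) X') (e(\<beta> := d1))"
      using gh unfolding m_def by blast
  next
    fix \<beta> X X' L \<iota> and e :: "'u \<Rightarrow> 'm"
    assume l: "limit_point ?r \<beta>" and t: "trans_seq C UNIV (Restr ?r (underS ?r \<beta>)) X X'"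
      and q: "\<forall>\<gamma>\<in>underS ?r \<beta>. Q \<gamma> X X' e"
      and L: "is_colimit (ord_cat (Restr ?r (underS ?r \<beta>))) C X X' L \<iota>"
    note F = Field_Restr_initial[OF r ofilter_underS[OF r], of \<beta>]
    have ee: "e \<alpha> \<cdot> X' (\<gamma>, \<alpha>) = e \<gamma>" if "(\<gamma>, \<alpha>) \<in> ?r" "\<alpha> \<in> underS ?r \<beta>" for \<alpha> \<gamma>
    proof (cases "\<gamma> = \<alpha>")
      case True
      have "X' (\<alpha>, \<alpha>) = Id C (X \<alpha>)"
        using t that(2) unfolding trans_seq_Restr_iff[OF cat r ofilter_underS[OF r]]
        by (simp add: trans_seq_at_def)
      then show ?thesis using True q that(2) Comp_Id[of "e \<alpha>" "X \<alpha>" "Cod C f"] by (simp add: Q_def)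
    next
      case False
      then show ?thesis using q that by (auto simp: Q_def underS_def)
    qed
    obtain h where h: "h \<in> hom C L (Cod C f)" "\<And>\<alpha>. \<alpha> \<in> underS ?r \<beta> \<Longrightarrow> h \<cdot> \<iota> \<alpha> = e \<alpha>"
      by (rule ord_colimit_universal[OF L, of "Cod C f" e]) (use F q ee Cod_Obj[OF f] in \<open>auto simp: Q_def\<close>)
    have "\<not> is_succ ?r \<alpha> \<beta>" "underS ?r \<beta> \<noteq> {}" for \<alpha> using l by (auto simp: limit_point_def)
    then have "Q \<beta> (X(\<beta> := L)) (extend_map \<beta> (\<iota>(\<beta> := Id C L)) X') (e(\<beta> := h))"
      using h by (auto simp: Q_def underS_def)
    then show "\<exists>d1. Q \<beta> (X(\<beta> := L)) (extend_map \<beta> (\<iota>(\<beta> := Id C L)) X') (e(\<beta> := d1))" by blast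
  qed (simp, blast)
  have at: "trans_seq_at C UNIV ?r X X' \<beta>" for \<beta> using t trans_seq_iff[OF cat r] by auto
  have XO: "X \<beta> \<in> Obj C" for \<beta> using at[of \<beta>] by (simp add: trans_seq_at_def)
  have Xh: "X' (\<alpha>, \<beta>) \<in> hom C (X \<alpha>) (X \<beta>)" if "(\<alpha>, \<beta>) \<in> ?r" for \<alpha> \<beta>
    using at[of \<beta>] that by (simp add: trans_seq_at_def)
  have Xc: "X' (\<alpha>, \<beta>) = X' (\<gamma>, \<beta>) \<cdot> X' (\<alpha>, \<gamma>)" if "(\<alpha>, \<gamma>) \<in> ?r" "(\<gamma>, \<beta>) \<in> ?r" for \<alpha> \<beta> \<gamma>
    using at[of \<beta>] that by (simp add: trans_seq_at_def)
  have eh: "e \<beta> \<in> hom C (X \<beta>) (Cod C f)" for \<beta> using Qe[of \<beta>] by (simp add: Q_def)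
  have ee: "e \<beta> \<cdot> X' (\<alpha>, \<beta>) = e \<alpha>" if "\<alpha> \<in> underS ?r \<beta>" for \<alpha> \<beta> using Qe[of \<beta>] that by (simp add: Q_def)
  \<comment> \<open>A stage at which a given problem of the stage \<open>\<alpha>\<close> is designated.\<close>
  define turn where "turn \<alpha> k = (SOME \<beta>. (\<alpha>, \<beta>) \<in> ?r \<and> b \<beta> = (\<alpha>, enc (X \<alpha>) (e \<alpha>) k))" for \<alpha> k
  have turn: "(\<alpha>, turn \<alpha> k) \<in> ?r" "b (turn \<alpha> k) = (\<alpha>, enc (X \<alpha>) (e \<alpha>) k)" for \<alpha> k
    using someI_ex[OF b[of \<alpha> "(\<alpha>, enc (X \<alpha>) (e \<alpha>) k)"]] by (auto simp: turn_def)
  obtain \<kappa> where \<kappa>: "small U \<kappa>" "\<And>k. k \<in> K \<Longrightarrow> factors_through_stage U \<kappa> C (pushouts C K) (Dom C k)"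
    by (rule weakly_small_uniform[where D = "Dom C", OF U K(2) ws]) (assumption, blast)
  obtain l where l: "limit_point ?r l" "filtered_ord \<kappa> (Restr ?r (underS ?r l))"
    "\<And>\<alpha>. \<alpha> \<in> underS ?r l \<Longrightarrow> turn \<alpha> ` prob (X \<alpha>) (e \<alpha>) \<subseteq> underS ?r l"
    using closed_limit_ordinal[OF U small_image[OF prob_small[OF XO]] \<kappa>(1), of turn "\<lambda>\<alpha>. \<alpha>" e] by blast
  note So = ofilter_underS[OF r, of l]
  note F = Field_Restr_initial[OF r So]
  have col: "is_colimit (ord_cat (Restr ?r (underS ?r l))) C X X' (X l) (\<lambda>\<alpha>. X' (\<alpha>, l))"
    using at[of l] l(1) by (simp add: trans_seq_at_def)
  have tl: "trans_seq C (pushouts C K) (Restr ?r (underS ?r l)) X X'"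
    using to_K[OF So trans_seq_initial[OF cat t So]] Qe by blast
  \<comment> \<open>The colimit of the stages before \<open>l\<close> is the stage \<open>l\<close> itself.\<close>
  have lift: "lifts C k (e l)" if k: "k \<in> K" for k
  proof (rule liftsI)
    fix u v assume u: "u \<in> hom C (Dom C k) (Dom C (e l))" and v: "v \<in> hom C (Cod C k) (Cod C (e l))"
      and sq: "e l \<cdot> u = v \<cdot> k"
    have ed: "Dom C (e l) = X l" "Cod C (e l) = Cod C f" using eh[of l] by (auto simp: hom_def)
    obtain \<alpha> u' where \<alpha>: "\<alpha> \<in> underS ?r l" "u' \<in> hom C (Dom C k) (X \<alpha>)" "X' (\<alpha>, l) \<cdot> u' = u"
      using factors_through_stageE[OF \<kappa>(2)[OF k] _ l(2) tl col, of u] u small_underS_univ[OF U, of l]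
      unfolding F ed by auto
    have al: "(\<alpha>, l) \<in> ?r" using \<alpha>(1) by (simp add: underS_def)
    have pr: "(k, u', v) \<in> prob (X \<alpha>) (e \<alpha>)"
      using k \<alpha> v ed sq Comp_assoc[OF \<alpha>(2) Xh[OF al] eh] ee[OF \<alpha>(1)] by (simp add: prob_def)
    define \<beta> where "\<beta> = turn \<alpha> (k, u', v)"
    have \<beta>: "(\<alpha>, \<beta>) \<in> ?r" "b \<beta> = (\<alpha>, enc (X \<alpha>) (e \<alpha>) (k, u', v))" "\<beta> \<in> underS ?r l"
      using turn l(3)[OF \<alpha>(1)] pr by (auto simp: \<beta>_def)
    obtain \<gamma> where \<gamma>: "is_succ ?r \<beta> \<gamma>" "(\<gamma>, l) \<in> ?r" using is_succ_exists[OF r \<beta>(3)] by blast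
    then have gl: "\<gamma> \<in> underS ?r l" using l(1) by (auto simp: limit_point_def underS_def)
    note sD = is_succD[OF r \<gamma>(1)]
    obtain p where p: "p \<in> hom C (Cod C k) (X \<gamma>)" "p \<cdot> k = X' (\<beta>, \<gamma>) \<cdot> (X' (\<alpha>, \<beta>) \<cdot> u')" "e \<gamma> \<cdot> p = v"
      using Qe[of \<gamma>] \<gamma>(1) \<beta>(1,2) pr unfolding Q_def solved_def by blast
    have kh: "k \<in> hom C (Dom C k) (Cod C k)" using k K by (auto simp: hom_def)
    have ag: "(\<alpha>, \<gamma>) \<in> ?r" using \<beta>(1) sD(2) Well_orderD(2)[OF r] by (meson transD)
    have "p \<cdot> k = X' (\<alpha>, \<gamma>) \<cdot> u'"
      using p(2) Comp_assoc[OF \<alpha>(2) Xh[OF \<beta>(1)] Xh[OF sD(2)]] Xc[OF \<beta>(1) sD(2)] by simp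
    then have "X' (\<gamma>, l) \<cdot> p \<cdot> k = u"
      using Comp_assoc[OF kh p(1) Xh[OF \<gamma>(2)]] Comp_assoc[OF \<alpha>(2) Xh[OF ag] Xh[OF \<gamma>(2)]]
        Xc[OF ag \<gamma>(2)] \<alpha>(3) by simp
    moreover have "e l \<cdot> (X' (\<gamma>, l) \<cdot> p) = v"
      using Comp_assoc[OF p(1) Xh[OF \<gamma>(2)] eh] ee[OF gl] p(3) by simp
    ultimately show "\<exists>j\<in>hom C (Cod C k) (Dom C (e l)). j \<cdot> k = u \<and> e l \<cdot> j = v"
      using Comp_hom[OF p(1) Xh[OF \<gamma>(2)]] ed by auto
  qed
  obtain z where z: "underS ?r z = {}" using least_exists[OF r] by auto
  have zl: "z \<in> underS ?r l"
    using least_le[OF r _ z, of l] z l(1) by (auto simp: underS_def limit_point_def)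
  have "X' (z, l) \<in> cell U C K"
    using in_cell[OF trans_seq_initial[OF cat t ofilter_under[OF r]] _ z] Qe by blast
  moreover have "e l \<in> inj_maps C K" using lift eh[of l] by (simp add: inj_maps_def RLP_def hom_def)
  moreover have "Cod C (X' (z, l)) = Dom C (e l)"
    using eh[of l] Xh[of z l] zl by (simp add: hom_def underS_def)
  moreover have "f = e l \<cdot> X' (z, l)" using ee[OF zl] Qe[of z] z by (simp add: Q_def)
  ultimately show False by (rule no)
qed

section \<open>Smallness relative to cofibrations\<close>

lemma colimit_retract:
  fixes C :: "('o, 'm) cat" (structure)
  assumes C: "category C" and X: "cat_functor (ord_cat r) C X X'" and W: "cat_functor (ord_cat r) C W W'"
    and LX: "is_colimit (ord_cat r) C X X' L \<iota>" and LW: "is_colimit (ord_cat r) C W W' M \<mu>"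
    and s: "\<And>\<alpha>. \<alpha> \<in> Field r \<Longrightarrow> s \<alpha> \<in> hom C (X \<alpha>) (W \<alpha>)"
      "\<And>\<alpha> \<beta>. (\<alpha>, \<beta>) \<in> r \<Longrightarrow> s \<beta> \<cdot> X' (\<alpha>, \<beta>) = W' (\<alpha>, \<beta>) \<cdot> s \<alpha>"
    and t: "\<And>\<alpha>. \<alpha> \<in> Field r \<Longrightarrow> t \<alpha> \<in> hom C (W \<alpha>) (X \<alpha>)"
      "\<And>\<alpha> \<beta>. (\<alpha>, \<beta>) \<in> r \<Longrightarrow> t \<beta> \<cdot> W' (\<alpha>, \<beta>) = X' (\<alpha>, \<beta>) \<cdot> t \<alpha>"
    and ts: "\<And>\<alpha>. \<alpha> \<in> Field r \<Longrightarrow> t \<alpha> \<cdot> s \<alpha> = Id C (X \<alpha>)"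
  obtains S T where "S \<in> hom C L M" "T \<in> hom C M L" "T \<cdot> S = Id C L"
    "\<And>\<alpha>. \<alpha> \<in> Field r \<Longrightarrow> S \<cdot> \<iota> \<alpha> = \<mu> \<alpha> \<cdot> s \<alpha>" "\<And>\<alpha>. \<alpha> \<in> Field r \<Longrightarrow> T \<cdot> \<mu> \<alpha> = \<iota> \<alpha> \<cdot> t \<alpha>"
proof -
  interpret category C by fact
  note XD = ord_functorD[OF X] and WD = ord_functorD[OF W]
  note LD = ord_colimitD[OF LX] and MD = ord_colimitD[OF LW]
  have Fr: "\<alpha> \<in> Field r" "\<beta> \<in> Field r" if "(\<alpha>, \<beta>) \<in> r" for \<alpha> \<beta> using that by (auto simp: Field_def)
  obtain S where S: "S \<in> hom C L M" "\<And>\<alpha>. \<alpha> \<in> Field r \<Longrightarrow> S \<cdot> \<iota> \<alpha> = \<mu> \<alpha> \<cdot> s \<alpha>"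
  proof (rule ord_colimit_universal[OF LX MD(1), of "\<lambda>\<alpha>. \<mu> \<alpha> \<cdot> s \<alpha>"])
    show "\<mu> \<alpha> \<cdot> s \<alpha> \<in> hom C (X \<alpha>) M" if "\<alpha> \<in> Field r" for \<alpha> using Comp_hom[OF s(1) MD(2)] that by blast
    fix \<alpha> \<beta> assume ab: "(\<alpha>, \<beta>) \<in> r"
    show "\<mu> \<beta> \<cdot> s \<beta> \<cdot> X' (\<alpha>, \<beta>) = \<mu> \<alpha> \<cdot> s \<alpha>"
      using Comp_assoc[OF XD(2)[OF ab] s(1) MD(2)] Comp_assoc[OF s(1) WD(2)[OF ab] MD(2)]
        Fr[OF ab] s(2)[OF ab] MD(3)[OF ab] by simp
  qed blast
  obtain T where T: "T \<in> hom C M L" "\<And>\<alpha>. \<alpha> \<in> Field r \<Longrightarrow> T \<cdot> \<mu> \<alpha> = \<iota> \<alpha> \<cdot> t \<alpha>"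
  proof (rule ord_colimit_universal[OF LW LD(1), of "\<lambda>\<alpha>. \<iota> \<alpha> \<cdot> t \<alpha>"])
    show "\<iota> \<alpha> \<cdot> t \<alpha> \<in> hom C (W \<alpha>) L" if "\<alpha> \<in> Field r" for \<alpha> using Comp_hom[OF t(1) LD(2)] that by blast
    fix \<alpha> \<beta> assume ab: "(\<alpha>, \<beta>) \<in> r"
    show "\<iota> \<beta> \<cdot> t \<beta> \<cdot> W' (\<alpha>, \<beta>) = \<iota> \<alpha> \<cdot> t \<alpha>"
      using Comp_assoc[OF WD(2)[OF ab] t(1) LD(2)] Comp_assoc[OF t(1) XD(2)[OF ab] LD(2)]
        Fr[OF ab] t(2)[OF ab] LD(3)[OF ab] by simp
  qed blast
  have "T \<cdot> S = Id C L"
  proof (rule ord_colimit_eqI[OF LX C XD(2) Comp_hom[OF S(1) T(1)] Id_hom[OF LD(1)]])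
    fix \<alpha> assume \<alpha>: "\<alpha> \<in> Field r"
    have "T \<cdot> S \<cdot> \<iota> \<alpha> = T \<cdot> (\<mu> \<alpha> \<cdot> s \<alpha>)" using Comp_assoc[OF LD(2)[OF \<alpha>] S(1) T(1)] S(2)[OF \<alpha>] by simp
    also have "\<dots> = \<iota> \<alpha> \<cdot> t \<alpha> \<cdot> s \<alpha>" using Comp_assoc[OF s(1) MD(2) T(1)] T(2) \<alpha> by simp
    also have "\<dots> = \<iota> \<alpha>" using Comp_assoc[OF s(1) t(1) LD(2)] ts Comp_Id[OF LD(2)] \<alpha> by simp
    finally show "T \<cdot> S \<cdot> \<iota> \<alpha> = Id C L \<cdot> \<iota> \<alpha>" using Id_Comp[OF LD(2)[OF \<alpha>]] by simp
  qed
  then show ?thesis using S T by (intro that)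
qed

text \<open>
  A sequence \<open>X\<close> whose steps are cofibrations is a retract of a sequence \<open>W\<close> whose steps are relative
  cell complexes: at a successor, the cofibration from \<open>W\<close> to the pushout of the next stage of \<open>X\<close> is
  factored as a relative cell complex followed by an injective map, of which it is then a retract.
  A map to the colimit of \<open>X\<close> factors through a stage of \<open>W\<close> and, by retraction, of \<open>X\<close>.
\<close>

lemma weakly_small_cof:
  fixes C :: "('o, 'm) cat" (structure)
  assumes C: "category C" and U: "universe (U :: 'u itself)" and co: "cocomplete U C"
    and fact: "\<And>f. f \<in> Arr C \<Longrightarrow> \<exists>q \<in> cell U C K. \<exists>p \<in> inj_maps C K. Cod C q = Dom C p \<and> f = p \<cdot> q"
    and ws: "weakly_small U C (cell U C K) A"
  shows "weakly_small U C (cof C K) A"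
proof -
  interpret category C by fact
  obtain \<kappa> where \<kappa>: "small U \<kappa>" "factors_through_stage U \<kappa> C (cell U C K) A"
    using ws unfolding weakly_small_def by blast
  have main: "\<exists>\<beta> \<in> Field r. \<exists>a' \<in> hom C A (X \<beta>). \<iota> \<beta> \<cdot> a' = a"
    if sm: "small U (Field r)" and fi: "filtered_ord \<kappa> r" and tX: "trans_seq C (cof C K) r X X'"
      and LX: "is_colimit (ord_cat r) C X X' L \<iota>" and a: "a \<in> hom C A L"
    for r :: "'u rel" and X X' L \<iota> a
  proof -
    have r: "Well_order r" using tX by (simp add: trans_seq_def)
    have rr: "(\<alpha>, \<alpha>) \<in> r" if "\<alpha> \<in> Field r" for \<alpha>
      using Well_orderD(1)[OF r] that by (simp add: refl_on_def)
    have fX: "cat_functor (ord_cat r) C X X'" using tX by (simp add: trans_seq_def)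
    note XD = ord_functorD[OF fX] and LD = ord_colimitD[OF LX]
    obtain z where z: "z \<in> Field r" "underS r z = {}"
      using least_exists[OF r] fi by (auto simp: filtered_ord_def)
    have zu: "\<beta> = z" if "\<beta> \<in> Field r" "underS r \<beta> = {}" for \<beta>
      using Well_order_cases[OF r that(1) z(1)] that z by auto
    define Q where "Q \<beta> W W' d \<longleftrightarrow>
        fst (d \<beta>) \<in> hom C (X \<beta>) (W \<beta>) \<and> snd (d \<beta>) \<in> hom C (W \<beta>) (X \<beta>) \<and>
        snd (d \<beta>) \<cdot> fst (d \<beta>) = Id C (X \<beta>) \<and>
        (\<forall>\<alpha>\<in>underS r \<beta>. fst (d \<beta>) \<cdot> X' (\<alpha>, \<beta>) = W' (\<alpha>, \<beta>) \<cdot> fst (d \<alpha>) \<and>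
           snd (d \<beta>) \<cdot> W' (\<alpha>, \<beta>) = X' (\<alpha>, \<beta>) \<cdot> snd (d \<alpha>)) \<and>
        (\<forall>\<alpha>. is_succ r \<alpha> \<beta> \<longrightarrow> W' (\<alpha>, \<beta>) \<in> cell U C K)"
      for \<beta> W W' and d :: "'u \<Rightarrow> 'm \<times> 'm"
    \<comment> \<open>The squares commute also for the identity of a stage.\<close>
    have nat: "fst (d \<gamma>) \<cdot> X' (\<alpha>, \<gamma>) = W' (\<alpha>, \<gamma>) \<cdot> fst (d \<alpha>) \<and> snd (d \<gamma>) \<cdot> W' (\<alpha>, \<gamma>) = X' (\<alpha>, \<gamma>) \<cdot> snd (d \<alpha>)"
      if "(\<alpha>, \<gamma>) \<in> r" "Q \<gamma> W W' d" "W' (\<gamma>, \<gamma>) = Id C (W \<gamma>)" for \<alpha> \<gamma> W W' and d :: "'u \<Rightarrow> 'm \<times> 'm"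
    proof (cases "\<alpha> = \<gamma>")
      case True
      have "\<gamma> \<in> Field r" using that by (auto simp: Field_def)
      then show ?thesis using True that XD(3)[of \<gamma>]
          Id_Comp[of "fst (d \<gamma>)" "X \<gamma>" "W \<gamma>"] Comp_Id[of "fst (d \<gamma>)" "X \<gamma>" "W \<gamma>"]
          Id_Comp[of "snd (d \<gamma>)" "W \<gamma>" "X \<gamma>"] Comp_Id[of "snd (d \<gamma>)" "W \<gamma>" "X \<gamma>"]
        by (simp add: Q_def)
    next
      case False
      then show ?thesis using that by (simp add: Q_def underS_def)
    qed
    have sm': "small U (underS r \<beta>)" for \<beta> by (rule small_mono[OF sm]) (auto intro: underS_Field)
    obtain W W' d where tW: "trans_seq C UNIV r W W'" and Qd: "\<And>\<beta>. \<beta> \<in> Field r \<Longrightarrow> Q \<beta> W W' d"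
    proof (rule decorated_trans_seq_exists[OF C co U r sm' XD(1)[OF z(1)], of Q])
      fix \<beta> W V W' V' and d e :: "'u \<Rightarrow> 'm \<times> 'm"
      assume \<beta>: "\<beta> \<in> Field r" and eq: "\<And>\<alpha>. (\<alpha>, \<beta>) \<in> r \<Longrightarrow> W \<alpha> = V \<alpha> \<and> d \<alpha> = e \<alpha>"
        "\<And>\<alpha> \<gamma>. \<lbrakk>(\<alpha>, \<gamma>) \<in> r; (\<gamma>, \<beta>) \<in> r\<rbrakk> \<Longrightarrow> W' (\<alpha>, \<gamma>) = V' (\<alpha>, \<gamma>)" and q: "Q \<beta> W W' d"
      have "W \<beta> = V \<beta>" "d \<beta> = e \<beta>" using eq(1)[OF rr[OF \<beta>]] by simp_all
      moreover have "W' (\<alpha>, \<beta>) = V' (\<alpha>, \<beta>)" "d \<alpha> = e \<alpha>" if "\<alpha> \<in> underS r \<beta>" for \<alpha>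
        using that eq rr[OF \<beta>] by (auto simp: underS_def)
      moreover have "\<alpha> \<in> underS r \<beta>" if "is_succ r \<alpha> \<beta>" for \<alpha> using is_succD(1)[OF r that] .
      ultimately show "Q \<beta> V V' e" using q unfolding Q_def by (metis (no_types, lifting))
    next
      fix \<beta> W W' and d :: "'u \<Rightarrow> 'm \<times> 'm" assume \<beta>: "\<beta> \<in> Field r" "underS r \<beta> = {}"
      then have "\<not> is_succ r \<alpha> \<beta>" for \<alpha> by (auto simp: is_succ_def)
      then show "\<exists>d0. Q \<beta> (W(\<beta> := X z)) (extend_map \<beta> (\<lambda>_. Id C (X z)) W') (d(\<beta> := d0))"
        using \<beta> zu[OF \<beta>] Id_hom[OF XD(1)[OF z(1)]] Comp_Id[OF Id_hom[OF XD(1)[OF z(1)]]]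
        by (intro exI[of _ "(Id C (X z), Id C (X z))"]) (simp add: Q_def)
    next
      fix \<alpha> \<beta> W W' and d :: "'u \<Rightarrow> 'm \<times> 'm"
      assume s: "is_succ r \<alpha> \<beta>" and t: "trans_seq C UNIV (Restr r (under r \<alpha>)) W W'"
        and q: "\<forall>\<gamma>\<in>under r \<alpha>. Q \<gamma> W W' d"
      note sD = is_succD[OF r s]
      have aa: "\<alpha> \<in> under r \<alpha>" using rr[OF sD(3)] by (simp add: under_def)
      have at: "trans_seq_at C UNIV r W W' \<alpha>"
        using t aa unfolding trans_seq_Restr_iff[OF C r ofilter_under[OF r]] by blast
      let ?s = "fst (d \<alpha>)" and ?t = "snd (d \<alpha>)" and ?x = "X' (\<alpha>, \<beta>)"
      have st: "?s \<in> hom C (X \<alpha>) (W \<alpha>)" "?t \<in> hom C (W \<alpha>) (X \<alpha>)" "?t \<cdot> ?s = Id C (X \<alpha>)"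
        using q aa by (auto simp: Q_def)
      have x: "?x \<in> hom C (X \<alpha>) (X \<beta>)" using XD(2)[OF sD(2)] .
      obtain p g where po: "is_pushout C ?x ?s p g"
        using pushout_exists[OF U C co, of ?x ?s] st(1) x by (auto simp: hom_def)
      note pD = is_pushoutD[OF po]
      have p: "p \<in> hom C (X \<beta>) (Cod C p)" and g: "g \<in> hom C (W \<alpha>) (Cod C p)"
        using pD(4,5) x st(1) by (simp_all add: hom_def)
      have "?x \<in> cof C K" using tX s by (simp add: trans_seq_def)
      then have gc: "g \<in> cof C K" using cof_pushout[OF po] by blast
      obtain l i where li: "l \<in> cell U C K" "i \<in> inj_maps C K" "Cod C l = Dom C i" "g = i \<cdot> l"
        using fact[OF homD(1)[OF g]] by blast
      have lA: "l \<in> Arr C" "i \<in> Arr C" using li trans_comps_Arr[OF C] inj_maps_Arr by (auto simp: cell_def)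
      have lh: "l \<in> hom C (W \<alpha>) (Cod C l)" and ih: "i \<in> hom C (Cod C l) (Cod C p)"
        using g li(3,4) lA by (auto simp: hom_def Arr_Comp)
      obtain \<sigma> where \<sigma>: "\<sigma> \<in> hom C (Cod C p) (Cod C l)" "\<sigma> \<cdot> g = l" "i \<cdot> \<sigma> = Id C (Cod C p)"
        using retract_argument[OF lA li(3,4) cof_lifts[OF gc li(2)]] homD(3)[OF g] by auto
      have "Id C (X \<beta>) \<cdot> ?x = ?x \<cdot> ?t \<cdot> ?s"
        using Id_Comp[OF x] Comp_Id[OF x] Comp_assoc[OF st(1,2) x] st(3) by simp
      then obtain T where T: "T \<in> hom C (Cod C p) (X \<beta>)" "T \<cdot> p = Id C (X \<beta>)" "T \<cdot> g = ?x \<cdot> ?t"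
        using is_pushout_induced[OF po, of "Id C (X \<beta>)" "X \<beta>" "?x \<cdot> ?t"] Id_hom[OF XD(1)[OF sD(4)]]
          Comp_hom[OF st(2) x] homD(3)[OF x] homD(3)[OF st(1)] by auto
      have s': "\<sigma> \<cdot> p \<in> hom C (X \<beta>) (Cod C l)" and t': "T \<cdot> i \<in> hom C (Cod C l) (X \<beta>)"
        using Comp_hom[OF p \<sigma>(1)] Comp_hom[OF ih T(1)] .
      have ts': "T \<cdot> i \<cdot> (\<sigma> \<cdot> p) = Id C (X \<beta>)"
      proof -
        have "T \<cdot> i \<cdot> (\<sigma> \<cdot> p) = T \<cdot> (i \<cdot> \<sigma> \<cdot> p)"
          using Comp_assoc[OF s' ih T(1)] Comp_assoc[OF p \<sigma>(1) ih] by simp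
        then show ?thesis using \<sigma>(3) T(2) Id_Comp[OF p] by simp
      qed
      have ns: "\<sigma> \<cdot> p \<cdot> ?x = l \<cdot> ?s"
        using Comp_assoc[OF x p \<sigma>(1)] Comp_assoc[OF st(1) g \<sigma>(1)] pD(7) \<sigma>(2) by simp
      have nt: "T \<cdot> i \<cdot> l = ?x \<cdot> ?t" using Comp_assoc[OF lh ih T(1)] li(4) T(3) by simp
      define m where "m = (\<lambda>\<gamma>. l \<cdot> W' (\<gamma>, \<alpha>))(\<beta> := Id C (Cod C l))"
      have ne: "\<gamma> \<noteq> \<beta>" if "(\<gamma>, \<alpha>) \<in> r" for \<gamma>
        using underS_trans(2)[OF r that sD(1)] by (simp add: underS_def)
      have Wh: "W' (\<gamma>, \<alpha>) \<in> hom C (W \<gamma>) (W \<alpha>)" if "(\<gamma>, \<alpha>) \<in> r" for \<gamma>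
        using at that by (simp add: trans_seq_at_def)
      have Wid: "W' (\<alpha>, \<alpha>) = Id C (W \<alpha>)" using at by (simp add: trans_seq_at_def)
      have m\<alpha>: "m \<alpha> = l" using ne[OF rr[OF sD(3)]] Wid Comp_Id[OF lh] by (simp add: m_def)
      have "\<sigma> \<cdot> p \<cdot> X' (\<gamma>, \<beta>) = m \<gamma> \<cdot> fst (d \<gamma>) \<and> T \<cdot> i \<cdot> m \<gamma> = X' (\<gamma>, \<beta>) \<cdot> snd (d \<gamma>) \<and> \<gamma> \<noteq> \<beta>"
        if "\<gamma> \<in> underS r \<beta>" for \<gamma>
      proof (intro conjI)
        have ga: "(\<gamma>, \<alpha>) \<in> r" using that sD(5) by (simp add: under_def)
        have qg: "Q \<gamma> W W' d" using q ga by (simp add: under_def)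
        have dg: "fst (d \<gamma>) \<in> hom C (X \<gamma>) (W \<gamma>)" "snd (d \<gamma>) \<in> hom C (W \<gamma>) (X \<gamma>)"
          using qg by (auto simp: Q_def)
        have n: "?s \<cdot> X' (\<gamma>, \<alpha>) = W' (\<gamma>, \<alpha>) \<cdot> fst (d \<gamma>)" "?t \<cdot> W' (\<gamma>, \<alpha>) = X' (\<gamma>, \<alpha>) \<cdot> snd (d \<gamma>)"
          using nat[of \<gamma> \<alpha> W W' d] ga Wid q aa by auto
        show "\<gamma> \<noteq> \<beta>" using ne[OF ga] .
        then have mg: "m \<gamma> = l \<cdot> W' (\<gamma>, \<alpha>)" by (simp add: m_def)
        have "\<sigma> \<cdot> p \<cdot> X' (\<gamma>, \<beta>) = \<sigma> \<cdot> p \<cdot> ?x \<cdot> X' (\<gamma>, \<alpha>)"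
          using XD(4)[OF ga sD(2)] Comp_assoc[OF XD(2)[OF ga] x s'] by simp
        also have "\<dots> = l \<cdot> (?s \<cdot> X' (\<gamma>, \<alpha>))"
          using ns Comp_assoc[OF XD(2)[OF ga] st(1) lh] by simp
        also have "\<dots> = m \<gamma> \<cdot> fst (d \<gamma>)" using n(1) mg Comp_assoc[OF dg(1) Wh[OF ga] lh] by simp
        finally show "\<sigma> \<cdot> p \<cdot> X' (\<gamma>, \<beta>) = m \<gamma> \<cdot> fst (d \<gamma>)" .
        have "T \<cdot> i \<cdot> m \<gamma> = ?x \<cdot> ?t \<cdot> W' (\<gamma>, \<alpha>)" using mg nt Comp_assoc[OF Wh[OF ga] lh t'] by simp
        also have "\<dots> = ?x \<cdot> X' (\<gamma>, \<alpha>) \<cdot> snd (d \<gamma>)"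
          using Comp_assoc[OF Wh[OF ga] st(2) x] n(2) Comp_assoc[OF dg(2) XD(2)[OF ga] x] by simp
        finally show "T \<cdot> i \<cdot> m \<gamma> = X' (\<gamma>, \<beta>) \<cdot> snd (d \<gamma>)" using XD(4)[OF ga sD(2)] by simp
      qed
      then have "Q \<beta> (W(\<beta> := Cod C l)) (extend_map \<beta> m W') (d(\<beta> := (\<sigma> \<cdot> p, T \<cdot> i)))"
        using s' t' ts' m\<alpha> li(1) is_succ_unique[OF r s] by (auto simp: Q_def)
      then show "\<exists>Y g d1. g \<in> hom C (W \<alpha>) Y \<and> Q \<beta> (W(\<beta> := Y))
          (extend_map \<beta> ((\<lambda>\<gamma>. g \<cdot> W' (\<gamma>, \<alpha>))(\<beta> := Id C Y)) W') (d(\<beta> := d1))"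
        using lh unfolding m_def by blast
    next
      fix \<beta> W W' M \<mu> and d :: "'u \<Rightarrow> 'm \<times> 'm"
      assume lim: "limit_point r \<beta>" and t: "trans_seq C UNIV (Restr r (underS r \<beta>)) W W'"
        and q: "\<forall>\<gamma>\<in>underS r \<beta>. Q \<gamma> W W' d"
        and M: "is_colimit (ord_cat (Restr r (underS r \<beta>))) C W W' M \<mu>"
      note So = ofilter_underS[OF r, of \<beta>]
      note F = Field_Restr_initial[OF r So]
      have at: "trans_seq_at C UNIV r W W' \<gamma>" if "\<gamma> \<in> underS r \<beta>" for \<gamma>
        using t that unfolding trans_seq_Restr_iff[OF C r So] by blast
      have n: "fst (d \<gamma>) \<cdot> X' (\<alpha>, \<gamma>) = W' (\<alpha>, \<gamma>) \<cdot> fst (d \<alpha>)" "snd (d \<gamma>) \<cdot> W' (\<alpha>, \<gamma>) = X' (\<alpha>, \<gamma>) \<cdot> snd (d \<alpha>)"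
        if "(\<alpha>, \<gamma>) \<in> Restr r (underS r \<beta>)" for \<alpha> \<gamma>
        using nat[of \<alpha> \<gamma> W W' d] that q at[of \<gamma>] by (auto simp: trans_seq_at_def)
      have fXr: "cat_functor (ord_cat (Restr r (underS r \<beta>))) C X X'"
        using trans_seq_initial[OF C tX So] by (simp add: trans_seq_def)
      have fWr: "cat_functor (ord_cat (Restr r (underS r \<beta>))) C W W'" using t by (simp add: trans_seq_def)
      have col: "is_colimit (ord_cat (Restr r (underS r \<beta>))) C X X' (X \<beta>) (\<lambda>\<alpha>. X' (\<alpha>, \<beta>))"
        using tX lim by (simp add: trans_seq_def)
      obtain S T where ST: "S \<in> hom C (X \<beta>) M" "T \<in> hom C M (X \<beta>)" "T \<cdot> S = Id C (X \<beta>)"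
        "\<And>\<alpha>. \<alpha> \<in> underS r \<beta> \<Longrightarrow> S \<cdot> X' (\<alpha>, \<beta>) = \<mu> \<alpha> \<cdot> fst (d \<alpha>)"
        "\<And>\<alpha>. \<alpha> \<in> underS r \<beta> \<Longrightarrow> T \<cdot> \<mu> \<alpha> = X' (\<alpha>, \<beta>) \<cdot> snd (d \<alpha>)"
        by (rule colimit_retract[OF C fXr fWr col M, of "\<lambda>\<alpha>. fst (d \<alpha>)" "\<lambda>\<alpha>. snd (d \<alpha>)", unfolded F])
          (use q n in \<open>auto simp: Q_def\<close>)
      have "\<not> is_succ r \<alpha> \<beta>" for \<alpha> using lim by (auto simp: limit_point_def)
      then have "Q \<beta> (W(\<beta> := M)) (extend_map \<beta> (\<mu>(\<beta> := Id C M)) W') (d(\<beta> := (S, T)))"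
        using ST by (auto simp: Q_def underS_def)
      then show "\<exists>d1. Q \<beta> (W(\<beta> := M)) (extend_map \<beta> (\<mu>(\<beta> := Id C M)) W') (d(\<beta> := d1))" by blast
    qed blast
    have tW': "trans_seq C (cell U C K) r W W'"
      using tW Qd is_succD(4)[OF r] by (auto simp: trans_seq_def Q_def)
    have fW: "cat_functor (ord_cat r) C W W'" using tW by (simp add: trans_seq_def)
    have "small U r"
      by (rule small_mono[OF small_Sigma[OF U sm sm]]) (auto simp: Field_def)
    then obtain M \<mu> where M: "is_colimit (ord_cat r) C W W' M \<mu>"
      using small_colimit_exists[OF co fW] sm by auto
    have n: "fst (d \<gamma>) \<cdot> X' (\<alpha>, \<gamma>) = W' (\<alpha>, \<gamma>) \<cdot> fst (d \<alpha>)" "snd (d \<gamma>) \<cdot> W' (\<alpha>, \<gamma>) = X' (\<alpha>, \<gamma>) \<cdot> snd (d \<alpha>)"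
      if "(\<alpha>, \<gamma>) \<in> r" for \<alpha> \<gamma>
    proof -
      have "\<gamma> \<in> Field r" using that by (auto simp: Field_def)
      then show "fst (d \<gamma>) \<cdot> X' (\<alpha>, \<gamma>) = W' (\<alpha>, \<gamma>) \<cdot> fst (d \<alpha>)"
        "snd (d \<gamma>) \<cdot> W' (\<alpha>, \<gamma>) = X' (\<alpha>, \<gamma>) \<cdot> snd (d \<alpha>)"
        using nat[OF that Qd, of] ord_functorD(3)[OF fW] by blast+
    qed
    obtain S T where ST: "S \<in> hom C L M" "T \<in> hom C M L" "T \<cdot> S = Id C L"
      "\<And>\<alpha>. \<alpha> \<in> Field r \<Longrightarrow> T \<cdot> \<mu> \<alpha> = \<iota> \<alpha> \<cdot> snd (d \<alpha>)"
      by (rule colimit_retract[OF C fX fW LX M, of "\<lambda>\<alpha>. fst (d \<alpha>)" "\<lambda>\<alpha>. snd (d \<alpha>)"])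
        (use Qd n in \<open>auto simp: Q_def\<close>)
    obtain \<beta> a' where \<beta>: "\<beta> \<in> Field r" "a' \<in> hom C A (W \<beta>)" "\<mu> \<beta> \<cdot> a' = S \<cdot> a"
      by (rule factors_through_stageE[OF \<kappa>(2) sm fi tW' M Comp_hom[OF a ST(1)]])
    have th: "snd (d \<beta>) \<in> hom C (W \<beta>) (X \<beta>)" using Qd[OF \<beta>(1)] by (simp add: Q_def)
    have "\<iota> \<beta> \<cdot> (snd (d \<beta>) \<cdot> a') = T \<cdot> \<mu> \<beta> \<cdot> a'"
      using Comp_assoc[OF \<beta>(2) th LD(2)[OF \<beta>(1)]] ST(4)[OF \<beta>(1)] by simp
    also have "\<dots> = T \<cdot> (S \<cdot> a)"
      using Comp_assoc[OF \<beta>(2) ord_colimitD(2)[OF M \<beta>(1)] ST(2)] \<beta>(3) by simp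
    also have "\<dots> = a" using Comp_assoc[OF a ST(1,2)] ST(3) Id_Comp[OF a] by simp
    finally show ?thesis using Comp_hom[OF \<beta>(2) th] \<beta>(1) by blast
  qed
  show ?thesis
    unfolding weakly_small_def
    by (intro exI[of _ \<kappa>] conjI \<kappa>(1) factors_through_stageI) (rule main)
qed

section \<open>Homotopies for relative cylinders\<close>

locale relative_cylinders = category C
  for C :: "('o, 'm) cat" (structure) +
  fixes U :: "'u itself" and I :: "'m set" and Cyl :: "'m \<Rightarrow> 'o" and \<iota>0 \<iota>1 :: "'m \<Rightarrow> 'm"
  assumes univ: "universe U" and compl: "complete U C" and I_Arr: "I \<subseteq> Arr C"
    and refl_cyl: "\<And>i. i \<in> I \<Longrightarrow> reflexive_cylinder C i (Cyl i) (\<iota>0 i) (\<iota>1 i)"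
    and copair_cof: "\<And>i. i \<in> I \<Longrightarrow> copair_in C (cof C I) i (Cyl i) (\<iota>0 i) (\<iota>1 i)"
begin

abbreviation "J \<equiv> J_maps I \<iota>0"
abbreviation "W \<equiv> W_maps C I Cyl \<iota>0 \<iota>1"

lemma I_hom: "i \<in> I \<Longrightarrow> i \<in> hom C (Dom C i) (Cod C i)"
  using I_Arr by (auto simp: hom_def)

lemma cylinderD:
  assumes "i \<in> I"
  shows "\<iota>0 i \<in> hom C (Cod C i) (Cyl i)" "\<iota>1 i \<in> hom C (Cod C i) (Cyl i)" "\<iota>0 i \<cdot> i = \<iota>1 i \<cdot> i"
  using refl_cyl[OF assms] by (auto simp: reflexive_cylinder_def rel_cylinder_def)

lemma cylinder_retraction:
  assumes "i \<in> I"
  obtains s where "s \<in> hom C (Cyl i) (Cod C i)" "s \<cdot> \<iota>0 i = Id C (Cod C i)" "s \<cdot> \<iota>1 i = Id C (Cod C i)"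
  using refl_cyl[OF assms] by (auto simp: reflexive_cylinder_def)

lemma copair:
  assumes "i \<in> I"
  obtains j0 j1 c where "is_pushout C i i j0 j1" "c \<in> hom C (Cod C j0) (Cyl i)"
    "c \<cdot> j0 = \<iota>0 i" "c \<cdot> j1 = \<iota>1 i" "c \<in> cof C I"
  using copair_cof[OF assms] unfolding copair_in_def by (elim exE bexE conjE)

lemma cylinder_cof:
  assumes i: "i \<in> I" shows "\<iota>0 i \<in> cof C I" "\<iota>1 i \<in> cof C I"
proof -
  obtain j0 j1 c where c: "is_pushout C i i j0 j1" "c \<in> hom C (Cod C j0) (Cyl i)"
    "c \<cdot> j0 = \<iota>0 i" "c \<cdot> j1 = \<iota>1 i" "c \<in> cof C I" using copair[OF i] by blast
  have ic: "i \<in> cof C I" using i sub_cof[OF I_Arr] by blast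
  have "j0 \<in> cof C I" "j1 \<in> cof C I"
    using cof_pushout[OF is_pushout_sym[OF c(1)] ic] cof_pushout[OF c(1) ic] .
  then show "\<iota>0 i \<in> cof C I" "\<iota>1 i \<in> cof C I"
    using cof_Comp[of j0 I c] cof_Comp[of j1 I c] c is_pushoutD(6)[OF c(1)] homD(2)[OF c(2)] by auto
qed

lemma J_cof: "J \<subseteq> cof C I"
  using cylinder_cof by (auto simp: J_maps_def)

lemma J_Arr: "J \<subseteq> Arr C"
  by (rule subset_trans[OF J_cof subsetI]) (rule cof_Arr)

lemma inj_I_J: "inj_maps C I \<subseteq> inj_maps C J"
  by (rule inj_maps_mono[OF J_cof])

text \<open>The retraction of the cylinder makes every object fibrant.\<close>

lemma to_terminal_inj_J:
  assumes T: "T \<in> Obj C" "\<And>X. X \<in> Obj C \<Longrightarrow> \<exists>!t. t \<in> hom C X T" and t: "t \<in> hom C Y T"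
  shows "t \<in> inj_maps C J"
proof -
  have "lifts C (\<iota>0 i) t" if i: "i \<in> I" for i
  proof (rule liftsI)
    note cD = cylinderD[OF i]
    obtain s where s: "s \<in> hom C (Cyl i) (Cod C i)" "s \<cdot> \<iota>0 i = Id C (Cod C i)"
      using cylinder_retraction[OF i] by blast
    fix u v assume u: "u \<in> hom C (Dom C (\<iota>0 i)) (Dom C t)" and v: "v \<in> hom C (Cod C (\<iota>0 i)) (Cod C t)"
    have u: "u \<in> hom C (Cod C i) Y" and v: "v \<in> hom C (Cyl i) T" using u v cD(1) t by (auto simp: hom_def)
    have us: "u \<cdot> s \<in> hom C (Cyl i) Y" using Comp_hom[OF s(1) u] .
    have "t \<cdot> (u \<cdot> s) = v" using Comp_hom[OF us t] v T(2)[OF hom_Obj(1)[OF v]] by blast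
    moreover have "u \<cdot> s \<cdot> \<iota>0 i = u" using Comp_assoc[OF cD(1) s(1) u] s(2) Comp_Id[OF u] by simp
    ultimately show "\<exists>k\<in>hom C (Cod C (\<iota>0 i)) (Dom C t). k \<cdot> \<iota>0 i = u \<and> t \<cdot> k = v"
      unfolding homD(3)[OF cD(1)] homD(2)[OF t] using us by (intro bexI[of _ "u \<cdot> s"] conjI)
  qed
  then show ?thesis using t by (auto simp: inj_maps_def RLP_def J_maps_def hom_def)
qed

lemma extension_along_cof_J:
  assumes q: "q \<in> cof C J" and a: "a \<in> hom C (Dom C q) Y"
  obtains b where "b \<in> hom C (Cod C q) Y" "b \<cdot> q = a"
proof -
  obtain T where T: "T \<in> Obj C" "\<And>X. X \<in> Obj C \<Longrightarrow> \<exists>!t. t \<in> hom C X T"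
    using terminal_exists[OF univ category_axioms compl] by blast
  note qh = Arr_hom[OF cof_Arr[OF q]]
  obtain t v where t: "t \<in> hom C Y T" and v: "v \<in> hom C (Cod C q) T"
    using T(2)[OF hom_Obj(2)[OF a]] T(2)[OF hom_Obj(2)[OF qh]] by blast
  have "t \<cdot> a = v \<cdot> q" using Comp_hom[OF a t] Comp_hom[OF qh v] T(2)[OF hom_Obj(1)[OF a]] by blast
  then show ?thesis
    using liftsD[OF cof_lifts[OF q to_terminal_inj_J[OF T t]], of a v] a v homD(2,3)[OF t] that by auto
qed

lemma cof_J_retraction:
  assumes q: "q \<in> cof C J"
  obtains \<rho> where "\<rho> \<in> hom C (Cod C q) (Dom C q)" "\<rho> \<cdot> q = Id C (Dom C q)"
  using extension_along_cof_J[OF q Id_hom[OF Dom_Obj[OF cof_Arr[OF q]]]] by blast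

lemma W_Arr: "W \<subseteq> Arr C"
  by (auto simp: W_maps_def)

lemma W_I:
  assumes "f \<in> Arr C"
    and "\<And>i u v. \<lbrakk>i \<in> I; u \<in> hom C (Dom C i) (Dom C f); v \<in> hom C (Cod C i) (Cod C f); f \<cdot> u = v \<cdot> i\<rbrakk>
      \<Longrightarrow> \<exists>k h. k \<in> hom C (Cod C i) (Dom C f) \<and> k \<cdot> i = u \<and>
        h \<in> hom C (Cyl i) (Cod C f) \<and> h \<cdot> \<iota>0 i = f \<cdot> k \<and> h \<cdot> \<iota>1 i = v"
  shows "f \<in> W"
  using assms unfolding W_maps_def lifts_upto_def homotopic_def by blast

lemma W_E:
  assumes "f \<in> W" "i \<in> I" "u \<in> hom C (Dom C i) (Dom C f)" "v \<in> hom C (Cod C i) (Cod C f)" "f \<cdot> u = v \<cdot> i"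
  obtains k h where "k \<in> hom C (Cod C i) (Dom C f)" "k \<cdot> i = u"
    "h \<in> hom C (Cyl i) (Cod C f)" "h \<cdot> \<iota>0 i = f \<cdot> k" "h \<cdot> \<iota>1 i = v"
  using assms unfolding W_maps_def lifts_upto_def homotopic_def by blast

text \<open>If \<open>h\<close> is a homotopy from \<open>f \<cdot> k\<close> to \<open>v\<close> and \<open>f\<close> is in \<open>J-inj\<close>, then \<open>h\<close> lifts to a homotopy that
  starts at \<open>k\<close>; its other end is a solution with \<open>v\<close> on the nose.\<close>

lemma inj_I_eq: "inj_maps C I = inj_maps C J \<inter> W"
proof (intro subset_antisym subsetI IntI)
  fix f assume f: "f \<in> inj_maps C I"
  then show "f \<in> inj_maps C J" using inj_I_J by blast
  show "f \<in> W"
  proof (rule W_I)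
    fix i u v assume i: "i \<in> I" and u: "u \<in> hom C (Dom C i) (Dom C f)" and v: "v \<in> hom C (Cod C i) (Cod C f)"
      and sq: "f \<cdot> u = v \<cdot> i"
    have "lifts C i f" using f i by (simp add: inj_maps_def RLP_def)
    then obtain k where k: "k \<in> hom C (Cod C i) (Dom C f)" "k \<cdot> i = u" "f \<cdot> k = v"
      by (rule liftsD[OF _ u v sq])
    obtain s where s: "s \<in> hom C (Cyl i) (Cod C i)" "s \<cdot> \<iota>0 i = Id C (Cod C i)" "s \<cdot> \<iota>1 i = Id C (Cod C i)"
      using cylinder_retraction[OF i] by blast
    note cD = cylinderD[OF i]
    have "v \<cdot> s \<cdot> \<iota>0 i = v" "v \<cdot> s \<cdot> \<iota>1 i = v"
      using Comp_assoc[OF cD(1) s(1) v] Comp_assoc[OF cD(2) s(1) v] s Comp_Id[OF v] by simp_all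
    then show "\<exists>k h. k \<in> hom C (Cod C i) (Dom C f) \<and> k \<cdot> i = u \<and>
        h \<in> hom C (Cyl i) (Cod C f) \<and> h \<cdot> \<iota>0 i = f \<cdot> k \<and> h \<cdot> \<iota>1 i = v"
      using k(1,2) Comp_hom[OF s(1) v] unfolding k(3)
      by (intro exI[of _ k] exI[of _ "v \<cdot> s"] conjI) (simp_all add: k(3))
  qed (rule inj_maps_Arr[OF f])
next
  fix f assume f: "f \<in> inj_maps C J \<inter> W"
  have fA: "f \<in> Arr C" by (rule inj_maps_Arr[OF IntD1[OF f]])
  have "lifts C i f" if i: "i \<in> I" for i
  proof (rule liftsI)
    note cD = cylinderD[OF i] and fh = Arr_hom[OF fA]
    fix u v assume u: "u \<in> hom C (Dom C i) (Dom C f)" and v: "v \<in> hom C (Cod C i) (Cod C f)"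
      and sq: "f \<cdot> u = v \<cdot> i"
    obtain k h where k: "k \<in> hom C (Cod C i) (Dom C f)" "k \<cdot> i = u"
      and h: "h \<in> hom C (Cyl i) (Cod C f)" "h \<cdot> \<iota>0 i = f \<cdot> k" "h \<cdot> \<iota>1 i = v"
      using W_E[OF _ i u v sq] f by blast
    have "lifts C (\<iota>0 i) f" using f i by (auto simp: inj_maps_def RLP_def J_maps_def)
    then obtain l where l: "l \<in> hom C (Cyl i) (Dom C f)" "l \<cdot> \<iota>0 i = k" "f \<cdot> l = h"
      using liftsD[of C "\<iota>0 i" f k h] k h homD(2,3)[OF cD(1)] by auto
    have "f \<cdot> (l \<cdot> \<iota>1 i) = v" using Comp_assoc[OF cD(2) l(1) fh] l(3) h(3) by simp
    moreover have "l \<cdot> \<iota>1 i \<cdot> i = u"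
      using Comp_assoc[OF I_hom[OF i] cD(2) l(1)] Comp_assoc[OF I_hom[OF i] cD(1) l(1)] cD(3) l(2) k(2)
      by simp
    ultimately show "\<exists>k\<in>hom C (Cod C i) (Dom C f). k \<cdot> i = u \<and> f \<cdot> k = v"
      using Comp_hom[OF cD(2) l(1)] by blast
  qed
  then show "f \<in> inj_maps C I" using fA by (simp add: inj_maps_def RLP_def)
qed

text \<open>
  The maps that a model structure with the given classes is bound to have as weak equivalences:
  a trivial cofibration followed by a trivial fibration.
\<close>

definition Weq :: "'m set" where
  "Weq = {p \<cdot> q | p q. q \<in> cof C J \<and> p \<in> inj_maps C I \<and> Cod C q = Dom C p}"

lemma Weq_I: "\<lbrakk>q \<in> cof C J; p \<in> inj_maps C I; Cod C q = Dom C p\<rbrakk> \<Longrightarrow> p \<cdot> q \<in> Weq"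
  by (auto simp: Weq_def)

lemma Weq_E:
  assumes "f \<in> Weq"
  obtains p q where "f = p \<cdot> q" "q \<in> cof C J" "p \<in> inj_maps C I"
    "q \<in> hom C (Dom C f) (Dom C p)" "p \<in> hom C (Dom C p) (Cod C f)"
proof -
  obtain p q where pq: "f = p \<cdot> q" "q \<in> cof C J" "p \<in> inj_maps C I" "Cod C q = Dom C p"
    using assms by (auto simp: Weq_def)
  moreover have "q \<in> Arr C" "p \<in> Arr C" using cof_Arr[OF pq(2)] inj_maps_Arr[OF pq(3)] .
  ultimately show ?thesis using that by (auto simp: hom_def Arr_Comp)
qed

text \<open>
  Against a map in \<open>Weq\<close>, a cofibration has the upper half of the lifting property: lift against the
  trivial fibration and retract along the trivial cofibration.
\<close>

lemma upper_lift_Weq: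
  assumes g: "g \<in> Weq" and j: "j \<in> cof C I"
    and u: "u \<in> hom C (Dom C j) (Dom C g)" and v: "v \<in> hom C (Cod C j) (Cod C g)" and sq: "g \<cdot> u = v \<cdot> j"
  obtains k where "k \<in> hom C (Cod C j) (Dom C g)" "k \<cdot> j = u"
proof -
  obtain p q where pq: "g = p \<cdot> q" "q \<in> cof C J" "p \<in> inj_maps C I"
    "q \<in> hom C (Dom C g) (Dom C p)" "p \<in> hom C (Dom C p) (Cod C g)" using Weq_E[OF g] by blast
  obtain \<rho> where \<rho>: "\<rho> \<in> hom C (Cod C q) (Dom C q)" "\<rho> \<cdot> q = Id C (Dom C q)"
    using cof_J_retraction[OF pq(2)] by blast
  have \<rho>h: "\<rho> \<in> hom C (Dom C p) (Dom C g)" using \<rho>(1) pq(4) by (simp add: hom_def)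
  note jh = Arr_hom[OF cof_Arr[OF j]]
  have "p \<cdot> (q \<cdot> u) = v \<cdot> j" using Comp_assoc[OF u pq(4,5)] pq(1) sq by simp
  then obtain l where l: "l \<in> hom C (Cod C j) (Dom C p)" "l \<cdot> j = q \<cdot> u"
    using liftsD[OF cof_lifts[OF j pq(3)] Comp_hom[OF u pq(4)], of v] v homD(3)[OF pq(5)] by auto
  have "\<rho> \<cdot> l \<cdot> j = u"
    using Comp_assoc[OF jh l(1) \<rho>h] l(2) Comp_assoc[OF u pq(4) \<rho>h] \<rho>(2) homD(2)[OF pq(4)] Id_Comp[OF u]
    by simp
  then show ?thesis using that Comp_hom[OF l(1) \<rho>h] by blast
qed

text \<open>
  A retraction \<open>\<rho>\<close> of a trivial cofibration \<open>q\<close> is a homotopy inverse: \<open>\<rho>\<close> identifies \<open>q \<cdot> \<rho> \<cdot> l\<close> with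
  \<open>l\<close>, and the constant homotopy downstairs extends to one upstairs along \<open>[\<iota>0, \<iota>1]\<close>.
\<close>

lemma retraction_homotopy:
  assumes q: "q \<in> cof C J" and \<rho>: "\<rho> \<in> hom C (Cod C q) (Dom C q)" "\<rho> \<cdot> q = Id C (Dom C q)" "\<rho> \<in> Weq"
    and i: "i \<in> I" and u: "u \<in> hom C (Dom C i) (Dom C q)" and l: "l \<in> hom C (Cod C i) (Cod C q)"
    and sq: "l \<cdot> i = q \<cdot> u"
  obtains h where "h \<in> hom C (Cyl i) (Cod C q)" "h \<cdot> \<iota>0 i = q \<cdot> (\<rho> \<cdot> l)" "h \<cdot> \<iota>1 i = l"
proof -
  obtain j0 j1 c where po: "is_pushout C i i j0 j1" and c: "c \<in> hom C (Cod C j0) (Cyl i)"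
    "c \<cdot> j0 = \<iota>0 i" "c \<cdot> j1 = \<iota>1 i" "c \<in> cof C I" using copair[OF i] by blast
  note pD = is_pushoutD[OF po] and cD = cylinderD[OF i] and ih = I_hom[OF i]
  obtain s where s: "s \<in> hom C (Cyl i) (Cod C i)" "s \<cdot> \<iota>0 i = Id C (Cod C i)" "s \<cdot> \<iota>1 i = Id C (Cod C i)"
    using cylinder_retraction[OF i] by blast
  note qh = Arr_hom[OF cof_Arr[OF q]]
  have \<rho>l: "\<rho> \<cdot> l \<in> hom C (Cod C i) (Dom C q)" using Comp_hom[OF l \<rho>(1)] .
  have q\<rho>l: "q \<cdot> (\<rho> \<cdot> l) \<in> hom C (Cod C i) (Cod C q)" using Comp_hom[OF \<rho>l qh] .
  have "\<rho> \<cdot> l \<cdot> i = u"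
    using Comp_assoc[OF ih l \<rho>(1)] sq Comp_assoc[OF u qh \<rho>(1)] \<rho>(2) Id_Comp[OF u] by simp
  then have "q \<cdot> (\<rho> \<cdot> l) \<cdot> i = l \<cdot> i" using Comp_assoc[OF ih \<rho>l qh] sq by simp
  then obtain m where m: "m \<in> hom C (Cod C j0) (Cod C q)" "m \<cdot> j0 = q \<cdot> (\<rho> \<cdot> l)" "m \<cdot> j1 = l"
    using is_pushout_induced[OF po q\<rho>l l] by blast
  have \<rho>ls: "\<rho> \<cdot> l \<cdot> s \<in> hom C (Cyl i) (Dom C q)" using Comp_hom[OF s(1) \<rho>l] .
  have "\<rho> \<cdot> m = \<rho> \<cdot> l \<cdot> s \<cdot> c"
  proof (rule is_pushout_eqI[OF po Comp_hom[OF m(1) \<rho>(1)] Comp_hom[OF c(1) \<rho>ls] _ _ category_axioms])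
    have "\<rho> \<cdot> m \<cdot> j0 = \<rho> \<cdot> l"
      using Comp_assoc[OF pD(4) m(1) \<rho>(1)] m(2) Comp_assoc[OF \<rho>l qh \<rho>(1)] \<rho>(2) Id_Comp[OF \<rho>l] by simp
    moreover have "\<rho> \<cdot> l \<cdot> s \<cdot> c \<cdot> j0 = \<rho> \<cdot> l"
      using Comp_assoc[OF pD(4) c(1) \<rho>ls] c(2) Comp_assoc[OF cD(1) s(1) \<rho>l] s(2) Comp_Id[OF \<rho>l] by simp
    ultimately show "\<rho> \<cdot> m \<cdot> j0 = \<rho> \<cdot> l \<cdot> s \<cdot> c \<cdot> j0" by simp
    have j1: "j1 \<in> hom C (Cod C i) (Cod C j0)" using pD(5) .
    have "\<rho> \<cdot> m \<cdot> j1 = \<rho> \<cdot> l" using Comp_assoc[OF j1 m(1) \<rho>(1)] m(3) by simp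
    moreover have "\<rho> \<cdot> l \<cdot> s \<cdot> c \<cdot> j1 = \<rho> \<cdot> l"
      using Comp_assoc[OF j1 c(1) \<rho>ls] c(3) Comp_assoc[OF cD(2) s(1) \<rho>l] s(3) Comp_Id[OF \<rho>l] by simp
    ultimately show "\<rho> \<cdot> m \<cdot> j1 = \<rho> \<cdot> l \<cdot> s \<cdot> c \<cdot> j1" by simp
  qed
  then obtain h where h: "h \<in> hom C (Cyl i) (Cod C q)" "h \<cdot> c = m"
    using upper_lift_Weq[OF \<rho>(3) c(4), of m "\<rho> \<cdot> l \<cdot> s"] m(1) \<rho>ls homD(2,3)[OF \<rho>(1)] homD(2,3)[OF c(1)]
    by auto
  have "h \<cdot> \<iota>0 i = q \<cdot> (\<rho> \<cdot> l)" using Comp_assoc[OF pD(4) c(1) h(1)] c(2) h(2) m(2) by simp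
  moreover have "h \<cdot> \<iota>1 i = l" using Comp_assoc[OF pD(5) c(1) h(1)] c(3) h(2) m(3) by simp
  ultimately show ?thesis using that h(1) by blast
qed

text \<open>
  Let \<open>f = p \<cdot> q\<close> be in \<open>Weq\<close>, and let \<open>\<rho>\<close> be a retraction of \<open>q\<close>. If \<open>l\<close> solves the lifting problem
  for the trivial fibration \<open>p\<close>, then \<open>\<rho> \<cdot> l\<close> solves it for \<open>f\<close> up to homotopy, since \<open>q \<cdot> \<rho> \<cdot> l\<close> is
  homotopic to \<open>l\<close>.
\<close>

lemma Weq_sub_W:
  assumes retr: "\<And>q \<rho>. \<lbrakk>q \<in> cof C J; \<rho> \<in> hom C (Cod C q) (Dom C q); \<rho> \<cdot> q = Id C (Dom C q)\<rbrakk> \<Longrightarrow> \<rho> \<in> Weq"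
  shows "Weq \<subseteq> W"
proof
  fix f assume "f \<in> Weq"
  then obtain p q where pq: "f = p \<cdot> q" "q \<in> cof C J" "p \<in> inj_maps C I"
    "q \<in> hom C (Dom C f) (Dom C p)" "p \<in> hom C (Dom C p) (Cod C f)" using Weq_E by blast
  note qc = homD(2,3)[OF pq(4)]
  obtain \<rho> where \<rho>: "\<rho> \<in> hom C (Cod C q) (Dom C q)" "\<rho> \<cdot> q = Id C (Dom C q)"
    using cof_J_retraction[OF pq(2)] by blast
  note \<rho>Weq = retr[OF pq(2) \<rho>]
  have \<rho>h: "\<rho> \<in> hom C (Dom C p) (Dom C f)" using \<rho>(1) qc by simp
  show "f \<in> W"
  proof (rule W_I)
    show "f \<in> Arr C" using homD(1)[OF Comp_hom[OF pq(4,5)]] unfolding pq(1) .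
    fix i u v assume i: "i \<in> I" and u: "u \<in> hom C (Dom C i) (Dom C f)" and v: "v \<in> hom C (Cod C i) (Cod C f)"
      and sq: "f \<cdot> u = v \<cdot> i"
    have "lifts C i p" using pq(3) i by (simp add: inj_maps_def RLP_def)
    moreover have "p \<cdot> (q \<cdot> u) = v \<cdot> i" using Comp_assoc[OF u pq(4,5)] pq(1) sq by simp
    ultimately obtain l where l: "l \<in> hom C (Cod C i) (Dom C p)" "l \<cdot> i = q \<cdot> u" "p \<cdot> l = v"
      using liftsD[of C i p "q \<cdot> u" v] Comp_hom[OF u pq(4)] v homD(3)[OF pq(5)] by auto
    obtain h where h: "h \<in> hom C (Cyl i) (Cod C q)" "h \<cdot> \<iota>0 i = q \<cdot> (\<rho> \<cdot> l)" "h \<cdot> \<iota>1 i = l"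
      using retraction_homotopy[OF pq(2) \<rho> \<rho>Weq i, of u l] u l qc by auto
    have hh: "h \<in> hom C (Cyl i) (Dom C p)" using h(1) qc by simp
    have \<rho>l: "\<rho> \<cdot> l \<in> hom C (Cod C i) (Dom C f)" using Comp_hom[OF l(1) \<rho>h] .
    note cD = cylinderD[OF i]
    have "p \<cdot> h \<cdot> \<iota>0 i = f \<cdot> (\<rho> \<cdot> l)"
      using Comp_assoc[OF cD(1) hh pq(5)] h(2) Comp_assoc[OF \<rho>l pq(4,5)] pq(1) by simp
    moreover have "p \<cdot> h \<cdot> \<iota>1 i = v" using Comp_assoc[OF cD(2) hh pq(5)] h(3) l(3) by simp
    moreover have "\<rho> \<cdot> l \<cdot> i = u"
      using Comp_assoc[OF I_hom[OF i] l(1) \<rho>h] l(2) Comp_assoc[OF u pq(4) \<rho>h] \<rho>(2) qc Id_Comp[OF u] by simp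
    ultimately show "\<exists>k h. k \<in> hom C (Cod C i) (Dom C f) \<and> k \<cdot> i = u \<and>
        h \<in> hom C (Cyl i) (Cod C f) \<and> h \<cdot> \<iota>0 i = f \<cdot> k \<and> h \<cdot> \<iota>1 i = v"
      using \<rho>l Comp_hom[OF hh pq(5)] by (intro exI[of _ "\<rho> \<cdot> l"] exI[of _ "p \<cdot> h"] conjI)
  qed
qed

text \<open>
  A solution \<open>k\<close> up to homotopy for \<open>g \<cdot> f\<close> is one for \<open>f\<close>: the homotopy from \<open>g \<cdot> f \<cdot> k\<close> to \<open>g \<cdot> v\<close>
  lifts along \<open>g\<close> to one from \<open>f \<cdot> k\<close> to \<open>v\<close>, as \<open>[\<iota>0, \<iota>1]\<close> is a cofibration.
\<close>

lemma W_cancel_left: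
  assumes f: "f \<in> Arr C" and g: "g \<in> Weq" and fg: "Cod C f = Dom C g" and gf: "g \<cdot> f \<in> W"
  shows "f \<in> W"
proof (rule W_I[OF f])
  fix i u v assume i: "i \<in> I" and u: "u \<in> hom C (Dom C i) (Dom C f)" and v: "v \<in> hom C (Cod C i) (Cod C f)"
    and sq: "f \<cdot> u = v \<cdot> i"
  have gA: "g \<in> Arr C" by (rule Weq_E[OF g]) (auto simp: hom_def Arr_Comp)
  have fh: "f \<in> hom C (Dom C f) (Cod C f)" and gh: "g \<in> hom C (Cod C f) (Cod C g)"
    using f gA fg by (simp_all add: hom_def)
  note ih = I_hom[OF i] and cD = cylinderD[OF i]
  have gfA: "Dom C (g \<cdot> f) = Dom C f" "Cod C (g \<cdot> f) = Cod C g" using Arr_Comp[OF f gA fg] by simp_all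
  have "g \<cdot> f \<cdot> u = g \<cdot> v \<cdot> i" using Comp_assoc[OF u fh gh] Comp_assoc[OF ih v gh] sq by simp
  then obtain k h where k: "k \<in> hom C (Cod C i) (Dom C f)" "k \<cdot> i = u"
    and h: "h \<in> hom C (Cyl i) (Cod C g)" "h \<cdot> \<iota>0 i = g \<cdot> f \<cdot> k" "h \<cdot> \<iota>1 i = g \<cdot> v"
    using W_E[OF gf i, of u "g \<cdot> v"] u Comp_hom[OF v gh] unfolding gfA by blast
  have fk: "f \<cdot> k \<in> hom C (Cod C i) (Cod C f)" using Comp_hom[OF k(1) fh] .
  obtain j0 j1 c where po: "is_pushout C i i j0 j1" and c: "c \<in> hom C (Cod C j0) (Cyl i)"
    "c \<cdot> j0 = \<iota>0 i" "c \<cdot> j1 = \<iota>1 i" "c \<in> cof C I" using copair[OF i] by blast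
  note pD = is_pushoutD[OF po]
  have "f \<cdot> k \<cdot> i = v \<cdot> i" using Comp_assoc[OF ih k(1) fh] k(2) sq by simp
  then obtain m where m: "m \<in> hom C (Cod C j0) (Cod C f)" "m \<cdot> j0 = f \<cdot> k" "m \<cdot> j1 = v"
    using is_pushout_induced[OF po fk v] by blast
  have "g \<cdot> m = h \<cdot> c"
    by (rule is_pushout_eqI[OF po Comp_hom[OF m(1) gh] Comp_hom[OF c(1) h(1)] _ _ category_axioms])
      (use Comp_assoc[OF pD(4) m(1) gh] Comp_assoc[OF pD(4) c(1) h(1)] Comp_assoc[OF pD(5) m(1) gh]
        Comp_assoc[OF pD(5) c(1) h(1)] m c h Comp_assoc[OF k(1) fh gh] in simp_all)
  then obtain h' where h': "h' \<in> hom C (Cyl i) (Cod C f)" "h' \<cdot> c = m"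
    using upper_lift_Weq[OF g c(4), of m h] m(1) h(1) homD(2,3)[OF c(1)] fg by auto
  have "h' \<cdot> \<iota>0 i = f \<cdot> k" "h' \<cdot> \<iota>1 i = v"
    using Comp_assoc[OF pD(4) c(1) h'(1)] Comp_assoc[OF pD(5) c(1) h'(1)] c h' m by simp_all
  then show "\<exists>k h. k \<in> hom C (Cod C i) (Dom C f) \<and> k \<cdot> i = u \<and>
      h \<in> hom C (Cyl i) (Cod C f) \<and> h \<cdot> \<iota>0 i = f \<cdot> k \<and> h \<cdot> \<iota>1 i = v"
    using k h'(1) by (intro exI[of _ k] exI[of _ h'] conjI)
qed

text \<open>A retract relative to the domain; in this way the maps in \<open>J-cof\<close> inherit properties of those in
  \<open>J-cell\<close>.\<close>

lemma W_retract:
  assumes q: "q \<in> W" "q \<in> hom C X Z" and p: "p \<in> hom C Z Y" and s: "s \<in> hom C Y Z"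
    and eq: "s \<cdot> (p \<cdot> q) = q" "p \<cdot> s = Id C Y"
  shows "p \<cdot> q \<in> W"
proof -
  have pq: "p \<cdot> q \<in> hom C X Y" using Comp_hom[OF q(2) p] .
  note pqD = homD[OF pq] and qD = homD[OF q(2)]
  show ?thesis
  proof (rule W_I[OF pqD(1)], unfold pqD(2,3))
    fix i u v assume i: "i \<in> I" and u: "u \<in> hom C (Dom C i) X" and v: "v \<in> hom C (Cod C i) Y"
      and sq: "p \<cdot> q \<cdot> u = v \<cdot> i"
    note ih = I_hom[OF i] and cD = cylinderD[OF i]
    have "q \<cdot> u = s \<cdot> v \<cdot> i" using Comp_assoc[OF u pq s] eq(1) sq Comp_assoc[OF ih v s] by simp
    then obtain k h where k: "k \<in> hom C (Cod C i) X" "k \<cdot> i = u"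
      and h: "h \<in> hom C (Cyl i) Z" "h \<cdot> \<iota>0 i = q \<cdot> k" "h \<cdot> \<iota>1 i = s \<cdot> v"
      using W_E[OF q(1) i, of u "s \<cdot> v"] u Comp_hom[OF v s] unfolding qD by blast
    have "p \<cdot> h \<cdot> \<iota>0 i = p \<cdot> q \<cdot> k" using Comp_assoc[OF cD(1) h(1) p] h(2) Comp_assoc[OF k(1) q(2) p] by simp
    moreover have "p \<cdot> h \<cdot> \<iota>1 i = v"
      using Comp_assoc[OF cD(2) h(1) p] h(3) Comp_assoc[OF v s p] eq(2) Id_Comp[OF v] by simp
    ultimately show "\<exists>k h. k \<in> hom C (Cod C i) X \<and> k \<cdot> i = u \<and>
        h \<in> hom C (Cyl i) Y \<and> h \<cdot> \<iota>0 i = p \<cdot> q \<cdot> k \<and> h \<cdot> \<iota>1 i = v"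
      using k Comp_hom[OF h(1) p] by (intro exI[of _ k] exI[of _ "p \<cdot> h"] conjI)
  qed
qed

end

context relative_cylinders begin

section \<open>From the cancellation condition to a model structure\<close>

text \<open>
  Cancellation turns factorizations into \<open>J-cell\<close> and \<open>J-inj\<close> of maps in \<open>W\<close> into factorizations with
  a trivial fibration on the right, and puts the retractions of trivial cofibrations into \<open>W\<close>. Once
  \<open>W\<close> is identified with \<open>Weq\<close>, closure under composition remains: in a composite of two maps of
  \<open>Weq\<close>, the inner trivial fibration and trivial cofibration have to be interchanged.
\<close>

lemma model_structure_of_cancellation:
  assumes Ifact: "\<And>f. f \<in> Arr C \<Longrightarrow> \<exists>q \<in> cell U C I. \<exists>p \<in> inj_maps C I. Cod C q = Dom C p \<and> f = p \<cdot> q"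
    and Jfact: "\<And>f. f \<in> Arr C \<Longrightarrow> \<exists>q \<in> cell U C J. \<exists>p \<in> inj_maps C J. Cod C q = Dom C p \<and> f = p \<cdot> q"
    and cancel: "\<And>f g. \<lbrakk>f \<in> cell U C J \<union> W; g \<in> Arr C; Cod C f = Dom C g; g \<cdot> f \<in> W\<rbrakk> \<Longrightarrow> g \<in> W"
  shows "model_structure C (inj_maps C J) (cof C I) W \<and> cof C I \<inter> W = cof C J"
proof -
  note cell_J = cell_cof[OF category_axioms J_Arr, of U]
  have Id_W: "Id C X \<in> W" if "X \<in> Obj C" for X
    using Id_inj_maps[OF that I_Arr] inj_I_eq by blast
  have fact_W: "\<exists>q p. q \<in> cell U C J \<and> p \<in> inj_maps C I \<and> Cod C q = Dom C p \<and> f = p \<cdot> q" if f: "f \<in> W" for f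
  proof -
    obtain q p where qp: "q \<in> cell U C J" "p \<in> inj_maps C J" "Cod C q = Dom C p" "f = p \<cdot> q"
      using Jfact[OF subsetD[OF W_Arr f]] by blast
    have "p \<in> W" using cancel[of q p] qp f inj_maps_Arr[OF qp(2)] by auto
    then show ?thesis using qp inj_I_eq by blast
  qed
  have W_Weq: "W \<subseteq> Weq"
  proof
    fix f assume "f \<in> W"
    then obtain q p where "q \<in> cell U C J" "p \<in> inj_maps C I" "Cod C q = Dom C p" "f = p \<cdot> q"
      using fact_W by blast
    then show "f \<in> Weq" using Weq_I[of q p] cell_J by blast
  qed
  have cell_J_W: "cell U C J \<subseteq> W"
  proof
    fix q assume q: "q \<in> cell U C J"
    then have qJ: "q \<in> cof C J" using cell_J by blast
    note qA = cof_Arr[OF qJ]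
    obtain \<rho> where \<rho>: "\<rho> \<in> hom C (Cod C q) (Dom C q)" "\<rho> \<cdot> q = Id C (Dom C q)"
      using cof_J_retraction[OF qJ] by blast
    note \<rho>D = homD[OF \<rho>(1)]
    have "\<rho> \<in> W" using cancel[of q \<rho>] q \<rho>D \<rho>(2) Id_W[OF Dom_Obj[OF qA]] by simp
    then show "q \<in> W"
      using W_cancel_left[OF qA, of \<rho>] W_Weq \<rho>D(2) \<rho>(2) Id_W[OF Dom_Obj[OF qA]] by auto
  qed
  have cof_J_W: "cof C J \<subseteq> W"
  proof
    fix q assume q: "q \<in> cof C J"
    obtain q' p where qp: "q' \<in> cell U C J" "p \<in> inj_maps C J" "Cod C q' = Dom C p" "q = p \<cdot> q'"
      using Jfact[OF cof_Arr[OF q]] by blast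
    have A: "q' \<in> Arr C" "p \<in> Arr C" using cof_Arr[OF subsetD[OF cell_J qp(1)]] inj_maps_Arr[OF qp(2)] .
    obtain s where s: "s \<in> hom C (Cod C q) (Cod C q')" "s \<cdot> q = q'" "p \<cdot> s = Id C (Cod C q)"
      by (rule retract_argument[OF A qp(3,4) cof_lifts[OF q qp(2)]])
    have p: "p \<in> hom C (Cod C q') (Cod C q)" using A qp(3,4) by (simp add: hom_def Arr_Comp)
    have "p \<cdot> q' \<in> W"
      by (rule W_retract[OF subsetD[OF cell_J_W qp(1)] Arr_hom[OF A(1)] p s(1)])
        (use s qp(4) in simp_all)
    then show "q \<in> W" using qp(4) by simp
  qed
  have retr: "\<rho> \<in> Weq" if q: "q \<in> cof C J" and \<rho>: "\<rho> \<in> hom C (Cod C q) (Dom C q)" "\<rho> \<cdot> q = Id C (Dom C q)" for q \<rho>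
  proof -
    have "\<rho> \<in> W" using cancel[of q \<rho>] q cof_J_W homD[OF \<rho>(1)] \<rho>(2) Id_W[OF Dom_Obj[OF cof_Arr[OF q]]] by auto
    then show ?thesis using W_Weq by blast
  qed
  have Weq_W: "Weq = W" using Weq_sub_W retr W_Weq by blast
  \<comment> \<open>If \<open>\<rho>\<close> is a retraction of \<open>q\<close> and \<open>l\<close> lifts \<open>\<rho> \<cdot> v\<close> along \<open>p\<close>, then \<open>q \<cdot> p \<cdot> l = q \<cdot> \<rho> \<cdot> v\<close> is
    homotopic to \<open>v\<close>.\<close>
  have swap: "q \<cdot> p \<in> W" if p: "p \<in> inj_maps C I" and q: "q \<in> cof C J" and pq: "Cod C p = Dom C q" for p q
  proof -
    note pA = inj_maps_Arr[OF p] and qA = cof_Arr[OF q]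
    have ph: "p \<in> hom C (Dom C p) (Dom C q)" and qh: "q \<in> hom C (Dom C q) (Cod C q)"
      using pA qA pq by (simp_all add: hom_def)
    obtain \<rho> where \<rho>: "\<rho> \<in> hom C (Cod C q) (Dom C q)" "\<rho> \<cdot> q = Id C (Dom C q)"
      using cof_J_retraction[OF q] by blast
    note qp = Arr_Comp[OF pA qA pq]
    show ?thesis
    proof (rule W_I[OF qp(1)], unfold qp(2,3))
      fix i u v assume i: "i \<in> I" and u: "u \<in> hom C (Dom C i) (Dom C p)" and v: "v \<in> hom C (Cod C i) (Cod C q)"
        and sq: "q \<cdot> p \<cdot> u = v \<cdot> i"
      have pu: "p \<cdot> u \<in> hom C (Dom C i) (Dom C q)" and \<rho>v: "\<rho> \<cdot> v \<in> hom C (Cod C i) (Dom C q)"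
        using Comp_hom[OF u ph] Comp_hom[OF v \<rho>(1)] .
      have vi: "v \<cdot> i = q \<cdot> (p \<cdot> u)" using Comp_assoc[OF u ph qh] sq by simp
      have "p \<cdot> u = \<rho> \<cdot> v \<cdot> i"
        using Comp_assoc[OF I_hom[OF i] v \<rho>(1)] vi Comp_assoc[OF pu qh \<rho>(1)] \<rho>(2) Id_Comp[OF pu] by simp
      moreover have "lifts C i p" using p i by (simp add: inj_maps_def RLP_def)
      ultimately obtain l where l: "l \<in> hom C (Cod C i) (Dom C p)" "l \<cdot> i = u" "p \<cdot> l = \<rho> \<cdot> v"
        using liftsD[of C i p u "\<rho> \<cdot> v"] u \<rho>v pq by auto
      obtain h where h: "h \<in> hom C (Cyl i) (Cod C q)" "h \<cdot> \<iota>0 i = q \<cdot> (\<rho> \<cdot> v)" "h \<cdot> \<iota>1 i = v"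
        by (rule retraction_homotopy[OF q \<rho> retr[OF q \<rho>] i pu v vi])
      have "h \<cdot> \<iota>0 i = q \<cdot> p \<cdot> l" using h(2) l(3) Comp_assoc[OF l(1) ph qh] by simp
      then show "\<exists>k h. k \<in> hom C (Cod C i) (Dom C p) \<and> k \<cdot> i = u \<and>
          h \<in> hom C (Cyl i) (Cod C q) \<and> h \<cdot> \<iota>0 i = q \<cdot> p \<cdot> k \<and> h \<cdot> \<iota>1 i = v"
        using l(1,2) h(1,3) by (intro exI[of _ l] exI[of _ h] conjI)
    qed
  qed
  have comp: "g \<cdot> f \<in> W" if f: "f \<in> W" and g: "g \<in> W" and fg: "Cod C f = Dom C g" for f g
  proof -
    obtain p q where pq: "f = p \<cdot> q" "q \<in> cof C J" "p \<in> inj_maps C I"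
      "q \<in> hom C (Dom C f) (Dom C p)" "p \<in> hom C (Dom C p) (Cod C f)" using Weq_E f Weq_W by blast
    obtain p' q' where pq': "g = p' \<cdot> q'" "q' \<in> cof C J" "p' \<in> inj_maps C I"
      "q' \<in> hom C (Dom C g) (Dom C p')" "p' \<in> hom C (Dom C p') (Cod C g)" using Weq_E g Weq_W by blast
    have q'h: "q' \<in> hom C (Cod C f) (Dom C p')" using pq'(4) fg by simp
    have qp: "q' \<cdot> p \<in> hom C (Dom C p) (Dom C p')" using Comp_hom[OF pq(5) q'h] .
    have "q' \<cdot> p \<in> W" using swap[OF pq(3) pq'(2)] homD(3)[OF pq(5)] homD(2)[OF q'h] by simp
    then obtain a b where ab: "q' \<cdot> p = b \<cdot> a" "a \<in> cof C J" "b \<in> inj_maps C I"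
      "a \<in> hom C (Dom C p) (Dom C b)" "b \<in> hom C (Dom C b) (Dom C p')"
      using Weq_E[of "q' \<cdot> p"] Weq_W unfolding homD(2,3)[OF qp] by blast
    have "a \<cdot> q \<in> cof C J" using cof_Comp[OF pq(2) ab(2)] homD(3)[OF pq(4)] homD(2)[OF ab(4)] by simp
    moreover have "p' \<cdot> b \<in> inj_maps C I"
      using inj_maps_Comp[OF ab(3) pq'(3)] homD(3)[OF ab(5)] I_Arr by simp
    moreover have aq: "a \<cdot> q \<in> hom C (Dom C f) (Dom C b)" using Comp_hom[OF pq(4) ab(4)] .
    moreover have pb: "p' \<cdot> b \<in> hom C (Dom C b) (Cod C g)" using Comp_hom[OF ab(5) pq'(5)] .
    ultimately have "p' \<cdot> b \<cdot> (a \<cdot> q) \<in> Weq" using Weq_I[of "a \<cdot> q" "p' \<cdot> b"] homD(3)[OF aq] homD(2)[OF pb] by simp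
    also have "p' \<cdot> b \<cdot> (a \<cdot> q) = p' \<cdot> (b \<cdot> a \<cdot> q)"
      using Comp_assoc[OF aq ab(5) pq'(5)] Comp_assoc[OF pq(4) ab(4,5)] by simp
    also have "\<dots> = p' \<cdot> (q' \<cdot> f)" using ab(1) Comp_assoc[OF pq(4,5) q'h] pq(1) by simp
    also have "\<dots> = g \<cdot> f"
      using Comp_assoc[OF Comp_hom[OF pq(4,5)] q'h pq'(5)] pq(1) pq'(1) by simp
    finally show ?thesis using Weq_W by simp
  qed
  have two: "two_out_of_three C W"
    unfolding two_out_of_three_def
  proof (intro ballI impI conjI; (elim conjE)?)
    fix f g assume A: "f \<in> Arr C" "g \<in> Arr C" "Cod C f = Dom C g"
    show "f \<in> W \<Longrightarrow> g \<in> W \<Longrightarrow> g \<cdot> f \<in> W" using comp A(3) by blast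
    show "f \<in> W \<Longrightarrow> g \<cdot> f \<in> W \<Longrightarrow> g \<in> W" using cancel[of f g] A by blast
    show "g \<in> W \<Longrightarrow> g \<cdot> f \<in> W \<Longrightarrow> f \<in> W" using W_cancel_left[OF A(1)] A(3) Weq_W by blast
  qed
  have eq: "cof C I \<inter> W = cof C J"
  proof (intro subset_antisym subsetI)
    show "q \<in> cof C I \<inter> W" if "q \<in> cof C J" for q
      using that cof_J_W cof_mono[OF J_cof] by blast
    fix j assume j: "j \<in> cof C I \<inter> W"
    obtain q p where qp: "q \<in> cell U C J" "p \<in> inj_maps C I" "Cod C q = Dom C p" "j = p \<cdot> q"
      using fact_W j by blast
    have qJ: "q \<in> cof C J" using qp(1) cell_J by blast
    have A: "q \<in> Arr C" "p \<in> Arr C" using cof_Arr[OF qJ] inj_maps_Arr[OF qp(2)] .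
    obtain s where s: "s \<in> hom C (Cod C j) (Cod C q)" "s \<cdot> j = q" "p \<cdot> s = Id C (Cod C j)"
      by (rule retract_argument[OF A qp(3,4) cof_lifts[OF IntD1[OF j] qp(2)]])
    have "lifts C j g" if "g \<in> inj_maps C J" for g
      by (rule lifts_retract[OF A qp(3,4) s inj_maps_Arr[OF that] cof_lifts[OF qJ that]])
    then show "j \<in> cof C J" using cof_Arr[OF IntD1[OF j]] by (simp add: cof_def LLP_def)
  qed
  have wfs1: "weak_fact_system C (cof C I) (inj_maps C J \<inter> W)"
    unfolding weak_fact_system_def inj_I_eq[symmetric]
  proof (intro conjI ballI)
    show "cof C I = LLP C (inj_maps C I)" by (simp add: cof_def)
    show "inj_maps C I = RLP C (cof C I)" using RLP_cof[OF I_Arr] by simp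
    fix f assume "f \<in> Arr C"
    then obtain q p where "q \<in> cell U C I" "p \<in> inj_maps C I" "Cod C q = Dom C p" "f = p \<cdot> q"
      using Ifact by blast
    then show "\<exists>l\<in>cof C I. \<exists>r\<in>inj_maps C I. Cod C l = Dom C r \<and> r \<cdot> l = f"
      using cell_cof[OF category_axioms I_Arr, of U] by blast
  qed
  have wfs2: "weak_fact_system C (cof C I \<inter> W) (inj_maps C J)"
    unfolding weak_fact_system_def eq
  proof (intro conjI ballI)
    show "cof C J = LLP C (inj_maps C J)" by (simp add: cof_def)
    show "inj_maps C J = RLP C (cof C J)" using RLP_cof[OF J_Arr] by simp
    fix f assume "f \<in> Arr C"
    then obtain q p where "q \<in> cell U C J" "p \<in> inj_maps C J" "Cod C q = Dom C p" "f = p \<cdot> q"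
      using Jfact by blast
    then show "\<exists>l\<in>cof C J. \<exists>r\<in>inj_maps C J. Cod C l = Dom C r \<and> r \<cdot> l = f"
      using cell_J by blast
  qed
  show ?thesis using W_Arr two wfs1 wfs2 eq by (simp add: model_structure_def)
qed


section \<open>From a model structure to the cancellation condition\<close>

text \<open>
  That maps \<open>f : X \<rightarrow> Y\<close> in \<open>W\<close> are weak equivalences is proved with the path object \<open>P\<close> obtained by
  factoring the diagonal of \<open>Y\<close>, and the mapping path space \<open>N\<close>, the pullback of \<open>f\<close> along the
  start point map \<open>\<pi>0 : P \<rightarrow> Y\<close>. The map \<open>f\<close> is the section of constant paths \<open>X \<rightarrow> N\<close>, a weak
  equivalence, followed by the end point map \<open>n : N \<rightarrow> Y\<close>. The latter is in \<open>I-inj\<close>: given a problem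
  for \<open>n\<close>, the path over \<open>U\<close> is extended to \<open>V\<close> with the prescribed end point; its start point poses a
  problem for \<open>f\<close>, whose solution up to homotopy is joined to the extended path by lifting in
  \<open>P \<rightarrow> Y \<times> Y\<close> along \<open>\<iota>1\<close>.
\<close>

lemma weak_equivalences_eq_W:
  assumes ms: "model_structure C Fib (cof C I) V" and triv: "cof C I \<inter> V = cof C J"
  shows "V = W"
proof -
  have V: "V \<subseteq> Arr C" and two: "two_out_of_three C V"
    and wfs1: "weak_fact_system C (cof C I) (Fib \<inter> V)" and wfs2: "weak_fact_system C (cof C J) Fib"
    using ms unfolding model_structure_def triv by auto
  have tf: "Fib \<inter> V = inj_maps C I" using wfs1 RLP_cof[OF I_Arr] by (simp add: weak_fact_system_def)
  have Fib: "Fib = inj_maps C J" using wfs2 RLP_cof[OF J_Arr] by (simp add: weak_fact_system_def)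
  have comp: "g \<cdot> f \<in> V" if "f \<in> V" "g \<in> V" "Cod C f = Dom C g" for f g
    using two that V unfolding two_out_of_three_def by blast
  have cl: "g \<in> V" if "f \<in> V" "g \<cdot> f \<in> V" "g \<in> Arr C" "Cod C f = Dom C g" for f g
    using two that V unfolding two_out_of_three_def by blast
  have cr: "f \<in> V" if "g \<in> V" "g \<cdot> f \<in> V" "f \<in> Arr C" "Cod C f = Dom C g" for f g
    using two that V unfolding two_out_of_three_def by blast
  have JV: "cof C J \<subseteq> V" using triv by blast
  have IV: "inj_maps C I \<subseteq> V" using tf by blast
  have Jfact: "\<exists>q\<in>cof C J. \<exists>p\<in>inj_maps C J. Cod C q = Dom C p \<and> p \<cdot> q = f" if "f \<in> Arr C" for f
    using wfs2 that unfolding weak_fact_system_def Fib by blast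
  have Id_V: "Id C X \<in> V" if "X \<in> Obj C" for X using IV Id_inj_maps[OF that I_Arr] by blast
  have VWeq: "V \<subseteq> Weq"
  proof
    fix f assume f: "f \<in> V"
    obtain q p where qp: "q \<in> cof C J" "p \<in> inj_maps C J" "Cod C q = Dom C p" "p \<cdot> q = f"
      using Jfact subsetD[OF V f] by blast
    have "p \<in> V" using cl[of q p] qp f JV inj_maps_Arr[OF qp(2)] by blast
    then have "p \<in> inj_maps C I" using tf qp(2) Fib by blast
    then show "f \<in> Weq" using Weq_I[OF qp(1) _ qp(3)] qp(4) by blast
  qed
  have retr: "\<rho> \<in> Weq" if q: "q \<in> cof C J" and \<rho>: "\<rho> \<in> hom C (Cod C q) (Dom C q)" "\<rho> \<cdot> q = Id C (Dom C q)" for q \<rho>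
    using cl[of q \<rho>] JV q \<rho>(2) Id_V[OF Dom_Obj[OF cof_Arr[OF q]]] homD[OF \<rho>(1)] VWeq by auto
  have VW: "V \<subseteq> W" by (rule subset_trans[OF VWeq Weq_sub_W]) (rule retr)
  \<comment> \<open>Both ends of a cylinder are sections of the same weak equivalence.\<close>
  have \<iota>1: "\<iota>1 i \<in> cof C J" if i: "i \<in> I" for i
  proof -
    note cD = cylinderD[OF i]
    obtain s where s: "s \<in> hom C (Cyl i) (Cod C i)" "s \<cdot> \<iota>0 i = Id C (Cod C i)" "s \<cdot> \<iota>1 i = Id C (Cod C i)"
      using cylinder_retraction[OF i] by blast
    have O: "Cod C i \<in> Obj C" using hom_Obj(1)[OF cD(1)] .
    have "\<iota>0 i \<in> V" using JV sub_cof[OF J_Arr] i by (auto simp: J_maps_def)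
    then have "s \<in> V" using cl[of "\<iota>0 i" s] s Id_V[OF O] homD[OF s(1)] homD(3)[OF cD(1)] by simp
    then have "\<iota>1 i \<in> V" using cr[of s "\<iota>1 i"] s Id_V[OF O] homD[OF s(1)] homD[OF cD(2)] by simp
    then show ?thesis using cylinder_cof(2)[OF i] triv by blast
  qed
  have "W \<subseteq> V"
  proof
    fix f assume f: "f \<in> W"
    define X Y where "X = Dom C f" and "Y = Cod C f"
    have fA: "f \<in> Arr C" using f W_Arr by blast
    have fh: "f \<in> hom C X Y" using fA by (simp add: hom_def X_def Y_def)
    have XO: "X \<in> Obj C" and YO: "Y \<in> Obj C" using hom_Obj[OF fh] by auto
    obtain T where T: "T \<in> Obj C" "\<And>X. X \<in> Obj C \<Longrightarrow> \<exists>!t. t \<in> hom C X T"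
      using terminal_exists[OF univ category_axioms compl] by blast
    obtain t where t: "t \<in> hom C Y T" using T(2)[OF YO] by blast
    have t_eq: "t \<cdot> a = t \<cdot> b" if "a \<in> hom C Q Y" "b \<in> hom C Q Y" for a b Q
      using T(2)[OF hom_Obj(1)[OF that(1)]] Comp_hom[OF that(1) t] Comp_hom[OF that(2) t] by blast
    note tD = homD[OF t]
    obtain p0 p1 where pr: "is_pullback C t t p0 p1"
      using pullback_exists[OF univ category_axioms compl tD(1) tD(1)] by blast
    define YY where "YY = Dom C p0"
    have ph: "p0 \<in> hom C YY Y" "p1 \<in> hom C YY Y"
      using is_pullbackD[OF pr] tD(2) by (simp_all add: YY_def)
    have pair: "\<exists>h. h \<in> hom C Q YY \<and> p0 \<cdot> h = a \<and> p1 \<cdot> h = b" if "a \<in> hom C Q Y" "b \<in> hom C Q Y" for a b Q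
      by (rule is_pullback_induced[OF pr _ _ t_eq[OF that]]) (use that tD(2) in \<open>auto simp: YY_def\<close>)
    have pair_eq: "h = h'" if "h \<in> hom C Q YY" "h' \<in> hom C Q YY" "p0 \<cdot> h = p0 \<cdot> h'" "p1 \<cdot> h = p1 \<cdot> h'" for h h' Q
      using is_pullback_eqI[OF pr] that category_axioms by (simp add: YY_def)
    \<comment> \<open>The projections of the product are pullbacks of the map from \<open>Y\<close> to the terminal object.\<close>
    have t_inj: "t \<in> inj_maps C J" using to_terminal_inj_J[OF T t] .
    have pr_inj: "p0 \<in> inj_maps C J" "p1 \<in> inj_maps C J"
    proof -
      have jt: "j \<in> Arr C" "lifts C j t" if "j \<in> J" for j
        using that J_Arr t_inj by (auto simp: inj_maps_def RLP_def)
      have "lifts C j p0" if "j \<in> J" for j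
        using lifts_pullback[OF pr jt[OF that]] .
      moreover have "lifts C j p1" if "j \<in> J" for j
        using lifts_pullback[OF is_pullback_sym[OF pr] jt[OF that]] .
      ultimately show "p0 \<in> inj_maps C J" "p1 \<in> inj_maps C J"
        using homD(1)[OF ph(1)] homD(1)[OF ph(2)] by (simp_all add: inj_maps_def RLP_def)
    qed
    obtain \<Delta> where \<Delta>: "\<Delta> \<in> hom C Y YY" "p0 \<cdot> \<Delta> = Id C Y" "p1 \<cdot> \<Delta> = Id C Y"
      using pair[OF Id_hom[OF YO] Id_hom[OF YO]] by blast
    obtain c \<pi> where c\<pi>: "c \<in> cof C J" "\<pi> \<in> inj_maps C J" "Cod C c = Dom C \<pi>" "\<pi> \<cdot> c = \<Delta>"
      using Jfact[OF homD(1)[OF \<Delta>(1)]] by blast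
    define P where "P = Cod C c"
    note cA = cof_Arr[OF c\<pi>(1)] and \<pi>A = inj_maps_Arr[OF c\<pi>(2)]
    have ch: "c \<in> hom C Y P" and \<pi>h: "\<pi> \<in> hom C P YY"
      using Arr_Comp[OF cA \<pi>A c\<pi>(3)] c\<pi>(3,4) homD[OF \<Delta>(1)] cA \<pi>A by (simp_all add: hom_def P_def)
    define \<pi>0 \<pi>1 where "\<pi>0 = p0 \<cdot> \<pi>" and "\<pi>1 = p1 \<cdot> \<pi>"
    have \<pi>01h: "\<pi>0 \<in> hom C P Y" "\<pi>1 \<in> hom C P Y"
      using Comp_hom[OF \<pi>h ph(1)] Comp_hom[OF \<pi>h ph(2)] by (simp_all add: \<pi>0_def \<pi>1_def)
    have \<pi>c: "\<pi>0 \<cdot> c = Id C Y" "\<pi>1 \<cdot> c = Id C Y"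
      using Comp_assoc[OF ch \<pi>h ph(1)] Comp_assoc[OF ch \<pi>h ph(2)] c\<pi>(4) \<Delta> by (simp_all add: \<pi>0_def \<pi>1_def)
    have cV: "c \<in> V" using c\<pi>(1) JV by blast
    have "\<pi>0 \<in> V" "\<pi>1 \<in> V"
      using cl[OF cV, of \<pi>0] cl[OF cV, of \<pi>1] \<pi>c Id_V[OF YO] homD[OF \<pi>01h(1)] homD[OF \<pi>01h(2)] homD(3)[OF ch]
      by simp_all
    moreover have "\<pi>0 \<in> inj_maps C J" "\<pi>1 \<in> inj_maps C J"
      using inj_maps_Comp[OF c\<pi>(2) pr_inj(1)] inj_maps_Comp[OF c\<pi>(2) pr_inj(2)] J_Arr
        homD(3)[OF \<pi>h] homD(2)[OF ph(1)] homD(2)[OF ph(2)] by (simp_all add: \<pi>0_def \<pi>1_def)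
    ultimately have \<pi>I: "\<pi>0 \<in> inj_maps C I" "\<pi>1 \<in> inj_maps C I" using tf Fib by blast+
    \<comment> \<open>The mapping path space of \<open>f\<close>.\<close>
    note \<pi>0D = homD[OF \<pi>01h(1)]
    obtain a b where N: "is_pullback C f \<pi>0 a b"
      using pullback_exists[OF univ category_axioms compl fA \<pi>0D(1)] \<pi>0D(3) Y_def by auto
    define Nn where "Nn = Dom C a"
    have abh: "a \<in> hom C Nn X" "b \<in> hom C Nn P" "f \<cdot> a = \<pi>0 \<cdot> b"
      using is_pullbackD[OF N] \<pi>0D(2) by (simp_all add: Nn_def X_def)
    have ind: "\<exists>h. h \<in> hom C Q Nn \<and> a \<cdot> h = x \<and> b \<cdot> h = y"
      if "x \<in> hom C Q X" "y \<in> hom C Q P" "f \<cdot> x = \<pi>0 \<cdot> y" for x y Q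
      by (rule is_pullback_induced[OF N _ _ that(3)]) (use that \<pi>0D(2) in \<open>auto simp: Nn_def X_def\<close>)
    have ind_eq: "h = h'" if "h \<in> hom C Q Nn" "h' \<in> hom C Q Nn" "a \<cdot> h = a \<cdot> h'" "b \<cdot> h = b \<cdot> h'" for h h' Q
      using is_pullback_eqI[OF N] that category_axioms by (simp add: Nn_def)
    define n where "n = \<pi>1 \<cdot> b"
    have nh: "n \<in> hom C Nn Y" using Comp_hom[OF abh(2) \<pi>01h(2)] by (simp add: n_def)
    have "lifts C i n" if i: "i \<in> I" for i
    proof (rule liftsI, unfold homD(2,3)[OF nh])
      note cD = cylinderD[OF i] and ih = I_hom[OF i]
      fix u v assume u: "u \<in> hom C (Dom C i) Nn" and v: "v \<in> hom C (Cod C i) Y" and sq: "n \<cdot> u = v \<cdot> i"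
      have bu: "b \<cdot> u \<in> hom C (Dom C i) P" and au: "a \<cdot> u \<in> hom C (Dom C i) X"
        using Comp_hom[OF u abh(2)] Comp_hom[OF u abh(1)] .
      have "\<pi>1 \<cdot> (b \<cdot> u) = v \<cdot> i" using Comp_assoc[OF u abh(2) \<pi>01h(2)] sq by (simp add: n_def)
      moreover have "lifts C i \<pi>1" using \<pi>I(2) i by (simp add: inj_maps_def RLP_def)
      ultimately obtain e where e: "e \<in> hom C (Cod C i) P" "e \<cdot> i = b \<cdot> u" "\<pi>1 \<cdot> e = v"
        using liftsD[of C i \<pi>1 "b \<cdot> u" v] bu v homD(2,3)[OF \<pi>01h(2)] by auto
      have \<pi>0e: "\<pi>0 \<cdot> e \<in> hom C (Cod C i) Y" using Comp_hom[OF e(1) \<pi>01h(1)] .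
      have "f \<cdot> (a \<cdot> u) = \<pi>0 \<cdot> e \<cdot> i"
        using Comp_assoc[OF u abh(1) fh] abh(3) Comp_assoc[OF u abh(2) \<pi>01h(1)]
          Comp_assoc[OF ih e(1) \<pi>01h(1)] e(2) by simp
      then obtain k h where k: "k \<in> hom C (Cod C i) X" "k \<cdot> i = a \<cdot> u"
        and h: "h \<in> hom C (Cyl i) Y" "h \<cdot> \<iota>0 i = f \<cdot> k" "h \<cdot> \<iota>1 i = \<pi>0 \<cdot> e"
        using W_E[OF f i, of "a \<cdot> u" "\<pi>0 \<cdot> e"] au \<pi>0e unfolding homD(2,3)[OF fh] by blast
      obtain s where s: "s \<in> hom C (Cyl i) (Cod C i)" "s \<cdot> \<iota>0 i = Id C (Cod C i)" "s \<cdot> \<iota>1 i = Id C (Cod C i)"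
        using cylinder_retraction[OF i] by blast
      have vs: "v \<cdot> s \<in> hom C (Cyl i) Y" using Comp_hom[OF s(1) v] .
      have vs0: "v \<cdot> s \<cdot> \<iota>0 i = v" and vs1: "v \<cdot> s \<cdot> \<iota>1 i = v"
        using Comp_assoc[OF cD(1) s(1) v] Comp_assoc[OF cD(2) s(1) v] s Comp_Id[OF v] by simp_all
      obtain d where d: "d \<in> hom C (Cyl i) YY" "p0 \<cdot> d = h" "p1 \<cdot> d = v \<cdot> s" using pair[OF h(1) vs] by blast
      have "\<pi> \<cdot> e = d \<cdot> \<iota>1 i"
      proof (rule pair_eq[OF Comp_hom[OF e(1) \<pi>h] Comp_hom[OF cD(2) d(1)]])
        show "p0 \<cdot> (\<pi> \<cdot> e) = p0 \<cdot> (d \<cdot> \<iota>1 i)"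
          using Comp_assoc[OF e(1) \<pi>h ph(1)] Comp_assoc[OF cD(2) d(1) ph(1)] d(2) h(3) by (simp add: \<pi>0_def)
        show "p1 \<cdot> (\<pi> \<cdot> e) = p1 \<cdot> (d \<cdot> \<iota>1 i)"
          using Comp_assoc[OF e(1) \<pi>h ph(2)] Comp_assoc[OF cD(2) d(1) ph(2)] d(3) vs1 e(3) by (simp add: \<pi>1_def)
      qed
      then obtain m where m: "m \<in> hom C (Cyl i) P" "m \<cdot> \<iota>1 i = e" "\<pi> \<cdot> m = d"
        using liftsD[OF cof_lifts[OF \<iota>1[OF i] c\<pi>(2)], of e d] e(1) d(1) homD(2,3)[OF \<pi>h] homD(2,3)[OF cD(2)]
        by auto
      have w: "m \<cdot> \<iota>0 i \<in> hom C (Cod C i) P" using Comp_hom[OF cD(1) m(1)] .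
      have w0: "\<pi>0 \<cdot> (m \<cdot> \<iota>0 i) = f \<cdot> k"
        using Comp_assoc[OF w \<pi>h ph(1)] Comp_assoc[OF cD(1) m(1) \<pi>h] m(3) Comp_assoc[OF cD(1) d(1) ph(1)]
          d(2) h(2) by (simp add: \<pi>0_def)
      have w1: "\<pi>1 \<cdot> (m \<cdot> \<iota>0 i) = v"
        using Comp_assoc[OF w \<pi>h ph(2)] Comp_assoc[OF cD(1) m(1) \<pi>h] m(3) Comp_assoc[OF cD(1) d(1) ph(2)]
          d(3) vs0 by (simp add: \<pi>1_def)
      have wi: "m \<cdot> \<iota>0 i \<cdot> i = b \<cdot> u"
        using Comp_assoc[OF ih cD(1) m(1)] Comp_assoc[OF ih cD(2) m(1)] cD(3) m(2) e(2) by simp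
      obtain x where x: "x \<in> hom C (Cod C i) Nn" "a \<cdot> x = k" "b \<cdot> x = m \<cdot> \<iota>0 i"
        using ind[OF k(1) w] w0 by auto
      have "x \<cdot> i = u"
        by (rule ind_eq[OF Comp_hom[OF ih x(1)] u])
          (use Comp_assoc[OF ih x(1) abh(1)] Comp_assoc[OF ih x(1) abh(2)] x k(2) wi in simp_all)
      moreover have "n \<cdot> x = v" using Comp_assoc[OF x(1) abh(2) \<pi>01h(2)] x(3) w1 by (simp add: n_def)
      ultimately show "\<exists>k\<in>hom C (Cod C i) Nn. k \<cdot> i = u \<and> n \<cdot> k = v" using x(1) by (intro bexI[of _ x] conjI)
    qed
    then have nI: "n \<in> inj_maps C I" using homD(1)[OF nh] by (simp add: inj_maps_def RLP_def)
    have "lifts C i a" if i: "i \<in> I" for i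
      using lifts_pullback[OF N, of i] \<pi>I(1) i I_Arr by (auto simp: inj_maps_def RLP_def)
    then have "a \<in> inj_maps C I" using homD(1)[OF abh(1)] by (simp add: inj_maps_def RLP_def)
    then have aV: "a \<in> V" using IV by blast
    have cf: "c \<cdot> f \<in> hom C X P" using Comp_hom[OF fh ch] .
    have "f \<cdot> Id C X = \<pi>0 \<cdot> (c \<cdot> f)"
      using Comp_assoc[OF fh ch \<pi>01h(1)] \<pi>c(1) Comp_Id[OF fh] Id_Comp[OF fh] by simp
    then obtain \<sigma> where \<sigma>: "\<sigma> \<in> hom C X Nn" "a \<cdot> \<sigma> = Id C X" "b \<cdot> \<sigma> = c \<cdot> f"
      using ind[OF Id_hom[OF XO] cf] by blast
    have "\<sigma> \<in> V" using cr[OF aV, of \<sigma>] \<sigma> Id_V[OF XO] homD[OF \<sigma>(1)] homD(2)[OF abh(1)] by simp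
    then have "n \<cdot> \<sigma> \<in> V" using comp[of \<sigma> n] IV nI homD(3)[OF \<sigma>(1)] homD(2)[OF nh] by auto
    moreover have "n \<cdot> \<sigma> = f"
      using Comp_assoc[OF \<sigma>(1) abh(2) \<pi>01h(2)] \<sigma>(3) Comp_assoc[OF fh ch \<pi>01h(2)] \<pi>c(2) Id_Comp[OF fh]
      by (simp add: n_def)
    ultimately show "f \<in> V" by simp
  qed
  then show ?thesis using VW by blast
qed

lemma cancellation_of_model_structure:
  assumes ms: "model_structure C Fib (cof C I) V" and triv: "cof C I \<inter> V = cof C J"
    and f: "f \<in> cell U C J \<union> W" and g: "g \<in> Arr C" "Cod C f = Dom C g" "g \<cdot> f \<in> W"
  shows "g \<in> W"
proof -
  have VW: "V = W" using weak_equivalences_eq_W[OF ms triv] .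
  have "cell U C J \<subseteq> W" using cell_cof[OF category_axioms J_Arr, of U] triv VW by blast
  then have "f \<in> W" using f by blast
  then show ?thesis
    using ms g W_Arr unfolding model_structure_def two_out_of_three_def VW by blast
qed

end


section \<open>The existence criterion\<close>

theorem theorem4p2:
  fixes C :: "('o, 'm) cat"
    and I :: "'m set"
    and Cyl :: "'m \<Rightarrow> 'o"
    and \<iota>0 \<iota>1 :: "'m \<Rightarrow> 'm"
  assumes "universe TYPE('u)"
    and "category C"
    and "locally_small TYPE('u) C"
    and "complete TYPE('u) C"
    and "cocomplete TYPE('u) C"
    and "I \<subseteq> Arr C"
    and "small TYPE('u) I"
    and "\<And>i. i \<in> I \<Longrightarrow> small_rel TYPE('u) C (cell TYPE('u) C I) (Dom C i)"
    and "\<And>i. i \<in> I \<Longrightarrow> small_rel TYPE('u) C (cell TYPE('u) C I) (Cod C i)"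
    and "\<And>i. i \<in> I \<Longrightarrow> reflexive_cylinder C i (Cyl i) (\<iota>0 i) (\<iota>1 i)"
    and "\<And>i. i \<in> I \<Longrightarrow> copair_in C (cof C I) i (Cyl i) (\<iota>0 i) (\<iota>1 i)"
  shows "(\<exists>Fib W. model_structure C Fib (cof C I) W \<and> cof C I \<inter> W = cof C (J_maps I \<iota>0)) \<longleftrightarrow>
    (\<forall>f g. f \<in> cell TYPE('u) C (J_maps I \<iota>0) \<union> W_maps C I Cyl \<iota>0 \<iota>1 \<and> g \<in> Arr C \<and>
       Cod C f = Dom C g \<and> g \<cdot>\<^bsub>C\<^esub> f \<in> W_maps C I Cyl \<iota>0 \<iota>1 \<longrightarrow>
       g \<in> W_maps C I Cyl \<iota>0 \<iota>1)"
proof -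
  interpret relative_cylinders C "TYPE('u)" I Cyl \<iota>0 \<iota>1
    by (rule relative_cylinders.intro[OF assms(2)], unfold_locales) (use assms in blast)+
  have Ifact: "\<exists>q \<in> cell TYPE('u) C I. \<exists>p \<in> inj_maps C I. Cod C q = Dom C p \<and> f = Comp C p q"
    if f: "f \<in> Arr C" for f
  proof -
    have "weakly_small TYPE('u) C (pushouts C I) (Dom C i)" if "i \<in> I" for i
      by (rule weakly_small_mono[OF small_rel_weakly_small[OF assms(2) assms(8)[OF that]]
            pushouts_cell[OF assms(2,1)]])
    then show ?thesis
      by (rule small_object_argument[OF assms(2,1,5,3,6,7) _ f]) blast+
  qed
  have Jfact: "\<exists>q \<in> cell TYPE('u) C J. \<exists>p \<in> inj_maps C J. Cod C q = Dom C p \<and> f = Comp C p q"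
    if f: "f \<in> Arr C" for f
  proof -
    have Js: "small TYPE('u) J"
      using small_image[OF assms(7), of \<iota>0] by (simp add: J_maps_def image_def setcompr_eq_image)
    have po: "pushouts C J \<subseteq> cof C I" using J_cof cof_pushout by (auto simp: pushouts_def)
    have "weakly_small TYPE('u) C (pushouts C J) (Dom C j)" if j: "j \<in> J" for j
    proof -
      obtain i where i: "i \<in> I" "j = \<iota>0 i" using j by (auto simp: J_maps_def)
      have "weakly_small TYPE('u) C (cof C I) (Cod C i)"
        by (rule weakly_small_cof[OF assms(2,1,5) Ifact small_rel_weakly_small[OF assms(2) assms(9)[OF i(1)]]])
      then show ?thesis using weakly_small_mono[OF _ po] i(2) homD(2)[OF cylinderD(1)[OF i(1)]] by simp
    qed
    then show ?thesis
      by (rule small_object_argument[OF assms(2,1,5,3) J_Arr Js _ f]) blast+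
  qed
  show ?thesis
  proof
    assume "\<exists>Fib W. model_structure C Fib (cof C I) W \<and> cof C I \<inter> W = cof C J"
    then obtain Fib V where ms: "model_structure C Fib (cof C I) V" "cof C I \<inter> V = cof C J" by blast
    show "\<forall>f g. f \<in> cell TYPE('u) C J \<union> W \<and> g \<in> Arr C \<and> Cod C f = Dom C g \<and> Comp C g f \<in> W \<longrightarrow> g \<in> W"
      using cancellation_of_model_structure[OF ms] by blast
  next
    assume "\<forall>f g. f \<in> cell TYPE('u) C J \<union> W \<and> g \<in> Arr C \<and> Cod C f = Dom C g \<and> Comp C g f \<in> W \<longrightarrow> g \<in> W"
    then have "model_structure C (inj_maps C J) (cof C I) W \<and> cof C I \<inter> W = cof C J"
      by (intro model_structure_of_cancellation Ifact Jfact) blast+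
    then show "\<exists>Fib W. model_structure C Fib (cof C I) W \<and> cof C I \<inter> W = cof C J" by blast
  qed
qed

end
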